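(* Let $a\in\mathbb{R}$ and $b\ge0$, and let $(\mathbb{X}_t)_{t\ge0}$ be a free Lévy process in $\mathcal{A}$ such that for all $t,s>0$ the increment $(\mathbb{X}_{t+s}-\mathbb{X}_t)/\sqrt{s}$ has the free Meixner law $\mu_{a/\sqrt{s},\,b/s}$. Then for all $t>0$ $$\tau(\mathbb{X}_t^3\,|\,\mathbb{X}_{2t})=\frac{1}{8(b+2t)^2}\Big(b^2\mathbb{X}_{2t}^3+4bat\,\mathbb{X}_{2t}^2+4(b+a^2)t^2\,\mathbb{X}_{2t}+8at^3\,\mathbb{I}\Big)+\frac18\mathbb{X}_{2t}^3+\frac{1}{4(b+2t)}\Big[4t^2\,\mathbb{X}_{2t}+2ta\,\mathbb{X}_{2t}^2+b\,\mathbb{X}_{2t}^3\Big].$$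
   Context: $\mathcal{A}$ is a von Neumann algebra with unit $\mathbb{I}$ and a normal faithful tracial state $\tau:\mathcal{A}\to\mathbb{C}$. A random variable is a self-adjoint element of $\mathcal{A}$; its law is the compactly supported probability measure on $\mathbb{R}$ with the same moments. Free Lévy process: a family $(\mathbb{X}_t)_{t\ge0}$ of self-adjoint elements of $\mathcal{A}$ with $\mathbb{X}_0=0$ having free and stationary additive increments: for $0\le t_1<\dots<t_n$ the increments $\mathbb{X}_{t_2}-\mathbb{X}_{t_1},\dots,\mathbb{X}_{t_n}-\mathbb{X}_{t_{n-1}}$ are free, and the law of $\mathbb{X}_{t+s}-\mathbb{X}_t$ depends only on $s$. Freeness is with respect to $\tau$ (equivalently, all mixed free cumulants vanish). Free Meixner laws: for $a\in\mathbb{R}$, $b\ge-1$, $\mu_{a,b}$ is the compactly supported probability measure on $\mathbb{R}$ with Cauchy–Stieltjes transform $$\int_{\mathbb{R}}\frac{1}{z-y}\,\mu_{a,b}(dy)=\frac{(1+2b)z+a-\sqrt{(z-a)^2-4(1+b)}}{2(bz^2+az+1)},\qquad \Im z>0,$$ the branch of the square root being such that the transform maps the upper half plane to the closed lower half plane. It has mean $0$ and variance $1$. Equivalently, its $\mathcal{R}$-transform $\sum_{i\ge0}R_{i+1}z^i$ ($R_i$ being its free cumulants) is $\dfrac{2z}{1-za+\sqrt{(1-za)^2-4z^2b}}$ for small $|z|$, with the root chosen so that it tends to $0$ as $z\to0$. Conditional expectation: for self-adjoint $\mathbb{V}\in\mathcal{A}$, $\tau(\cdot|\mathbb{V})$ is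 the unique $\tau$-preserving conditional expectation of $\mathcal{A}$ onto the von Neumann subalgebra $\mathcal{B}$ generated by $\mathbb{V}$ and $\mathbb{I}$, characterized by $\tau(\mathbb{U}\mathbb{W})=\tau(\tau(\mathbb{U}|\mathbb{V})\mathbb{W})$ for all $\mathbb{W}\in\mathcal{B}$. *)

theory Defs
  imports "HOL-Probability.Probability"
begin

section \<open>Complex Hilbert spaces\<close>

class complex_vector = real_vector +
  fixes scaleC :: "complex \<Rightarrow> 'a \<Rightarrow> 'a" (infixr "*\<^sub>C" 75)
  assumes scaleC_add_right: "c *\<^sub>C (x + y) = c *\<^sub>C x + c *\<^sub>C y"
    and scaleC_add_left: "(c + d) *\<^sub>C x = c *\<^sub>C x + d *\<^sub>C x"
    and scaleC_scaleC: "c *\<^sub>C d *\<^sub>C x = (c * d) *\<^sub>C x"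
    and scaleC_of_real: "complex_of_real r *\<^sub>C x = r *\<^sub>R x"

text \<open>The inner product is linear in the second argument. Positive definiteness is inherited
  from \<^class>\<open>real_inner\<close>, which also provides the norm.\<close>

class complex_inner = complex_vector + real_inner +
  fixes cinner :: "'a \<Rightarrow> 'a \<Rightarrow> complex"
  assumes cinner_add_right: "cinner x (y + z) = cinner x y + cinner x z"
    and cinner_scaleC_right: "cinner x (c *\<^sub>C y) = c * cinner x y"
    and cinner_commute: "cinner x y = cnj (cinner y x)"
    and Re_cinner: "Re (cinner x y) = inner x y"

class chilbert_space = complex_inner + complete_space


section \<open>The algebra of bounded operators\<close>

lemma scaleC_zero_right: "c *\<^sub>C (0::'a::complex_vector) = 0"
  using scaleC_add_right[of c 0 "0::'a"] by simp

lemma scaleC_minus_right: "c *\<^sub>C (- x) = - (c *\<^sub>C (x::'a::complex_vector))"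
  using scaleC_add_right[of c x "- x"]
  by (metis add.right_inverse minus_unique scaleC_zero_right)

lemma scaleC_diff_right: "c *\<^sub>C (x - y) = c *\<^sub>C x - c *\<^sub>C (y::'a::complex_vector)"
  using scaleC_add_right[of c x "- y"] by (simp add: scaleC_minus_right)

lemma scaleC_scaleR_commute: "c *\<^sub>C r *\<^sub>R x = r *\<^sub>R c *\<^sub>C (x::'a::complex_vector)"
  by (metis mult.commute scaleC_of_real scaleC_scaleC)

lemma norm_scaleC: "norm (c *\<^sub>C x) = cmod c * norm (x::'a::complex_inner)"
proof -
  have *: "cinner y y = complex_of_real ((norm y)\<^sup>2)" for y :: 'a
    using cinner_commute[of y y] Re_cinner[of y y]
    by (simp add: complex_eq_iff power2_norm_eq_inner)
  have "cinner (c *\<^sub>C x) (c *\<^sub>C x) = c * cnj c * cinner x x"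
    by (metis cinner_commute cinner_scaleC_right complex_cnj_mult mult.assoc)
  then have "(norm (c *\<^sub>C x))\<^sup>2 = (cmod c * norm x)\<^sup>2"
    unfolding * complex_norm_square[symmetric] of_real_mult[symmetric] of_real_eq_iff
    by (simp add: power_mult_distrib)
  then show ?thesis
    by (simp add: power2_eq_iff_nonneg)
qed

lemma bounded_linear_scaleC: "bounded_linear (\<lambda>x::'a::complex_inner. c *\<^sub>C x)"
  by (rule bounded_linear_intro[of _ "cmod c"])
    (simp_all add: scaleC_add_right scaleC_scaleR_commute norm_scaleC mult.commute)

typedef (overloaded) 'a bop =
  "{T :: 'a::complex_inner \<Rightarrow>\<^sub>L 'a. \<forall>c x. blinfun_apply T (c *\<^sub>C x) = c *\<^sub>C blinfun_apply T x}"
  by (intro exI[of _ 0]) (simp add: scaleC_zero_right)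

setup_lifting type_definition_bop

lift_definition bop_apply :: "'a::complex_inner bop \<Rightarrow> 'a \<Rightarrow> 'a" is blinfun_apply .

instantiation bop :: (complex_inner) real_algebra
begin

lift_definition zero_bop :: "'a bop" is 0
  by (simp add: scaleC_zero_right)

lift_definition plus_bop :: "'a bop \<Rightarrow> 'a bop \<Rightarrow> 'a bop" is "(+)"
  by (simp add: blinfun.add_left scaleC_add_right)

lift_definition uminus_bop :: "'a bop \<Rightarrow> 'a bop" is uminus
  by (simp add: blinfun.minus_left scaleC_minus_right)

lift_definition minus_bop :: "'a bop \<Rightarrow> 'a bop \<Rightarrow> 'a bop" is "(-)"
  by (simp add: blinfun.diff_left scaleC_diff_right)

lift_definition scaleR_bop :: "real \<Rightarrow> 'a bop \<Rightarrow> 'a bop" is scaleR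
  by (simp add: blinfun.scaleR_left scaleC_scaleR_commute)

lift_definition times_bop :: "'a bop \<Rightarrow> 'a bop \<Rightarrow> 'a bop" is "(o\<^sub>L)"
  by simp

instance
  by standard
    (transfer; rule blinfun_eqI; simp add: blinfun.bilinear_simps scaleR_add_right scaleR_add_left)+

end

text \<open>The class \<^class>\<open>real_algebra_1\<close> is not available, because \<open>0 = 1\<close> for operators
  on the zero space.\<close>

instantiation bop :: (complex_inner) monoid_mult
begin

lift_definition one_bop :: "'a bop" is id_blinfun
  by simp

instance
  by standard (transfer; rule blinfun_eqI; simp)+

end

instantiation bop :: (complex_inner) complex_vector
begin

lift_definition scaleC_bop :: "complex \<Rightarrow> 'a bop \<Rightarrow> 'a bop"
  is "\<lambda>c T. Blinfun (\<lambda>x. c *\<^sub>C x) o\<^sub>L T"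
  by (simp add: bounded_linear_Blinfun_apply bounded_linear_scaleC scaleC_scaleC mult.commute)

instance
  by standard
    (transfer; rule blinfun_eqI;
      simp add: bounded_linear_Blinfun_apply bounded_linear_scaleC blinfun.bilinear_simps
        scaleC_add_right scaleC_add_left scaleC_scaleC scaleC_of_real)+

end

definition adj :: "'a::chilbert_space bop \<Rightarrow> 'a bop" where
  "adj T = (THE S. \<forall>x y. cinner (bop_apply S x) y = cinner x (bop_apply T y))"

definition self_adjoint :: "'a::chilbert_space bop \<Rightarrow> bool" where
  "self_adjoint T \<longleftrightarrow> (\<forall>x y. cinner (bop_apply T x) y = cinner x (bop_apply T y))"


section \<open>Von Neumann algebras and normal faithful tracial states\<close>

definition commutant :: "'a::chilbert_space bop set \<Rightarrow> 'a bop set" where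
  "commutant M = {S. \<forall>T\<in>M. S * T = T * S}"

definition von_neumann_algebra :: "'a::chilbert_space bop set \<Rightarrow> bool" where
  "von_neumann_algebra M \<longleftrightarrow> (\<forall>T\<in>M. adj T \<in> M) \<and> commutant (commutant M) = M"

text \<open>Von Neumann algebras in the above sense contain the identity operator, so there is no need
  to add it to the generating set.\<close>

definition generated_vna :: "'a::chilbert_space bop set \<Rightarrow> 'a bop set" where
  "generated_vna S = \<Inter> {M. von_neumann_algebra M \<and> S \<subseteq> M}"

definition sigma_weak_topology :: "'a::chilbert_space bop topology" where
  "sigma_weak_topology = topology_generated_by
     {{T. (\<Sum>n. cinner (\<xi> n) (bop_apply T (\<eta> n))) \<in> U} | (\<xi> :: nat \<Rightarrow> 'a) \<eta> U.
        summable (\<lambda>n. (norm (\<xi> n))\<^sup>2) \<and> summable (\<lambda>n. (norm (\<eta> n))\<^sup>2) \<and> open U}"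

text \<open>A state is a functional on the carrier \<open>A\<close>; its values outside \<open>A\<close> are irrelevant.\<close>

definition normal_faithful_tracial_state ::
    "'a::chilbert_space bop set \<Rightarrow> ('a bop \<Rightarrow> complex) \<Rightarrow> bool" where
  "normal_faithful_tracial_state A \<tau> \<longleftrightarrow>
     (\<forall>S\<in>A. \<forall>T\<in>A. \<tau> (S + T) = \<tau> S + \<tau> T) \<and>
     (\<forall>c. \<forall>T\<in>A. \<tau> (c *\<^sub>C T) = c * \<tau> T) \<and>
     (\<forall>T\<in>A. \<tau> (adj T * T) \<in> \<real>\<^sub>\<ge>\<^sub>0) \<and>
     \<tau> 1 = 1 \<and>
     (\<forall>S\<in>A. \<forall>T\<in>A. \<tau> (S * T) = \<tau> (T * S)) \<and>
     (\<forall>T\<in>A. \<tau> (adj T * T) = 0 \<longrightarrow> T = 0) \<and>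
     continuous_map (subtopology sigma_weak_topology A) euclidean \<tau>"

text \<open>The conditional expectation of \<open>U\<close> given a self-adjoint \<open>V\<close>; uniqueness follows from the
  faithfulness of \<open>\<tau>\<close>.\<close>

definition cond_expectation ::
    "('a::chilbert_space bop \<Rightarrow> complex) \<Rightarrow> 'a bop \<Rightarrow> 'a bop \<Rightarrow> 'a bop" where
  "cond_expectation \<tau> U V =
     (THE E. E \<in> generated_vna {V} \<and> (\<forall>W\<in>generated_vna {V}. \<tau> (U * W) = \<tau> (E * W)))"


section \<open>Laws, freeness and free Levy processes\<close>

definition compactly_supported :: "real measure \<Rightarrow> bool" where
  "compactly_supported \<mu> \<longleftrightarrow> (\<exists>K. compact K \<and> (AE y in \<mu>. y \<in> K))"

definition is_law :: "('a::chilbert_space bop \<Rightarrow> complex) \<Rightarrow> 'a bop \<Rightarrow> real measure \<Rightarrow> bool" where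
  "is_law \<tau> T \<mu> \<longleftrightarrow> real_distribution \<mu> \<and> compactly_supported \<mu> \<and>
     (\<forall>n. \<tau> (T ^ n) = complex_of_real (\<integral>y. y ^ n \<partial>\<mu>))"

text \<open>For self-adjoint \<open>T\<close> this is the unital *-algebra generated by \<open>T\<close>.\<close>

definition generated_algebra :: "'a::chilbert_space bop \<Rightarrow> 'a bop set" where
  "generated_algebra T = {\<Sum>k\<le>n. c k *\<^sub>C T ^ k | (n::nat) (c :: nat \<Rightarrow> complex). True}"

definition free_algebras ::
    "('a::chilbert_space bop \<Rightarrow> complex) \<Rightarrow> 'i set \<Rightarrow> ('i \<Rightarrow> 'a bop set) \<Rightarrow> bool" where
  "free_algebras \<tau> I \<B> \<longleftrightarrow>
     (\<forall>is Ts. is \<noteq> [] \<and> set is \<subseteq> I \<and> distinct_adj is \<and> length Ts = length is \<and>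
        (\<forall>k<length is. Ts ! k \<in> \<B> (is ! k) \<and> \<tau> (Ts ! k) = 0) \<longrightarrow> \<tau> (prod_list Ts) = 0)"

definition free_elements ::
    "('a::chilbert_space bop \<Rightarrow> complex) \<Rightarrow> 'i set \<Rightarrow> ('i \<Rightarrow> 'a bop) \<Rightarrow> bool" where
  "free_elements \<tau> I T \<longleftrightarrow> free_algebras \<tau> I (\<lambda>i. generated_algebra (T i))"

definition free_levy_process ::
    "'a::chilbert_space bop set \<Rightarrow> ('a bop \<Rightarrow> complex) \<Rightarrow> (real \<Rightarrow> 'a bop) \<Rightarrow> bool" where
  "free_levy_process A \<tau> X \<longleftrightarrow>
     (\<forall>t\<ge>0. X t \<in> A \<and> self_adjoint (X t)) \<and>
     X 0 = 0 \<and>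
     (\<forall>(t :: nat \<Rightarrow> real) n. 0 \<le> t 0 \<and> (\<forall>i<n. t i < t (Suc i)) \<longrightarrow>
        free_elements \<tau> {..<n} (\<lambda>i. X (t (Suc i)) - X (t i))) \<and>
     (\<exists>\<nu>. \<forall>t\<ge>0. \<forall>s\<ge>0. is_law \<tau> (X (t + s) - X t) (\<nu> s))"


section \<open>Free Meixner laws\<close>

definition cauchy_transform :: "real measure \<Rightarrow> complex \<Rightarrow> complex" where
  "cauchy_transform \<mu> z = (\<integral>y. 1 / (z - complex_of_real y) \<partial>\<mu>)"

text \<open>The function \<open>r\<close> is the branch of the square root. The zeros of \<open>b z\<^sup>2 + a z + 1\<close> in the
  upper half plane have to be left out: they are removable singularities of the quotient, to which
  HOL assigns the value 0.\<close>

definition free_meixner :: "real \<Rightarrow> real \<Rightarrow> real measure \<Rightarrow> bool" where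
  "free_meixner a b \<mu> \<longleftrightarrow> real_distribution \<mu> \<and> compactly_supported \<mu> \<and>
     (\<exists>r. r holomorphic_on {z. Im z > 0} \<and>
        (\<forall>z. Im z > 0 \<longrightarrow> (r z)\<^sup>2 = (z - of_real a)\<^sup>2 - 4 * (1 + of_real b)) \<and>
        (\<forall>z. Im z > 0 \<longrightarrow> Im (cauchy_transform \<mu> z) \<le> 0) \<and>
        (\<forall>z. Im z > 0 \<and> of_real b * z\<^sup>2 + of_real a * z + 1 \<noteq> 0 \<longrightarrow>
           cauchy_transform \<mu> z =
             ((1 + 2 * of_real b) * z + of_real a - r z) /
             (2 * (of_real b * z\<^sup>2 + of_real a * z + 1))))"

definition has_free_meixner_law ::
    "('a::chilbert_space bop \<Rightarrow> complex) \<Rightarrow> 'a bop \<Rightarrow> real \<Rightarrow> real \<Rightarrow> bool" where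
  "has_free_meixner_law \<tau> T a b \<longleftrightarrow> (\<exists>\<mu>. free_meixner a b \<mu> \<and> is_law \<tau> T \<mu>)"

end

theory Submission
  imports Defs "HOL-Complex_Analysis.Cauchy_Integral_Formula"
begin

text \<open>Write \<open>U\<close> and \<open>V\<close> for the two increments and \<open>S = U + V = X (2 * t)\<close>. Let \<open>G\<close> be the Cauchy
  transform of \<open>S\<close> and put \<open>\<omega> = (w + 1 / G w) / 2\<close>. The quadratic equations of the free Meixner laws
  give \<open>\<tau> ((\<omega> - U)\<^sup>-\<^sup>1) = G w\<close>, and the same for \<open>V\<close>. With the centred elements \<open>a\<close>, \<open>b\<close> defined by
  \<open>(\<omega> - U)\<^sup>-\<^sup>1 = G w (1 + a)\<close> and \<open>(\<omega> - V)\<^sup>-\<^sup>1 = G w (1 + b)\<close> one has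
  \<open>(w - S)\<^sup>-\<^sup>1 = G w (1 + b) (1 - a b)\<^sup>-\<^sup>1 (1 + a)\<close>, and freeness yields
  \<open>\<tau> (p(U) (w - S)\<^sup>-\<^sup>1) = \<tau> (p(U) (\<omega> - U)\<^sup>-\<^sup>1)\<close>. For \<open>p(U) = U\<^sup>3\<close> this determines all
  \<open>\<tau> (U\<^sup>3 S\<^sup>n)\<close>. Resolvents are treated as formal power series in \<open>z = 1 / w\<close>, with \<open>q = 1 / \<omega>\<close>.
  Von Neumann's density theorem passes from the powers of \<open>S\<close> to the von Neumann algebra
  generated by \<open>S\<close>.\<close>


section \<open>Hilbert space geometry\<close>

text \<open>The formula for \<omega> is that of additive free convolution: the two subordination
  functions add up to \<open>w + 1 / G w\<close>, and they coincide because both increments have the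
  same law. Since \<omega> is thus explicit, no fixed point has to be found, and the claim about it
  is checked by algebra on quadratic equations. Freeness is used through the vanishing of
  alternating centred words, without cumulants. The quadratic equation of \<open>G\<close> is also
  the reason why the answer is a cubic in \<open>S\<close>: it makes \<tau> of \<open>U ^ 3\<close>
  times the resolvent of \<open>S\<close> a combination of the same expressions for
  \<open>1, S, S ^ 2, S ^ 3\<close>.

  Formal series fit because their coefficients are exactly the required moment identities: series
  with constant term 1 are invertible, and iterating in \<open>a b\<close> raises the order.

  The remaining obstacle is analytic. A conditional expectation is tested against a whole von
  Neumann algebra, and normality refers to countable sums of vector functionals. Such a sum is a
  single vector functional on square summable sequences of vectors, which is why that Hilbert space
  is built and the density argument is carried out there.\<close>

lemma norm_diff_scaleR_squared:
  fixes u m :: "'a::real_inner"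
  shows "(norm (u - s *\<^sub>R m))\<^sup>2 = (norm u)\<^sup>2 - 2 * s * inner u m + s\<^sup>2 * (norm m)\<^sup>2"
  unfolding power2_norm_eq_inner
  by (simp add: inner_diff_left inner_diff_right inner_commute power2_eq_square algebra_simps)

text \<open>A quadratic polynomial in \<open>s\<close> that is smallest at \<open>s = 0\<close> has
  no linear term; inserting its true minimiser makes this visible.\<close>

lemma minimal_norm_orthogonal:
  fixes u m :: "'a::real_inner"
  assumes "\<And>s. (norm u)\<^sup>2 \<le> (norm (u - s *\<^sub>R m))\<^sup>2"
  shows "inner u m = 0"
proof (cases "m = 0")
  case False
  then have m: "(norm m)\<^sup>2 > 0" by simp
  define s where "s = inner u m / (norm m)\<^sup>2"
  have "0 \<le> s\<^sup>2 * (norm m)\<^sup>2 - 2 * s * inner u m"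
    using assms[of s] unfolding norm_diff_scaleR_squared by simp
  also have "\<dots> = - (inner u m)\<^sup>2 / (norm m)\<^sup>2"
    using m by (simp add: s_def power2_eq_square field_simps)
  finally have "(inner u m)\<^sup>2 \<le> 0" using m
    by (simp add: divide_simps split: if_splits)
  then show ?thesis by simp
qed simp

text \<open>A minimising sequence is Cauchy by the parallelogram law, and its limit attains the
  distance. Real subspaces and the real inner product suffice here; complex linearity is recovered
  later from uniqueness of the projection.\<close>

lemma closed_subspace_projection:
  fixes M :: "'a::{real_inner, complete_space} set"
  assumes M: "subspace M" "closed M"
  obtains p where "p \<in> M" "\<And>m. m \<in> M \<Longrightarrow> inner (x - p) m = 0"
proof -
  define D where "D = (\<lambda>m. (norm (x - m))\<^sup>2) ` M"
  define d where "d = Inf D"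
  have ne: "D \<noteq> {}" using subspace_0[OF M(1)] by (auto simp: D_def)
  have bdd: "bdd_below D" by (rule bdd_belowI[of _ 0]) (auto simp: D_def)
  have lower: "d \<le> (norm (x - m))\<^sup>2" if "m \<in> M" for m
    unfolding d_def by (rule cInf_lower[OF _ bdd]) (use that in \<open>auto simp: D_def\<close>)
  have "\<exists>m\<in>M. (norm (x - m))\<^sup>2 < d + 1 / real (Suc n)" for n
    using cInf_lessD[OF ne, of "d + 1 / real (Suc n)"] by (auto simp: d_def D_def)
  then obtain f where f: "\<And>n. f n \<in> M" "\<And>n. (norm (x - f n))\<^sup>2 < d + 1 / real (Suc n)"
    by metis
  have dist_f: "(dist (f n) (f k))\<^sup>2 \<le> 2 / real (Suc n) + 2 / real (Suc k)" for n k
  proof -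
    \<comment> \<open>The midpoint lies in \<open>M\<close>, so its squared distance to
      \<open>x\<close> is at least \<open>d\<close>. The parallelogram law then forces two almost
      minimal points to be close to each other.\<close>
    have "(1/2) *\<^sub>R (f n + f k) \<in> M"
      by (intro subspace_scale subspace_add M f)
    then have *: "4 * d \<le> (norm (2 *\<^sub>R x - (f n + f k)))\<^sup>2"
      using lower[of "(1/2) *\<^sub>R (f n + f k)"]
      by (simp add: power2_norm_eq_inner inner_simps inner_commute field_simps)
    have "(dist (f n) (f k))\<^sup>2 + (norm (2 *\<^sub>R x - (f n + f k)))\<^sup>2
        = 2 * (norm (x - f n))\<^sup>2 + 2 * (norm (x - f k))\<^sup>2"
      by (simp add: dist_norm power2_norm_eq_inner inner_simps inner_commute algebra_simps)
    then show ?thesis using f(2)[of n] f(2)[of k] * by simp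
  qed
  have "Cauchy f"
  proof (rule metric_CauchyI)
    fix e :: real assume e: "e > 0"
    then obtain N where N: "inverse (real (Suc N)) < e\<^sup>2 / 4"
      using reals_Archimedean[of "e\<^sup>2 / 4"] by auto
    show "\<exists>N. \<forall>m\<ge>N. \<forall>n\<ge>N. dist (f m) (f n) < e"
    proof (intro exI allI impI)
      fix m n assume "N \<le> m" "N \<le> n"
      then have "1 / real (Suc m) \<le> 1 / real (Suc N)" "1 / real (Suc n) \<le> 1 / real (Suc N)"
        by (simp_all add: frac_le)
      then have "(dist (f m) (f n))\<^sup>2 < e\<^sup>2"
        using dist_f[of m n] N by (simp add: inverse_eq_divide)
      then show "dist (f m) (f n) < e" using e by (simp add: power2_less_imp_less)
    qed
  qed
  then obtain p where p: "f \<longlonglongrightarrow> p" by (auto simp: Cauchy_convergent_iff convergent_def)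
  have pM: "p \<in> M" using closed_sequentially[OF M(2) _ p] f(1) by blast
  have "(\<lambda>n. (norm (x - f n))\<^sup>2) \<longlonglongrightarrow> (norm (x - p))\<^sup>2" by (intro tendsto_intros p)
  moreover have "(\<lambda>n. d + 1 / real (Suc n)) \<longlonglongrightarrow> d + 0"
    by (intro tendsto_intros LIMSEQ_Suc[OF lim_1_over_n])
  ultimately have "(norm (x - p))\<^sup>2 \<le> d"
    using LIMSEQ_le[of "\<lambda>n. (norm (x - f n))\<^sup>2" _ "\<lambda>n. d + 1 / real (Suc n)" "d + 0"] f(2)
    by (auto intro: less_imp_le)
  then have "inner (x - p) m = 0" if "m \<in> M" for m
  proof (intro minimal_norm_orthogonal)
    fix s
    have "p + s *\<^sub>R m \<in> M" by (intro subspace_add subspace_scale M pM that)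
    from lower[OF this] \<open>(norm (x - p))\<^sup>2 \<le> d\<close>
    show "(norm (x - p))\<^sup>2 \<le> (norm (x - p - s *\<^sub>R m))\<^sup>2"
      unfolding diff_diff_eq by linarith
  qed
  with pM that show thesis by blast
qed

text \<open>The kernel has a one-dimensional orthogonal complement, spanned by the component
  \<open>w\<close> of a vector outside the kernel. Subtracting \<open>(f y / f w)\<close> times
  \<open>w\<close> from \<open>y\<close> lands in the kernel.\<close>

lemma riesz_representation:
  fixes f :: "'a::{real_inner, complete_space} \<Rightarrow> real"
  assumes "bounded_linear f"
  obtains v where "\<And>y. f y = inner v y"
proof (cases "\<forall>y. f y = 0")
  case True
  with that[of 0] show thesis by simp
next
  case False
  then obtain u where u: "f u \<noteq> 0" by blast
  interpret f: bounded_linear f by fact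
  define M where "M = {y. f y = 0}"
  have "subspace M" by (auto simp: M_def subspace_def f.add f.scaleR f.zero)
  moreover have "closed M"
    unfolding M_def by (intro closed_Collect_eq continuous_on_const f.continuous_on continuous_on_id)
  ultimately obtain p where p: "p \<in> M" and orth: "\<And>m. m \<in> M \<Longrightarrow> inner (u - p) m = 0"
    by (rule closed_subspace_projection[where x = u]) blast
  define w where "w = u - p"
  have fw: "f w \<noteq> 0" using u p by (simp add: w_def f.diff M_def)
  then have w: "inner w w \<noteq> 0" using f.zero by (metis inner_eq_zero_iff)
  have "f y = inner ((f w / inner w w) *\<^sub>R w) y" for y
  proof -
    have "y - (f y / f w) *\<^sub>R w \<in> M" using fw by (simp add: M_def f.diff f.scaleR)
    from orth[OF this] have "inner w y = (f y / f w) * inner w w"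
      by (simp add: w_def[symmetric] inner_diff_right)
    with w fw show ?thesis by simp
  qed
  then show thesis by (rule that)
qed

text \<open>A complex inner product is determined by its real part. This transfers Riesz
  representation and orthogonality from the real to the complex setting.\<close>

lemma cinner_eq_Complex_inner:
  "cinner x y = Complex (inner x y) (- inner x (\<i> *\<^sub>C y))"
  using Re_cinner[of x "\<i> *\<^sub>C y"] by (simp add: complex_eq_iff Re_cinner cinner_scaleC_right)

lemma cinner_diff_right: "cinner x (y - z) = cinner x y - cinner x (z::'a::complex_inner)"
  using cinner_add_right[of x "y - z" z] by simp

lemma cinner_ext:
  fixes x y :: "'a::complex_inner"
  assumes "\<And>z. cinner x z = cinner y z"
  shows "x = y"
proof -
  have "inner x z = inner y z" for z using assms[of z] by (metis Re_cinner)
  then show ?thesis using vector_eq_rdot[of x y] by (simp add: inner_commute)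
qed

lemma norm_cinner_le: "cmod (cinner x y) \<le> norm x * norm (y::'a::complex_inner)"
proof (cases "cinner x y = 0")
  case False
  \<comment> \<open>A unimodular factor that rotates the inner product onto the positive real axis,
    where the real Cauchy-Schwarz inequality applies.\<close>
  define c where "c = cnj (cinner x y) / cmod (cinner x y)"
  have c: "c * cinner x y = cmod (cinner x y)"
    using False by (simp add: c_def complex_norm_square[symmetric] mult.commute power2_eq_square)
  have "cmod (cinner x y) = Re (cinner x (c *\<^sub>C y))" by (simp add: cinner_scaleC_right c)
  also have "\<dots> \<le> norm x * norm (c *\<^sub>C y)" unfolding Re_cinner by (rule norm_cauchy_schwarz)
  also have "norm (c *\<^sub>C y) = norm y" using False by (simp add: norm_scaleC c_def norm_divide)
  finally show ?thesis .
qed simp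


section \<open>Bounded operators and adjoints\<close>

lemma scaleC_zero_left: "(0::complex) *\<^sub>C x = (0::'a::complex_vector)"
  using scaleC_of_real[of 0 x] by simp

lemma scaleC_sum_left: "(\<Sum>i\<in>I. f i) *\<^sub>C (x::'a::complex_vector) = (\<Sum>i\<in>I. f i *\<^sub>C x)"
  by (induction I rule: infinite_finite_induct) (simp_all add: scaleC_zero_left scaleC_add_left)

lemma scaleC_sum_right: "c *\<^sub>C (\<Sum>i\<in>I. f i) = (\<Sum>i\<in>I. c *\<^sub>C (f i::'a::complex_vector))"
  by (induction I rule: infinite_finite_induct) (simp_all add: scaleC_zero_right scaleC_add_right)

lemma scaleC_one: "(1::complex) *\<^sub>C x = (x::'a::complex_vector)"
  using scaleC_of_real[of 1 x] by simp

lemma bounded_linear_bop_apply: "bounded_linear (bop_apply T)"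
  by (simp add: bop_apply.rep_eq blinfun.bounded_linear_right)

lemma bop_apply_scaleC: "bop_apply T (c *\<^sub>C x) = c *\<^sub>C bop_apply T x"
  by transfer blast

lemma bop_eqI: "(\<And>x. bop_apply S x = bop_apply T x) \<Longrightarrow> S = T"
  by transfer (auto intro: blinfun_eqI)

lemma bop_apply_simps [simp]:
  "bop_apply (S + T) x = bop_apply S x + bop_apply T x"
  "bop_apply (S - T) x = bop_apply S x - bop_apply T x"
  "bop_apply (S * T) x = bop_apply S (bop_apply T x)"
  "bop_apply 0 x = 0"
  "bop_apply 1 x = x"
  "bop_apply (r *\<^sub>R T) x = r *\<^sub>R bop_apply T x"
  "bop_apply (c *\<^sub>C T) x = c *\<^sub>C bop_apply T x"
  by (transfer; simp add: blinfun.bilinear_simps bounded_linear_Blinfun_apply bounded_linear_scaleC)+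

lemma scaleC_bop_mult_left: "(c *\<^sub>C S) * T = c *\<^sub>C (S * (T::'a::complex_inner bop))"
  by (rule bop_eqI) simp

lemma scaleC_bop_mult_right: "S * (c *\<^sub>C T) = c *\<^sub>C (S * (T::'a::complex_inner bop))"
  by (rule bop_eqI) (simp add: bop_apply_scaleC)

lemma bop_exists:
  assumes "bounded_linear f" "\<And>c x. f (c *\<^sub>C x) = c *\<^sub>C f x"
  obtains T where "\<And>x. bop_apply T x = f x"
proof -
  have "bop_apply (Abs_bop (Blinfun f)) x = f x" for x
    using assms by (simp add: bop_apply.rep_eq Abs_bop_inverse bounded_linear_Blinfun_apply)
  then show thesis by (rule that)
qed

lemma bop_bound:
  fixes T :: "'a::complex_inner bop"
  obtains K where "K \<ge> 0" "\<And>x. norm (bop_apply T x) \<le> K * norm x"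
proof -
  interpret bounded_linear "bop_apply T" by (rule bounded_linear_bop_apply)
  show thesis using nonneg_bounded that by (metis mult.commute)
qed

text \<open>\<open>adj\<close> is a definite description, so it has its meaning only after existence
  and uniqueness are settled. Existence is Riesz representation of the real functional
  \<open>inner x (bop_apply T y)\<close> in \<open>y\<close>; the bound comes from Cauchy-Schwarz
  applied to the squared norm of \<open>f x\<close>.\<close>

lemma cinner_adj:
  fixes T :: "'a::chilbert_space bop"
  shows "cinner (bop_apply (adj T) x) y = cinner x (bop_apply T y)"
proof -
  interpret T: bounded_linear "bop_apply T" by (rule bounded_linear_bop_apply)
  have "\<exists>v. \<forall>y. cinner v y = cinner x (bop_apply T y)" for x
  proof -
    obtain v where v: "\<And>y. inner x (bop_apply T y) = inner v y"
      using riesz_representation[OF bounded_linear_compose[OF bounded_linear_inner_right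
            bounded_linear_bop_apply[of T]], of x] by blast
    show ?thesis
      by (intro exI[of _ v]) (simp add: cinner_eq_Complex_inner v bop_apply_scaleC[symmetric])
  qed
  then obtain f where f: "\<And>x y. cinner (f x) y = cinner x (bop_apply T y)" by metis
  have left: "cinner (x + y) z = cinner x z + cinner y z"
    "cinner (c *\<^sub>C x) z = cnj c * cinner x z" for x y z :: 'a and c
    by (simp_all add: cinner_commute[of _ z] cinner_add_right cinner_scaleC_right)
  obtain K where K: "K \<ge> 0" "\<And>x. norm (bop_apply T x) \<le> K * norm x" by (rule bop_bound[of T]) blast
  have fC: "f (c *\<^sub>C x) = c *\<^sub>C f x" for c x
    by (rule cinner_ext) (simp add: f left)
  have "bounded_linear f"
  proof (rule bounded_linear_intro)
    show "f (x + y) = f x + f y" for x y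
      by (rule cinner_ext) (simp add: f left)
    show "f (r *\<^sub>R x) = r *\<^sub>R f x" for r x
      using fC[of "of_real r" x] by (simp add: scaleC_of_real)
    show "norm (f x) \<le> norm x * K" for x
    proof -
      have "(norm (f x))\<^sup>2 = Re (cinner x (bop_apply T (f x)))"
        by (simp only: f[symmetric] Re_cinner power2_norm_eq_inner)
      also have "\<dots> \<le> norm x * norm (bop_apply T (f x))"
        unfolding Re_cinner by (rule norm_cauchy_schwarz)
      also have "\<dots> \<le> norm x * (K * norm (f x))" by (intro mult_left_mono K) simp
      finally have "norm (f x) * norm (f x) \<le> (norm x * K) * norm (f x)"
        by (simp add: power2_eq_square mult.assoc)
      then show ?thesis using K(1) by (cases "norm (f x) = 0") (auto simp: mult_le_cancel_right)
    qed
  qed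
  then obtain S where S: "\<And>x. bop_apply S x = f x" using fC by (rule bop_exists) blast
  have "adj T = S"
    unfolding adj_def
  proof (rule the_equality)
    show "\<forall>x y. cinner (bop_apply S x) y = cinner x (bop_apply T y)" by (simp add: S f)
    show "S' = S" if "\<forall>x y. cinner (bop_apply S' x) y = cinner x (bop_apply T y)" for S'
      by (intro bop_eqI cinner_ext) (simp add: that S f)
  qed
  then show ?thesis by (simp add: S f)
qed

lemma cinner_adj_right:
  "cinner x (bop_apply (adj T) y) = cinner (bop_apply T x) (y::'a::chilbert_space)"
  by (metis cinner_adj cinner_commute)

lemma bop_eqI_cinner:
  fixes S T :: "'a::chilbert_space bop"
  assumes "\<And>x y. cinner (bop_apply S x) y = cinner (bop_apply T x) y"
  shows "S = T"
  by (intro bop_eqI cinner_ext assms)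


section \<open>Von Neumann algebras\<close>

lemma commutant_closed:
  fixes M :: "'a::chilbert_space bop set"
  shows "0 \<in> commutant M" "1 \<in> commutant M"
    "S \<in> commutant M \<Longrightarrow> T \<in> commutant M \<Longrightarrow> S + T \<in> commutant M"
    "S \<in> commutant M \<Longrightarrow> T \<in> commutant M \<Longrightarrow> S - T \<in> commutant M"
    "S \<in> commutant M \<Longrightarrow> T \<in> commutant M \<Longrightarrow> S * T \<in> commutant M"
    "S \<in> commutant M \<Longrightarrow> c *\<^sub>C S \<in> commutant M"
  unfolding commutant_def mem_Collect_eq
  by (simp_all add: distrib_left distrib_right left_diff_distrib right_diff_distrib
      scaleC_bop_mult_left scaleC_bop_mult_right)
    (metis (no_types) mult.assoc)

lemma vna_closed:
  fixes M :: "'a::chilbert_space bop set"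
  assumes "von_neumann_algebra M"
  shows "0 \<in> M" "1 \<in> M"
    "S \<in> M \<Longrightarrow> T \<in> M \<Longrightarrow> S + T \<in> M"
    "S \<in> M \<Longrightarrow> T \<in> M \<Longrightarrow> S - T \<in> M"
    "S \<in> M \<Longrightarrow> T \<in> M \<Longrightarrow> S * T \<in> M"
    "S \<in> M \<Longrightarrow> c *\<^sub>C S \<in> M"
    "S \<in> M \<Longrightarrow> r *\<^sub>R S \<in> M"
    "S \<in> M \<Longrightarrow> S ^ n \<in> M"
    "S \<in> M \<Longrightarrow> adj S \<in> M"
proof -
  have M: "M = commutant (commutant M)" and "\<And>S. S \<in> M \<Longrightarrow> adj S \<in> M"
    using assms unfolding von_neumann_algebra_def by blast+
  note c = commutant_closed[where M = "commutant M", folded M]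
  show "0 \<in> M" "1 \<in> M" by (rule c)+
  show "S \<in> M \<Longrightarrow> T \<in> M \<Longrightarrow> S + T \<in> M"
    "S \<in> M \<Longrightarrow> T \<in> M \<Longrightarrow> S - T \<in> M"
    "S \<in> M \<Longrightarrow> T \<in> M \<Longrightarrow> S * T \<in> M"
    "S \<in> M \<Longrightarrow> c *\<^sub>C S \<in> M" for S T c by (rule c; assumption)+
  then show "S \<in> M \<Longrightarrow> r *\<^sub>R S \<in> M" by (metis scaleC_of_real)
  show "S \<in> M \<Longrightarrow> S ^ n \<in> M" by (induction n) (simp_all add: c)
  show "S \<in> M \<Longrightarrow> adj S \<in> M" by fact
qed

lemma commutant_antimono: "M \<subseteq> N \<Longrightarrow> commutant N \<subseteq> commutant M"
  by (auto simp: commutant_def)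

lemma subset_bicommutant: "M \<subseteq> commutant (commutant M)"
  by (rule subsetI) (simp add: commutant_def)

lemma commutant_triple: "commutant (commutant (commutant M)) = commutant M"
  by (intro subset_antisym subset_bicommutant commutant_antimono)

text \<open>Self-adjointness of \<open>S\<close> makes the commutant of \<open>S\<close> closed
  under adjoints, and this passes to the bicommutant. The purpose is an upper bound: everything in
  \<open>generated_vna {S}\<close> commutes with all operators that commute with
  \<open>S\<close>.\<close>

lemma bicommutant_self_adjoint_vna:
  assumes "self_adjoint S"
  shows "von_neumann_algebra (commutant (commutant {S}))"
  unfolding von_neumann_algebra_def
proof (intro conjI ballI)
  fix T assume T: "T \<in> commutant (commutant {S})"
  show "adj T \<in> commutant (commutant {S})"
    unfolding commutant_def[of "commutant {S}"]
  proof (intro CollectI ballI)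
    fix R assume R: "R \<in> commutant {S}"
    have sa: "cinner (bop_apply S x) y = cinner x (bop_apply S y)" for x y
      using assms by (simp add: self_adjoint_def)
    have RS: "bop_apply R (bop_apply S x) = bop_apply S (bop_apply R x)" for x
      using R unfolding commutant_def by (auto simp flip: bop_apply_simps(3))
    have "adj R * S = S * adj R"
      by (rule bop_eqI_cinner) (simp add: cinner_adj sa RS)
    then have "adj R \<in> commutant {S}" by (simp add: commutant_def)
    then have "T * adj R = adj R * T" using T by (simp add: commutant_def)
    then have TR: "bop_apply T (bop_apply (adj R) x) = bop_apply (adj R) (bop_apply T x)" for x
      by (simp flip: bop_apply_simps(3))
    show "adj T * R = R * adj T"
      by (rule bop_eqI_cinner)
        (simp add: cinner_adj cinner_adj_right[of _ R, symmetric] TR)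
  qed
next
  show "commutant (commutant (commutant (commutant {S}))) = commutant (commutant {S})"
    by (simp only: commutant_triple)
qed

lemma generated_vna_closed:
  fixes V :: "'a::chilbert_space bop"
  shows "V \<in> generated_vna {V}" "1 \<in> generated_vna {V}"
    "S \<in> generated_vna {V} \<Longrightarrow> T \<in> generated_vna {V} \<Longrightarrow> S + T \<in> generated_vna {V}"
    "S \<in> generated_vna {V} \<Longrightarrow> T \<in> generated_vna {V} \<Longrightarrow> S - T \<in> generated_vna {V}"
    "S \<in> generated_vna {V} \<Longrightarrow> r *\<^sub>R S \<in> generated_vna {V}"
    "S \<in> generated_vna {V} \<Longrightarrow> S ^ n \<in> generated_vna {V}"
    "S \<in> generated_vna {V} \<Longrightarrow> adj S \<in> generated_vna {V}"
  by (auto simp: generated_vna_def vna_closed)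

lemma generated_vna_subset: "von_neumann_algebra M \<Longrightarrow> V \<in> M \<Longrightarrow> generated_vna {V} \<subseteq> M"
  by (auto simp: generated_vna_def)


section \<open>Square summable sequences in a Hilbert space\<close>

text \<open>The Hilbert space sum of countably many copies of the given space. The functionals that
  define the sigma-weak topology are the vector functionals \<langle>\<xi>, (T \<otimes> 1)
  \<eta>\<rangle> with \<xi> and \<eta> in this space.\<close>

typedef (overloaded) 'a l2seq = "{f :: nat \<Rightarrow> 'a::complex_inner. summable (\<lambda>n. (norm (f n))\<^sup>2)}"
  by (intro exI[of _ "\<lambda>_. 0"]) simp

setup_lifting type_definition_l2seq

lift_definition l2nth :: "'a::complex_inner l2seq \<Rightarrow> nat \<Rightarrow> 'a" is "\<lambda>f. f" .

lemma l2_summable: "summable (\<lambda>n. (norm (l2nth x n))\<^sup>2)"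
  by transfer

lemma l2_eqI: "(\<And>n. l2nth x n = l2nth y n) \<Longrightarrow> x = y"
  by transfer blast

lemma l2_obtain:
  assumes "summable (\<lambda>n. (norm (f n :: 'a::complex_inner))\<^sup>2)"
  obtains x where "\<And>n. l2nth x n = f n"
proof
  show "l2nth (Abs_l2seq f) n = f n" for n
    using assms by (simp add: l2nth.rep_eq Abs_l2seq_inverse)
qed

lemma norm_add_squared_le:
  fixes u v :: "'a::real_inner"
  shows "(norm (u + v))\<^sup>2 \<le> 2 * ((norm u)\<^sup>2 + (norm v)\<^sup>2)"
proof -
  have "0 \<le> (norm (u - v))\<^sup>2" by simp
  moreover have "(norm (u + v))\<^sup>2 + (norm (u - v))\<^sup>2 = 2 * ((norm u)\<^sup>2 + (norm v)\<^sup>2)"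
    unfolding power2_norm_eq_inner by (simp add: inner_simps inner_commute)
  ultimately show ?thesis by linarith
qed

lemma summable_norm_add_squared:
  fixes f g :: "nat \<Rightarrow> 'a::real_inner"
  assumes "summable (\<lambda>n. (norm (f n))\<^sup>2)" "summable (\<lambda>n. (norm (g n))\<^sup>2)"
  shows "summable (\<lambda>n. (norm (f n + g n))\<^sup>2)"
  by (rule summable_comparison_test'[OF summable_mult[OF summable_add[OF assms], of 2], of 0])
    (use norm_add_squared_le in \<open>simp del: distrib_left_numeral\<close>)

lemma summable_norm_scaled_squared:
  fixes f g :: "nat \<Rightarrow> 'a::real_normed_vector"
  assumes "summable (\<lambda>n. (norm (f n))\<^sup>2)" "\<And>n. norm (g n) \<le> K * norm (f n)"
  shows "summable (\<lambda>n. (norm (g n))\<^sup>2)"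
  by (rule summable_comparison_test'[OF summable_mult[OF assms(1), of "K\<^sup>2"]])
    (use power_mono[OF assms(2), of _ 2] in \<open>simp add: power_mult_distrib\<close>)

instantiation l2seq :: (complex_inner) real_vector
begin

lift_definition zero_l2seq :: "'a l2seq" is "\<lambda>_. 0"
  by simp

lift_definition plus_l2seq :: "'a l2seq \<Rightarrow> 'a l2seq \<Rightarrow> 'a l2seq" is "\<lambda>f g n. f n + g n"
  by (rule summable_norm_add_squared)

lift_definition uminus_l2seq :: "'a l2seq \<Rightarrow> 'a l2seq" is "\<lambda>f n. - f n"
  by simp

lift_definition minus_l2seq :: "'a l2seq \<Rightarrow> 'a l2seq \<Rightarrow> 'a l2seq" is "\<lambda>f g n. f n - g n"
proof -
  fix f g :: "nat \<Rightarrow> 'a"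
  assume "summable (\<lambda>n. (norm (f n))\<^sup>2)" "summable (\<lambda>n. (norm (g n))\<^sup>2)"
  then show "summable (\<lambda>n. (norm (f n - g n))\<^sup>2)"
    using summable_norm_add_squared[of f "\<lambda>n. - g n"] by simp
qed

lift_definition scaleR_l2seq :: "real \<Rightarrow> 'a l2seq \<Rightarrow> 'a l2seq" is "\<lambda>r f n. r *\<^sub>R f n"
  by (erule summable_norm_scaled_squared) (rule eq_refl, rule norm_scaleR)

instance
proof
  fix x y z :: "'a l2seq" and r s :: real
  show "x + y + z = x + (y + z)" by transfer (simp add: add.assoc)
  show "x + y = y + x" by transfer (simp add: add.commute)
  show "0 + x = x" by transfer simp
  show "- x + x = 0" by transfer simp
  show "x - y = x + - y" by transfer simp
  show "r *\<^sub>R (x + y) = r *\<^sub>R x + r *\<^sub>R y" by transfer (simp add: scaleR_add_right)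
  show "(r + s) *\<^sub>R x = r *\<^sub>R x + s *\<^sub>R x" by transfer (simp add: scaleR_add_left)
  show "r *\<^sub>R s *\<^sub>R x = (r * s) *\<^sub>R x" by transfer simp
  show "1 *\<^sub>R x = x" by transfer simp
qed

end

lemma summable_cinner:
  fixes f g :: "nat \<Rightarrow> 'a::complex_inner"
  assumes "summable (\<lambda>n. (norm (f n))\<^sup>2)" "summable (\<lambda>n. (norm (g n))\<^sup>2)"
  shows "summable (\<lambda>n. cinner (f n) (g n))"
proof (rule summable_comparison_test'[OF summable_add[OF assms]])
  fix n
  have "cmod (cinner (f n) (g n)) \<le> norm (f n) * norm (g n)" by (rule norm_cinner_le)
  also have "\<dots> \<le> (norm (f n))\<^sup>2 + (norm (g n))\<^sup>2"
    using sum_squares_bound[of "norm (f n)" "norm (g n)"]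
      mult_nonneg_nonneg[OF norm_ge_zero norm_ge_zero, of "f n" "g n"] by linarith
  finally show "cmod (cinner (f n) (g n)) \<le> (norm (f n))\<^sup>2 + (norm (g n))\<^sup>2" .
qed

lemma summable_inner:
  fixes f g :: "nat \<Rightarrow> 'a::complex_inner"
  assumes "summable (\<lambda>n. (norm (f n))\<^sup>2)" "summable (\<lambda>n. (norm (g n))\<^sup>2)"
  shows "summable (\<lambda>n. inner (f n) (g n))"
  using summable_Re[OF summable_cinner[OF assms]] by (simp add: Re_cinner)

instantiation l2seq :: (complex_inner) complex_inner
begin

lift_definition scaleC_l2seq :: "complex \<Rightarrow> 'a l2seq \<Rightarrow> 'a l2seq" is "\<lambda>c f n. c *\<^sub>C f n"
  by (erule summable_norm_scaled_squared) (rule eq_refl, rule norm_scaleC)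

definition cinner_l2seq :: "'a l2seq \<Rightarrow> 'a l2seq \<Rightarrow> complex" where
  "cinner_l2seq x y = (\<Sum>n. cinner (l2nth x n) (l2nth y n))"

definition inner_l2seq :: "'a l2seq \<Rightarrow> 'a l2seq \<Rightarrow> real" where
  "inner_l2seq x y = (\<Sum>n. inner (l2nth x n) (l2nth y n))"

definition norm_l2seq :: "'a l2seq \<Rightarrow> real" where
  "norm_l2seq x = sqrt (inner x x)"

definition dist_l2seq :: "'a l2seq \<Rightarrow> 'a l2seq \<Rightarrow> real" where
  "dist_l2seq x y = norm (x - y)"

definition sgn_l2seq :: "'a l2seq \<Rightarrow> 'a l2seq" where
  "sgn_l2seq x = x /\<^sub>R norm x"

definition uniformity_l2seq :: "('a l2seq \<times> 'a l2seq) filter" where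
  "uniformity_l2seq = (INF e\<in>{0<..}. principal {(x, y). dist x y < e})"

definition open_l2seq :: "'a l2seq set \<Rightarrow> bool" where
  "open_l2seq U \<longleftrightarrow> (\<forall>x\<in>U. eventually (\<lambda>(x', y). x' = x \<longrightarrow> y \<in> U) uniformity)"

instance
proof
  fix x y z :: "'a l2seq" and r :: real and c d :: complex and U :: "'a l2seq set"
  note sc = summable_cinner[OF l2_summable l2_summable]
  note si = summable_inner[OF l2_summable l2_summable]
  show "c *\<^sub>C (x + y) = c *\<^sub>C x + c *\<^sub>C y" by transfer (simp add: scaleC_add_right)
  show "(c + d) *\<^sub>C x = c *\<^sub>C x + d *\<^sub>C x" by transfer (simp add: scaleC_add_left)
  show "c *\<^sub>C d *\<^sub>C x = (c * d) *\<^sub>C x" by transfer (simp add: scaleC_scaleC)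
  show "complex_of_real r *\<^sub>C x = r *\<^sub>R x" by transfer (simp add: scaleC_of_real)
  show "dist x y = norm (x - y)" by (rule dist_l2seq_def)
  show "sgn x = x /\<^sub>R norm x" by (rule sgn_l2seq_def)
  show "(uniformity :: ('a l2seq \<times> 'a l2seq) filter) = (INF e\<in>{0<..}. principal {(x, y). dist x y < e})"
    by (rule uniformity_l2seq_def)
  show "open U \<longleftrightarrow> (\<forall>x\<in>U. eventually (\<lambda>(x', y). x' = x \<longrightarrow> y \<in> U) uniformity)"
    by (rule open_l2seq_def)
  show "norm x = sqrt (inner x x)" by (rule norm_l2seq_def)
  show "inner x y = inner y x" by (simp add: inner_l2seq_def inner_commute)
  show "inner (x + y) z = inner x z + inner y z"
    unfolding inner_l2seq_def suminf_add[OF si si]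
    by (simp add: plus_l2seq.rep_eq l2nth.rep_eq inner_add_left)
  show "inner (r *\<^sub>R x) y = r * inner x y"
    unfolding inner_l2seq_def suminf_mult[OF si, symmetric]
    by (simp add: scaleR_l2seq.rep_eq l2nth.rep_eq)
  show "0 \<le> inner x x" unfolding inner_l2seq_def by (rule suminf_nonneg[OF si]) simp
  show "inner x x = 0 \<longleftrightarrow> x = 0"
  proof -
    have "inner x x = 0 \<longleftrightarrow> (\<forall>n. l2nth x n = 0)"
      unfolding inner_l2seq_def by (subst suminf_eq_zero_iff[OF si]) auto
    also have "\<dots> \<longleftrightarrow> x = 0" by transfer (simp add: fun_eq_iff)
    finally show ?thesis .
  qed
  show "cinner x (y + z) = cinner x y + cinner x z"
    unfolding cinner_l2seq_def suminf_add[OF sc sc]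
    by (simp add: plus_l2seq.rep_eq l2nth.rep_eq cinner_add_right)
  show "cinner x (c *\<^sub>C y) = c * cinner x y"
    unfolding cinner_l2seq_def suminf_mult[OF sc, symmetric]
    by (simp add: scaleC_l2seq.rep_eq l2nth.rep_eq cinner_scaleC_right)
  show "cinner x y = cnj (cinner y x)"
    unfolding cinner_l2seq_def
    using sums_unique[OF iffD2[OF sums_cnj summable_sums[OF sc[of y x]]]]
    by (simp flip: cinner_commute)
  show "Re (cinner x y) = inner x y"
    unfolding cinner_l2seq_def inner_l2seq_def Re_suminf[OF sc] by (simp add: Re_cinner)
qed

end

lemma l2nth_simps [simp]:
  "l2nth (x + y) n = l2nth x n + l2nth y n"
  "l2nth (x - y) n = l2nth x n - l2nth y n"
  "l2nth (r *\<^sub>R x) n = r *\<^sub>R l2nth x n"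
  "l2nth (c *\<^sub>C x) n = c *\<^sub>C l2nth x n"
  "l2nth 0 n = 0"
  by (transfer; simp)+

lemma l2nth_sum [simp]: "l2nth (\<Sum>i\<in>I. f i) n = (\<Sum>i\<in>I. l2nth (f i) n)"
  by (induction I rule: infinite_finite_induct) auto

lemma norm_l2_squared: "(norm x)\<^sup>2 = (\<Sum>n. (norm (l2nth x n))\<^sup>2)"
  by (simp add: power2_norm_eq_inner inner_l2seq_def)

lemma sum_norm_l2nth_le: "(\<Sum>k<M. (norm (l2nth x k))\<^sup>2) \<le> (norm x)\<^sup>2"
  unfolding norm_l2_squared by (rule sum_le_suminf[OF l2_summable]) auto

lemma norm_l2nth_le: "norm (l2nth x n) \<le> norm x"
proof -
  have "(\<Sum>k\<in>{n}. (norm (l2nth x k))\<^sup>2) \<le> (norm x)\<^sup>2"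
    unfolding norm_l2_squared by (rule sum_le_suminf[OF l2_summable]) auto
  then show ?thesis using power2_le_imp_le[of "norm (l2nth x n)" "norm x"] by simp
qed

lemma bounded_linear_l2nth: "bounded_linear (\<lambda>x. l2nth x n)"
  by (rule bounded_linear_intro[of _ 1]) (simp_all add: norm_l2nth_le)

text \<open>The limit is taken coordinatewise. The Cauchy bounds survive in the limit because they
  are first stated for finite partial sums, through which a limit passes freely.\<close>

instance l2seq :: (chilbert_space) chilbert_space
proof
  fix X :: "nat \<Rightarrow> 'a l2seq" assume X: "Cauchy X"
  define g where "g k = lim (\<lambda>m. l2nth (X m) k)" for k
  have g: "(\<lambda>m. l2nth (X m) k) \<longlonglongrightarrow> g k" for k
    unfolding g_def convergent_LIMSEQ_iff[symmetric]
    by (intro Cauchy_convergent bounded_linear.Cauchy[OF bounded_linear_l2nth X])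
  have tail: "\<exists>N. \<forall>m\<ge>N. \<forall>M. (\<Sum>k<M. (norm (l2nth (X m) k - g k))\<^sup>2) \<le> e\<^sup>2" if e: "e > 0" for e
  proof -
    obtain N where N: "\<And>m n. m \<ge> N \<Longrightarrow> n \<ge> N \<Longrightarrow> dist (X m) (X n) < e"
      using metric_CauchyD[OF X e] by blast
    show ?thesis
    proof (intro exI allI impI)
      fix m M assume m: "N \<le> m"
      show "(\<Sum>k<M. (norm (l2nth (X m) k - g k))\<^sup>2) \<le> e\<^sup>2"
      proof (rule LIMSEQ_le_const2)
        show "(\<lambda>n. \<Sum>k<M. (norm (l2nth (X m) k - l2nth (X n) k))\<^sup>2)
            \<longlonglongrightarrow> (\<Sum>k<M. (norm (l2nth (X m) k - g k))\<^sup>2)"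
          by (intro tendsto_intros g)
        show "\<exists>N. \<forall>n\<ge>N. (\<Sum>k<M. (norm (l2nth (X m) k - l2nth (X n) k))\<^sup>2) \<le> e\<^sup>2"
        proof (intro exI allI impI)
          fix n assume "N \<le> n"
          then have "norm (X m - X n) \<le> e" using N[OF m] by (force simp: dist_norm)
          then have "(norm (X m - X n))\<^sup>2 \<le> e\<^sup>2" by (rule power_mono) simp
          then show "(\<Sum>k<M. (norm (l2nth (X m) k - l2nth (X n) k))\<^sup>2) \<le> e\<^sup>2"
            using sum_norm_l2nth_le[of "X m - X n" M] by simp
        qed
      qed
    qed
  qed
  have diff: "summable (\<lambda>k. (norm (l2nth (X m) k - g k))\<^sup>2)"
    "(\<Sum>k. (norm (l2nth (X m) k - g k))\<^sup>2) \<le> e\<^sup>2"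
    if "\<forall>M. (\<Sum>k<M. (norm (l2nth (X m) k - g k))\<^sup>2) \<le> e\<^sup>2" for m e
  proof -
    show *: "summable (\<lambda>k. (norm (l2nth (X m) k - g k))\<^sup>2)"
      by (rule summableI_nonneg_bounded[of _ "e\<^sup>2"]) (use that in auto)
    show "(\<Sum>k. (norm (l2nth (X m) k - g k))\<^sup>2) \<le> e\<^sup>2"
      by (rule suminf_le_const[OF *]) (use that in auto)
  qed
  obtain m where m: "\<forall>M. (\<Sum>k<M. (norm (l2nth (X m) k - g k))\<^sup>2) \<le> 1\<^sup>2"
    using tail[OF zero_less_one] by blast
  \<comment> \<open>Adding \<open>- X m\<close> to the square summable difference
    \<open>X m - g\<close> leaves \<open>- g\<close>.\<close>
  have "summable (\<lambda>k. (norm (- l2nth (X m) k))\<^sup>2)" using l2_summable[of "X m"] by simp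
  from summable_norm_add_squared[OF diff(1)[OF m] this]
  have "summable (\<lambda>k. (norm (g k))\<^sup>2)" by simp
  then obtain x where x: "\<And>k. l2nth x k = g k" by (rule l2_obtain) blast
  have "X \<longlonglongrightarrow> x"
  proof (rule metric_LIMSEQ_I)
    fix e :: real assume "e > 0"
    then obtain N where N: "\<And>m. m \<ge> N \<Longrightarrow> \<forall>M. (\<Sum>k<M. (norm (l2nth (X m) k - g k))\<^sup>2) \<le> (e / 2)\<^sup>2"
      using tail[OF half_gt_zero] by blast
    have "dist (X m) x < e" if "m \<ge> N" for m
    proof -
      have "(norm (X m - x))\<^sup>2 \<le> (e / 2)\<^sup>2"
        using diff(2)[OF N[OF that]] by (simp add: norm_l2_squared x)
      then have "norm (X m - x) \<le> e / 2" by (rule power2_le_imp_le) (use \<open>e > 0\<close> in simp)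
      then show ?thesis using \<open>e > 0\<close> by (simp add: dist_norm)
    qed
    then show "\<exists>N. \<forall>m\<ge>N. dist (X m) x < e" by blast
  qed
  then show "convergent X" by (auto simp: convergent_def)
qed

section \<open>Coordinate embeddings and amplifications of operators\<close>

lift_definition l2unit :: "nat \<Rightarrow> 'a::complex_inner \<Rightarrow> 'a l2seq" is "\<lambda>j x n. if n = j then x else 0"
  by (rule summable_finite[of "{_}"]) auto

lemma l2nth_l2unit [simp]: "l2nth (l2unit j x) n = (if n = j then x else 0)"
  by transfer simp

lemma bounded_linear_l2unit: "bounded_linear (l2unit j)"
proof (rule bounded_linear_intro[of _ 1])
  fix x :: 'a
  have "(\<lambda>n. (norm (l2nth (l2unit j x) n))\<^sup>2) = (\<lambda>n. if n = j then (norm x)\<^sup>2 else 0)" by auto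
  then have "(norm (l2unit j x))\<^sup>2 = (norm x)\<^sup>2"
    unfolding norm_l2_squared using sums_single[of j "\<lambda>_. (norm x)\<^sup>2"] by (simp add: sums_iff)
  then show "norm (l2unit j x) \<le> norm x * 1" by (simp add: power2_eq_iff_nonneg)
qed (auto intro!: l2_eqI)

lemma l2unit_expansion: "(\<lambda>N. \<Sum>j<N. l2unit j (l2nth x j)) \<longlonglongrightarrow> x"
proof -
  let ?f = "\<lambda>n. (norm (l2nth x n))\<^sup>2"
  have "(norm (x - (\<Sum>j<N. l2unit j (l2nth x j))))\<^sup>2 = suminf ?f - sum ?f {..<N}" for N
  proof -
    have *: "l2nth (x - (\<Sum>j<N. l2unit j (l2nth x j))) n = (if n < N then 0 else l2nth x n)" for n
      by (simp add: sum.delta' if_distrib cong: if_cong)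
    have "(norm (x - (\<Sum>j<N. l2unit j (l2nth x j))))\<^sup>2
        = (\<Sum>n. (norm (if n < N then 0 else l2nth x n))\<^sup>2)"
      unfolding norm_l2_squared * ..
    also have "\<dots> = (\<Sum>n. ?f (n + N))"
      by (subst suminf_split_initial_segment[of _ N])
        (use l2_summable[of "x - (\<Sum>j<N. l2unit j (l2nth x j))"] in \<open>simp_all only: *\<close>, simp)
    also have "\<dots> = suminf ?f - sum ?f {..<N}"
      using suminf_split_initial_segment[OF l2_summable[of x], of N] by simp
    finally show ?thesis .
  qed
  moreover have "(\<lambda>N. suminf ?f - sum ?f {..<N}) \<longlonglongrightarrow> suminf ?f - suminf ?f"
    by (intro tendsto_diff tendsto_const summable_LIMSEQ l2_summable)
  ultimately have "(\<lambda>N. (norm (x - (\<Sum>j<N. l2unit j (l2nth x j))))\<^sup>2) \<longlonglongrightarrow> 0" by simp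
  then have "(\<lambda>N. sqrt ((norm (x - (\<Sum>j<N. l2unit j (l2nth x j))))\<^sup>2)) \<longlonglongrightarrow> sqrt 0"
    by (rule tendsto_real_sqrt)
  then have "(\<lambda>N. norm ((\<Sum>j<N. l2unit j (l2nth x j)) - x)) \<longlonglongrightarrow> 0"
    by (simp add: norm_minus_commute)
  then show ?thesis by (simp add: tendsto_norm_zero_iff LIM_zero_iff)
qed

text \<open>The amplification T \<otimes> 1, acting by \<open>T\<close> in every coordinate.\<close>

lift_definition amp :: "'a::complex_inner bop \<Rightarrow> 'a l2seq \<Rightarrow> 'a l2seq" is "\<lambda>T f n. bop_apply T (f n)"
proof -
  fix T :: "'a bop" and f :: "nat \<Rightarrow> 'a" assume f: "summable (\<lambda>n. (norm (f n))\<^sup>2)"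
  obtain K where "\<And>x. norm (bop_apply T x) \<le> K * norm x" by (rule bop_bound[of T]) blast
  then show "summable (\<lambda>n. (norm (bop_apply T (f n)))\<^sup>2)"
    by (rule summable_norm_scaled_squared[OF f])
qed

lemma l2nth_amp [simp]: "l2nth (amp T x) n = bop_apply T (l2nth x n)"
  by transfer simp

lemma amp_bound:
  assumes "\<And>x. norm (bop_apply T x) \<le> K * norm x" "K \<ge> 0"
  shows "norm (amp T x) \<le> K * norm x"
proof -
  have "(norm (amp T x))\<^sup>2 \<le> (\<Sum>n. K\<^sup>2 * (norm (l2nth x n))\<^sup>2)"
    unfolding norm_l2_squared
    by (intro suminf_le l2_summable summable_mult)
      (use power_mono[OF assms(1), of _ 2] in \<open>simp add: power_mult_distrib\<close>)
  also have "\<dots> = (K * norm x)\<^sup>2"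
    by (simp add: suminf_mult[OF l2_summable] norm_l2_squared power_mult_distrib)
  finally show ?thesis by (rule power2_le_imp_le) (use assms(2) in simp)
qed

lemma bounded_linear_amp: "bounded_linear (amp T)"
proof -
  interpret T: bounded_linear "bop_apply T" by (rule bounded_linear_bop_apply)
  obtain K where "K \<ge> 0" "\<And>x. norm (bop_apply T x) \<le> K * norm x" by (rule bop_bound[of T]) blast
  then show ?thesis
    by (intro bounded_linear_intro[of _ K])
      (auto intro!: l2_eqI simp: T.add T.scaleR amp_bound mult.commute)
qed

lemma amp_simps [simp]:
  "amp (S + T) x = amp S x + amp T x"
  "amp (S - T) x = amp S x - amp T x"
  "amp (S * T) x = amp S (amp T x)"
  "amp (r *\<^sub>R T) x = r *\<^sub>R amp T x"
  "amp (c *\<^sub>C T) x = c *\<^sub>C amp T x"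
  "amp 0 x = 0"
  "amp 1 x = x"
  by (auto intro!: l2_eqI)


section \<open>Polynomials in an operator\<close>

lemma generated_algebra_sumI:
  fixes T :: "'a::chilbert_space bop"
  assumes "finite I"
  shows "(\<Sum>k\<in>I. c k *\<^sub>C T ^ k) \<in> generated_algebra T"
proof -
  \<comment> \<open>Inserting 0 keeps the maximum meaningful for an empty index set.\<close>
  have sub: "I \<subseteq> {..Max (insert 0 I)}" using assms by auto
  have "(\<Sum>k\<in>I. c k *\<^sub>C T ^ k)
      = (\<Sum>k\<le>Max (insert 0 I). (if k \<in> I then c k else 0) *\<^sub>C T ^ k)"
    by (rule sum.mono_neutral_cong_left[OF _ sub]) (auto simp: scaleC_zero_left)
  then show ?thesis unfolding generated_algebra_def mem_Collect_eq
    by (intro exI[of _ "Max (insert 0 I)"] exI[of _ "\<lambda>k. if k \<in> I then c k else 0"] conjI TrueI)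
qed

lemma generated_algebra_closed:
  fixes T :: "'a::chilbert_space bop"
  shows "T ^ k \<in> generated_algebra T"
    "x \<in> generated_algebra T \<Longrightarrow> y \<in> generated_algebra T \<Longrightarrow> x + y \<in> generated_algebra T"
    "x \<in> generated_algebra T \<Longrightarrow> c *\<^sub>C x \<in> generated_algebra T"
    "x \<in> generated_algebra T \<Longrightarrow> y \<in> generated_algebra T \<Longrightarrow> x * y \<in> generated_algebra T"
proof -
  have one_C: "(1::complex) *\<^sub>C z = z" for z :: "'a bop" using scaleC_of_real[of 1 z] by simp
  have scale_sum: "c *\<^sub>C sum f I = (\<Sum>i\<in>I. c *\<^sub>C f i)" for c I and f :: "nat \<Rightarrow> 'a bop"
    by (induction I rule: infinite_finite_induct) (auto simp: scaleC_zero_right scaleC_add_right)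
  show pow: "T ^ k \<in> generated_algebra T" for k
    using generated_algebra_sumI[of "{k}" "\<lambda>_. 1" T] by (simp add: one_C)
  show scale: "x \<in> generated_algebra T \<Longrightarrow> c *\<^sub>C x \<in> generated_algebra T" for x c
  proof -
    assume "x \<in> generated_algebra T"
    then obtain n d where "x = (\<Sum>k\<le>n. d k *\<^sub>C T ^ k)" by (auto simp: generated_algebra_def)
    then have "c *\<^sub>C x = (\<Sum>k\<le>n. (c * d k) *\<^sub>C T ^ k)" by (simp add: scale_sum scaleC_scaleC)
    then show ?thesis using generated_algebra_sumI[OF finite_atMost, of "\<lambda>k. c * d k" T n] by simp
  qed
  show add: "x \<in> generated_algebra T \<Longrightarrow> y \<in> generated_algebra T \<Longrightarrow> x + y \<in> generated_algebra T" for x y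
  proof -
    assume "x \<in> generated_algebra T" "y \<in> generated_algebra T"
    then obtain n c m d where xy: "x = (\<Sum>k\<le>n. c k *\<^sub>C T ^ k)" "y = (\<Sum>k\<le>m. d k *\<^sub>C T ^ k)"
      unfolding generated_algebra_def by blast
    have *: "(\<Sum>k\<le>i. e k *\<^sub>C T ^ k) = (\<Sum>k\<le>max n m. (if k \<le> i then e k else 0) *\<^sub>C T ^ k)"
      if "i \<le> max n m" for i and e :: "nat \<Rightarrow> complex"
      by (rule sum.mono_neutral_cong_left) (use that in \<open>auto simp: scaleC_zero_left\<close>)
    have "x + y = (\<Sum>k\<le>max n m.
        ((if k \<le> n then c k else 0) + (if k \<le> m then d k else 0)) *\<^sub>C T ^ k)"
      unfolding xy *[of n, OF max.cobounded1] *[of m, OF max.cobounded2]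
      by (simp only: sum.distrib[symmetric] scaleC_add_left)
    then show ?thesis
      using generated_algebra_sumI[OF finite_atMost,
          of "\<lambda>k. (if k \<le> n then c k else 0) + (if k \<le> m then d k else 0)" T "max n m"] by simp
  qed
  have sum: "(\<And>i. i \<in> I \<Longrightarrow> f i \<in> generated_algebra T) \<Longrightarrow> sum f I \<in> generated_algebra T"
    for I :: "nat set" and f
    using generated_algebra_sumI[of "{}" "\<lambda>_. 0" T]
    by (induction I rule: infinite_finite_induct) (simp_all add: add)
  show "x \<in> generated_algebra T \<Longrightarrow> y \<in> generated_algebra T \<Longrightarrow> x * y \<in> generated_algebra T"
  proof -
    assume "x \<in> generated_algebra T" "y \<in> generated_algebra T"
    then obtain n c m d where xy: "x = (\<Sum>k\<le>n. c k *\<^sub>C T ^ k)" "y = (\<Sum>k\<le>m. d k *\<^sub>C T ^ k)"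
      unfolding generated_algebra_def by blast
    have "x * y = (\<Sum>i\<le>n. \<Sum>j\<le>m. d j *\<^sub>C c i *\<^sub>C T ^ (i + j))"
      unfolding xy sum_product scaleC_bop_mult_left scaleC_bop_mult_right power_add ..
    then show ?thesis by (simp only:) (intro sum scale pow)
  qed
qed

lemma generated_algebra_diff:
  fixes T :: "'a::chilbert_space bop"
  shows "x \<in> generated_algebra T \<Longrightarrow> y \<in> generated_algebra T \<Longrightarrow> x - y \<in> generated_algebra T"
proof -
  assume *: "x \<in> generated_algebra T" "y \<in> generated_algebra T"
  have "x - y = x + (-1::complex) *\<^sub>C y" using scaleC_of_real[of "-1" y] by simp
  show ?thesis unfolding \<open>x - y = _\<close> by (intro generated_algebra_closed *)
qed

lemma generated_algebra_1: "1 \<in> generated_algebra T"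
  using generated_algebra_closed(1)[of T 0] by simp

lemma generated_algebra_self: "T \<in> generated_algebra T"
  using generated_algebra_closed(1)[of T 1] by simp

lemma generated_algebra_0: "0 \<in> generated_algebra T"
  using generated_algebra_diff[OF generated_algebra_1 generated_algebra_1] by simp


section \<open>The density theorem\<close>

lemma subspace_closure:
  fixes L :: "'a::real_normed_vector set"
  assumes "subspace L"
  shows "subspace (closure L)"
proof (rule subspaceI)
  show "0 \<in> closure L" using subspace_0[OF assms] closure_subset by blast
  show "x + y \<in> closure L" if "x \<in> closure L" "y \<in> closure L" for x y
    using that unfolding closure_sequential
  proof safe
    fix f g assume "\<forall>n. f n \<in> L" "f \<longlonglongrightarrow> x" "\<forall>n. g n \<in> L" "g \<longlonglongrightarrow> y"
    then show "\<exists>h. (\<forall>n. h n \<in> L) \<and> h \<longlonglongrightarrow> x + y"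
      by (intro exI[of _ "\<lambda>n. f n + g n"]) (simp add: subspace_add[OF assms] tendsto_add)
  qed
  show "r *\<^sub>R x \<in> closure L" if "x \<in> closure L" for x r
    using that unfolding closure_sequential
  proof safe
    fix f assume "\<forall>n. f n \<in> L" "f \<longlonglongrightarrow> x"
    then show "\<exists>h. (\<forall>n. h n \<in> L) \<and> h \<longlonglongrightarrow> r *\<^sub>R x"
      by (intro exI[of _ "\<lambda>n. r *\<^sub>R f n"]) (simp add: subspace_scale[OF assms] tendsto_scaleR)
  qed
qed

lemma cinner_amp_self_adjoint:
  assumes "self_adjoint S"
  shows "inner (amp S x) y = inner x (amp S y)"
proof -
  have "inner (bop_apply S u) v = inner u (bop_apply S v)" for u v
    using assms unfolding self_adjoint_def by (metis Re_cinner)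
  then show ?thesis by (simp add: inner_l2seq_def)
qed

text \<open>Von Neumann's argument: the projection onto the closure of the orbit of \<open>x\<close> under polynomials
  in \<open>S\<close> commutes with the amplification of \<open>S\<close>, so its matrix entries lie in the commutant
  of \<open>S\<close> and therefore commute with \<open>T\<close>.\<close>

lemma self_adjoint_density:
  fixes S T :: "'a::chilbert_space bop"
  assumes S: "self_adjoint S" and T: "T \<in> commutant (commutant {S})" and "\<delta> > 0"
  obtains p where "p \<in> generated_algebra S" "norm (amp T x - amp p x) < \<delta>"
proof -
  define L where "L = (\<lambda>p. amp p x) ` generated_algebra S"
  define K where "K = closure L"
  have ampR: "r *\<^sub>R amp p x = amp (complex_of_real r *\<^sub>C p) x" for r p
    by (simp add: scaleC_of_real)
  have subL: "subspace L"
    unfolding L_def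
  proof (rule subspaceI)
    show "0 \<in> (\<lambda>p. amp p x) ` generated_algebra S"
      by (rule image_eqI[OF _ generated_algebra_0]) simp
    show "u + v \<in> (\<lambda>p. amp p x) ` generated_algebra S"
      if "u \<in> (\<lambda>p. amp p x) ` generated_algebra S" "v \<in> (\<lambda>p. amp p x) ` generated_algebra S" for u v
      using that generated_algebra_closed(2) by (force simp flip: amp_simps(1))
    show "r *\<^sub>R u \<in> (\<lambda>p. amp p x) ` generated_algebra S"
      if "u \<in> (\<lambda>p. amp p x) ` generated_algebra S" for u r
      using that by (auto simp only: ampR intro!: imageI generated_algebra_closed(3))
  qed
  have "subspace K" unfolding K_def by (rule subspace_closure[OF subL])
  moreover have "closed K" unfolding K_def by simp
  ultimately have "\<exists>p\<in>K. \<forall>m\<in>K. inner (z - p) m = 0" for z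
    by (rule closed_subspace_projection[where x = z]) blast
  then obtain P where PK: "\<And>z. P z \<in> K" and orth: "\<And>z m. m \<in> K \<Longrightarrow> inner (z - P z) m = 0"
    by metis
  \<comment> \<open>The algebraic properties of \<open>P\<close> below all come from this: exhibit a
    vector of \<open>K\<close> whose difference from \<open>z\<close> is orthogonal to
    \<open>K\<close>.\<close>
  have P_unique: "P z = p" if "p \<in> K" "\<And>m. m \<in> K \<Longrightarrow> inner (z - p) m = 0" for z p
  proof -
    have "P z - p \<in> K" using \<open>subspace K\<close> PK that(1) by (rule subspace_diff)
    from that(2)[OF this] orth[OF this, of z]
    have "inner (P z - p) (P z - p) = 0" by (simp add: inner_diff_left)
    then show ?thesis by simp
  qed
  have closed_C: "c *\<^sub>C u \<in> K" if "u \<in> K" for u and c :: complex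
  proof -
    have "(\<lambda>u. c *\<^sub>C u) ` closure L \<subseteq> closure ((\<lambda>u. c *\<^sub>C u) ` L)"
      by (intro closure_bounded_linear_image_subset bounded_linear_scaleC)
    also have "\<dots> \<subseteq> closure L"
      by (intro closure_mono)
        (auto simp: L_def generated_algebra_closed(3) simp flip: amp_simps(5) intro!: imageI)
    finally show ?thesis using that by (auto simp: K_def)
  qed
  have closed_S: "amp S u \<in> K" if "u \<in> K" for u
  proof -
    have "amp S ` closure L \<subseteq> closure (amp S ` L)"
      by (intro closure_bounded_linear_image_subset bounded_linear_amp)
    also have "\<dots> \<subseteq> closure L"
      by (intro closure_mono)
        (auto simp: L_def generated_algebra_closed(4) generated_algebra_self
          simp flip: amp_simps(3) intro!: imageI)
    finally show ?thesis using that by (auto simp: K_def)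
  qed
  have PS: "P (amp S z) = amp S (P z)" for z
  proof (rule P_unique)
    show "amp S (P z) \<in> K" by (intro closed_S PK)
    interpret S: bounded_linear "amp S" by (rule bounded_linear_amp)
    show "inner (amp S z - amp S (P z)) m = 0" if "m \<in> K" for m
      using orth[OF closed_S[OF that], of z]
      by (simp flip: S.diff add: cinner_amp_self_adjoint[OF S])
  qed
  \<comment> \<open>Since \<open>K\<close> is invariant under multiplication by \<open>\<i>\<close>,
    real orthogonality to \<open>K\<close> is already complex orthogonality, so complex scalars can
    be moved across.\<close>
  have PC: "P (c *\<^sub>C z) = c *\<^sub>C P z" for c z
  proof (rule P_unique)
    show "c *\<^sub>C P z \<in> K" by (intro closed_C PK)
    show "inner (c *\<^sub>C z - c *\<^sub>C P z) m = 0" if "m \<in> K" for m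
    proof -
      have "cinner (z - P z) m = 0"
        using orth[OF that] orth[OF closed_C[OF that]] by (simp add: cinner_eq_Complex_inner complex_eq_iff)
      then have "cinner m (c *\<^sub>C (z - P z)) = 0"
        unfolding cinner_scaleC_right by (subst cinner_commute) simp
      then show ?thesis by (metis Re_cinner inner_commute scaleC_diff_right zero_complex.simps(1))
    qed
  qed
  have Padd: "P (y + z) = P y + P z" for y z
  proof (rule P_unique)
    show "P y + P z \<in> K" by (intro subspace_add \<open>subspace K\<close> PK)
    show "inner (y + z - (P y + P z)) m = 0" if "m \<in> K" for m
      using orth[OF that, of y] orth[OF that, of z] by (simp add: inner_simps)
  qed
  have PR: "P (r *\<^sub>R z) = r *\<^sub>R P z" for r z
    using PC[of "complex_of_real r" z] by (simp add: scaleC_of_real)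
  have bP: "bounded_linear P"
  proof (rule bounded_linear_intro[of _ 1])
    show "P (y + z) = P y + P z" "P (r *\<^sub>R z) = r *\<^sub>R P z" for y z r by (rule Padd PR)+
    show "norm (P z) \<le> norm z * 1" for z
    proof (rule power2_le_imp_le)
      have "(norm z)\<^sup>2 = (norm (z - P z))\<^sup>2 + (norm (P z))\<^sup>2"
        using orth[OF PK, of z z] unfolding power2_norm_eq_inner
        by (simp add: inner_simps inner_commute)
      then show "(norm (P z))\<^sup>2 \<le> (norm z * 1)\<^sup>2" by simp
    qed simp
  qed
  have entry: "l2nth (P (l2unit j (bop_apply T u))) i = bop_apply T (l2nth (P (l2unit j u)) i)" for i j u
  proof -
    have b: "bounded_linear (\<lambda>u. l2nth (P (l2unit j u)) i)"
      by (rule bounded_linear_compose[OF bounded_linear_l2nth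
            bounded_linear_compose[OF bP bounded_linear_l2unit]])
    have unitC: "l2unit j (c *\<^sub>C u) = c *\<^sub>C l2unit j u" for c and u :: 'a
      by (rule l2_eqI) (simp add: scaleC_zero_right)
    have "l2nth (P (l2unit j (c *\<^sub>C u))) i = c *\<^sub>C l2nth (P (l2unit j u)) i" for c u
      by (simp add: unitC PC)
    with b obtain R where R: "\<And>u. bop_apply R u = l2nth (P (l2unit j u)) i"
      by (rule bop_exists) blast
    interpret S: bounded_linear "bop_apply S" by (rule bounded_linear_bop_apply)
    have "l2unit j (bop_apply S u) = amp S (l2unit j u)" for u
      by (rule l2_eqI) (simp add: S.zero)
    then have "R * S = S * R"
      by (intro bop_eqI) (simp add: R PS)
    then have "T * R = R * T" using T by (simp add: commutant_def)
    then have "bop_apply (T * R) u = bop_apply (R * T) u" by simp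
    then show ?thesis by (simp add: R)
  qed
  interpret T: bounded_linear "bop_apply T" by (rule bounded_linear_bop_apply)
  have fin: "P (amp T (l2unit j u)) = amp T (P (l2unit j u))" for j u
  proof -
    have "amp T (l2unit j u) = l2unit j (bop_apply T u)" by (rule l2_eqI) (simp add: T.zero)
    then show ?thesis by (intro l2_eqI) (simp add: entry)
  qed
  \<comment> \<open>Commutation is known on vectors supported in one coordinate; both sides are
    bounded linear, so it extends along the expansion of \<open>z\<close>.\<close>
  have PT: "P (amp T z) = amp T (P z)" for z
  proof -
    let ?s = "\<lambda>N. \<Sum>j<N. l2unit j (l2nth z j)"
    note c1 = bounded_linear_compose[OF bP bounded_linear_amp[of T]]
    note c2 = bounded_linear_compose[OF bounded_linear_amp[of T] bP]
    have "(\<lambda>N. P (amp T (?s N))) \<longlonglongrightarrow> P (amp T z)"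
      by (rule bounded_linear.tendsto[OF c1 l2unit_expansion])
    moreover have "P (amp T (?s N)) = amp T (P (?s N))" for N
      using bounded_linear.linear[OF c1] bounded_linear.linear[OF c2]
      by (simp add: linear_sum[of "\<lambda>z. P (amp T z)"] linear_sum[of "\<lambda>z. amp T (P z)"] fin)
    ultimately have "(\<lambda>N. amp T (P (?s N))) \<longlonglongrightarrow> P (amp T z)" by simp
    moreover have "(\<lambda>N. amp T (P (?s N))) \<longlonglongrightarrow> amp T (P z)"
      by (rule bounded_linear.tendsto[OF c2 l2unit_expansion])
    ultimately show ?thesis by (rule LIMSEQ_unique)
  qed
  \<comment> \<open>As the value of the polynomial 1, the vector \<open>x\<close> is fixed by
    \<open>P\<close>. Hence \<open>amp T x = amp T (P x) = P (amp T x)\<close> lies in the closed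
    orbit.\<close>
  have "x \<in> L" unfolding L_def by (rule image_eqI[OF _ generated_algebra_1]) simp
  then have "P x = x" by (intro P_unique) (auto simp: K_def intro: closure_subset[THEN subsetD])
  then have "amp T x \<in> K" using PK[of "amp T x"] PT[of x] by simp
  then obtain u where "u \<in> L" "dist u (amp T x) < \<delta>"
    using \<open>\<delta> > 0\<close> unfolding K_def closure_approachable by blast
  then show thesis using that by (auto simp: L_def dist_norm norm_minus_commute)
qed


section \<open>Neighbourhoods in the sigma-weak topology\<close>

text \<open>Placing \<open>x\<close> at the even and \<open>y\<close> at the odd positions gives a
  vector \<open>z\<close> whose squared amplified norm is the sum of the two. Two smallness
  conditions on an operator thus merge into one.\<close>

lemma l2_interleave:
  fixes x y :: "'a::complex_inner l2seq"
  obtains z where "\<And>T. norm (amp T x) \<le> norm (amp T z)" "\<And>T. norm (amp T y) \<le> norm (amp T z)"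
proof -
  let ?f = "\<lambda>n. if even n then l2nth x (n div 2) else l2nth y ((n - 1) div 2)"
  have *: "(\<lambda>n. (norm (bop_apply T (?f n)))\<^sup>2) sums ((norm (amp T y))\<^sup>2 + (norm (amp T x))\<^sup>2)" for T
  proof -
    have "(\<lambda>n. (norm (bop_apply T (l2nth w n)))\<^sup>2) sums (norm (amp T w))\<^sup>2" for w
      using summable_sums[OF l2_summable[of "amp T w"]] by (simp add: norm_l2_squared)
    note sums_if[OF this[of y] this[of x]]
    moreover have "(\<lambda>n. if even n then (norm (bop_apply T (l2nth x (n div 2))))\<^sup>2
          else (norm (bop_apply T (l2nth y ((n - 1) div 2))))\<^sup>2) = (\<lambda>n. (norm (bop_apply T (?f n)))\<^sup>2)"
      by auto
    ultimately show ?thesis by simp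
  qed
  have "summable (\<lambda>n. (norm (?f n))\<^sup>2)" using sums_summable[OF *[of 1]] by simp
  then obtain z where "\<And>n. l2nth z n = ?f n" by (rule l2_obtain) blast
  then have z: "(norm (amp T z))\<^sup>2 = (norm (amp T y))\<^sup>2 + (norm (amp T x))\<^sup>2" for T
    unfolding norm_l2_squared[of "amp T z"] using sums_unique[OF *[of T]] by simp
  show thesis
  proof (rule that)
    show "norm (amp T x) \<le> norm (amp T z)" for T by (rule power2_le_imp_le) (simp_all add: z)
    show "norm (amp T y) \<le> norm (amp T z)" for T by (rule power2_le_imp_le) (simp_all add: z)
  qed
qed

text \<open>By Cauchy-Schwarz a sigma-weak subbasic condition is implied by smallness of the
  amplified difference on one vector, and interleaving keeps this form under finite intersections.
  It matches the approximation that the density theorem delivers.\<close>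

lemma sigma_weak_open_nbhd:
  fixes T0 :: "'a::chilbert_space bop"
  assumes "openin sigma_weak_topology O'" "T0 \<in> O'"
  obtains x \<delta> where "\<delta> > 0" "\<And>T. norm (amp (T - T0) x) < \<delta> \<Longrightarrow> T \<in> O'"
proof -
  have "generate_topology_on
     {{T. (\<Sum>n. cinner (\<xi> n) (bop_apply T (\<eta> n))) \<in> U} | (\<xi> :: nat \<Rightarrow> 'a) \<eta> U.
        summable (\<lambda>n. (norm (\<xi> n))\<^sup>2) \<and> summable (\<lambda>n. (norm (\<eta> n))\<^sup>2) \<and> open U} O'"
    using assms(1) unfolding sigma_weak_topology_def openin_topology_generated_by_iff .
  then have "\<forall>T0\<in>O'. \<exists>x. \<exists>\<delta>>0. \<forall>T. norm (amp (T - T0) x) < \<delta> \<longrightarrow> T \<in> O'"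
  proof (induction rule: generate_topology_on.induct)
    case Empty
    then show ?case by simp
  next
    case (Int O1 O2)
    show ?case
    proof
      fix T0 assume "T0 \<in> O1 \<inter> O2"
      then have T0: "T0 \<in> O1" "T0 \<in> O2" by auto
      from bspec[OF Int.IH(1) T0(1)] obtain x1 d1 where
        1: "d1 > 0" "\<And>T. norm (amp (T - T0) x1) < d1 \<Longrightarrow> T \<in> O1" by blast
      from bspec[OF Int.IH(2) T0(2)] obtain x2 d2 where
        2: "d2 > 0" "\<And>T. norm (amp (T - T0) x2) < d2 \<Longrightarrow> T \<in> O2" by blast
      obtain z where z: "\<And>T. norm (amp T x1) \<le> norm (amp T z)" "\<And>T. norm (amp T x2) \<le> norm (amp T z)"
        by (rule l2_interleave[of x1 x2]) blast
      have "T \<in> O1 \<inter> O2" if "norm (amp (T - T0) z) < min d1 d2" for T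
      proof
        show "T \<in> O1" by (rule 1(2)) (use that z(1)[of "T - T0"] in linarith)
        show "T \<in> O2" by (rule 2(2)) (use that z(2)[of "T - T0"] in linarith)
      qed
      then show "\<exists>x. \<exists>\<delta>>0. \<forall>T. norm (amp (T - T0) x) < \<delta> \<longrightarrow> T \<in> O1 \<inter> O2"
        using 1(1) 2(1) by (intro exI[of _ z] exI[of _ "min d1 d2"]) auto
    qed
  next
    case (UN \<K>)
    then show ?case by blast
  next
    case (Basis O1)
    then obtain \<xi> \<eta> and U :: "complex set" where O1: "O1 = {T. (\<Sum>n. cinner (\<xi> n) (bop_apply T (\<eta> n))) \<in> U}"
      and s: "summable (\<lambda>n. (norm (\<xi> n))\<^sup>2)" "summable (\<lambda>n. (norm (\<eta> n))\<^sup>2)" and U: "open U"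
      by blast
    obtain x where x: "\<And>n. l2nth x n = \<xi> n" using s(1) by (rule l2_obtain) blast
    obtain y where y: "\<And>n. l2nth y n = \<eta> n" using s(2) by (rule l2_obtain) blast
    have O1': "T \<in> O1 \<longleftrightarrow> cinner x (amp T y) \<in> U" for T
      by (simp add: O1 cinner_l2seq_def x y)
    show ?case
    proof
      fix T0 assume "T0 \<in> O1"
      then have "cinner x (amp T0 y) \<in> U" by (simp only: O1')
      from bspec[OF U[unfolded open_dist] this]
      obtain e where e: "e > 0" "\<And>c. dist c (cinner x (amp T0 y)) < e \<Longrightarrow> c \<in> U" by blast
      \<comment> \<open>The summand 1 keeps the divisor positive when \<open>x = 0\<close>.\<close>
      have "T \<in> O1" if "norm (amp (T - T0) y) < e / (norm x + 1)" for T
        unfolding O1'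
      proof (rule e(2))
        have "dist (cinner x (amp T y)) (cinner x (amp T0 y)) = cmod (cinner x (amp (T - T0) y))"
          by (simp add: dist_norm cinner_diff_right)
        also have "\<dots> \<le> norm x * norm (amp (T - T0) y)" by (rule norm_cinner_le)
        also have "\<dots> \<le> (norm x + 1) * norm (amp (T - T0) y)" by (rule mult_right_mono) auto
        also have "\<dots> < e" using that by (simp add: pos_less_divide_eq add_nonneg_pos mult.commute)
        finally show "dist (cinner x (amp T y)) (cinner x (amp T0 y)) < e" .
      qed
      then show "\<exists>x. \<exists>\<delta>>0. \<forall>T. norm (amp (T - T0) x) < \<delta> \<longrightarrow> T \<in> O1"
        using e(1) by (intro exI[of _ y] exI[of _ "e / (norm x + 1)"]) (auto simp: add_nonneg_pos)
    qed
  qed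
  with assms(2) that show thesis by blast
qed

lemma generated_algebra_in_vna:
  assumes A: "von_neumann_algebra A" and "S \<in> A"
  shows "generated_algebra S \<subseteq> A"
proof -
  have "sum f I \<in> A" if "\<And>i. f i \<in> A" for f and I :: "nat set"
    by (induction I rule: infinite_finite_induct) (use that in \<open>simp_all add: vna_closed[OF A]\<close>)
  then show ?thesis using assms(2) by (auto simp: generated_algebra_def vna_closed[OF A])
qed

text \<open>By normality, the elements of \<open>A\<close> with nonzero state form a relatively open
  set. If it contained \<open>D * W\<close>, it would contain \<open>D * p\<close> for a polynomial
  \<open>p\<close> in \<open>S\<close> that is close to \<open>W\<close> on a single amplified
  vector, contrary to the hypothesis on polynomials.\<close>

lemma state_vanishes_on_generated_vna:
  fixes A :: "'a::chilbert_space bop set"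
  assumes A: "von_neumann_algebra A" and \<tau>: "normal_faithful_tracial_state A \<tau>"
    and S: "self_adjoint S" "S \<in> A" and D: "D \<in> A"
    and poly: "\<And>p. p \<in> generated_algebra S \<Longrightarrow> \<tau> (D * p) = 0"
    and W: "W \<in> generated_vna {S}"
  shows "\<tau> (D * W) = 0"
proof (rule ccontr)
  assume ne: "\<tau> (D * W) \<noteq> 0"
  have "S \<in> commutant (commutant {S})" using subset_bicommutant by blast
  from generated_vna_subset[OF bicommutant_self_adjoint_vna[OF S(1)] this]
  have W2: "W \<in> commutant (commutant {S})" using W by blast
  have WA: "W \<in> A" using generated_vna_subset[OF A S(2)] W by blast
  have "openin (subtopology sigma_weak_topology A) {T \<in> topspace (subtopology sigma_weak_topology A). \<tau> T \<in> - {0}}"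
  proof (rule openin_continuous_map_preimage[of _ euclidean])
    show "continuous_map (subtopology sigma_weak_topology A) euclidean \<tau>"
      using \<tau> unfolding normal_faithful_tracial_state_def by blast
    show "openin euclidean (- {0::complex})" by (simp add: open_Compl)
  qed
  then obtain O' where O': "openin sigma_weak_topology O'"
    and eq: "{T \<in> topspace (subtopology sigma_weak_topology A). \<tau> T \<in> - {0}} = O' \<inter> A"
    unfolding openin_subtopology by (elim exE conjE)
  \<comment> \<open>The zero sequences give a subbasic set that is the whole space, so the topology
    lives on all operators and the preimage is not cut down further.\<close>
  have "UNIV \<in> {{T. (\<Sum>n. cinner (\<xi> n) (bop_apply T (\<eta> n))) \<in> U} | (\<xi> :: nat \<Rightarrow> 'a) \<eta> U.
        summable (\<lambda>n. (norm (\<xi> n))\<^sup>2) \<and> summable (\<lambda>n. (norm (\<eta> n))\<^sup>2) \<and> open U}"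
    by (rule CollectI, rule exI[of _ "\<lambda>_. 0"], rule exI[of _ "\<lambda>_. 0"], rule exI[of _ UNIV]) simp
  from Union_upper[OF this] have top: "topspace (sigma_weak_topology :: 'a bop topology) = UNIV"
    unfolding sigma_weak_topology_def topology_generated_by_topspace by (rule top_le)
  have inO: "T \<in> O' \<longleftrightarrow> \<tau> T \<noteq> 0" if "T \<in> A" for T
  proof -
    have "T \<in> O' \<longleftrightarrow> T \<in> {T \<in> topspace (subtopology sigma_weak_topology A). \<tau> T \<in> - {0}}"
      unfolding eq using that by simp
    then show ?thesis using that by (simp add: top)
  qed
  have DW: "D * W \<in> A" by (rule vna_closed(5)[OF A D WA])
  then have "D * W \<in> O'" using ne by (simp add: inO)
  with O' obtain x \<delta> where \<delta>: "\<delta> > 0" "\<And>T. norm (amp (T - D * W) x) < \<delta> \<Longrightarrow> T \<in> O'"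
    by (rule sigma_weak_open_nbhd) blast
  obtain K where K: "K \<ge> 0" "\<And>x. norm (bop_apply D x) \<le> K * norm x" by (rule bop_bound[of D]) blast
  \<comment> \<open>Left multiplication by \<open>D\<close> enlarges errors by at most
    \<open>K\<close>; dividing by \<open>K + 1\<close> also covers \<open>K = 0\<close>.\<close>
  have "\<delta> / (K + 1) > 0" using \<delta> K by (simp add: add_nonneg_pos)
  then obtain p where p: "p \<in> generated_algebra S" "norm (amp W x - amp p x) < \<delta> / (K + 1)"
    by (rule self_adjoint_density[OF S(1) W2]) blast
  have "D * p - D * W = D * (p - W)" by (simp add: right_diff_distrib)
  then have "norm (amp (D * p - D * W) x) = norm (amp D (amp (p - W) x))" by (simp only: amp_simps(3))
  also have "\<dots> \<le> K * norm (amp (p - W) x)" by (rule amp_bound[OF K(2,1)])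
  also have "\<dots> \<le> (K + 1) * norm (amp (p - W) x)" by (rule mult_right_mono) auto
  also have "\<dots> < \<delta>" using p(2) K(1)
    by (simp add: pos_less_divide_eq add_nonneg_pos mult.commute norm_minus_commute)
  finally have "D * p \<in> O'" by (rule \<delta>(2))
  moreover have "D * p \<in> A"
    using generated_algebra_in_vna[OF A S(2)] p(1) D by (auto intro: vna_closed(5)[OF A])
  ultimately show False using inO[of "D * p"] poly[OF p(1)] by simp
qed


section \<open>Conditional expectations\<close>

lemma state_linear:
  assumes A: "von_neumann_algebra A" and \<tau>: "normal_faithful_tracial_state A \<tau>"
  shows "S \<in> A \<Longrightarrow> T \<in> A \<Longrightarrow> \<tau> (S + T) = \<tau> S + \<tau> T"
    "S \<in> A \<Longrightarrow> \<tau> (c *\<^sub>C S) = c * \<tau> S"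
    "S \<in> A \<Longrightarrow> \<tau> (r *\<^sub>R S) = of_real r * \<tau> S"
    "S \<in> A \<Longrightarrow> T \<in> A \<Longrightarrow> \<tau> (S - T) = \<tau> S - \<tau> T"
    "\<tau> 0 = 0" "\<tau> 1 = 1"
    "S \<in> A \<Longrightarrow> T \<in> A \<Longrightarrow> \<tau> (S * T) = \<tau> (T * S)"
    "S \<in> A \<Longrightarrow> \<tau> (adj S * S) = 0 \<Longrightarrow> S = 0"
proof -
  note d1 = \<tau>[unfolded normal_faithful_tracial_state_def]
  note d2 = conjunct2[OF d1] note d3 = conjunct2[OF d2] note d4 = conjunct2[OF d3]
  note d5 = conjunct2[OF d4] note d6 = conjunct2[OF d5]
  note add = conjunct1[OF d1, rule_format] and scale = conjunct1[OF d2, rule_format]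
    and one = conjunct1[OF d4] and trace = conjunct1[OF d5, rule_format]
    and faithful = conjunct1[OF d6, rule_format]
  show "S \<in> A \<Longrightarrow> T \<in> A \<Longrightarrow> \<tau> (S + T) = \<tau> S + \<tau> T"
    "S \<in> A \<Longrightarrow> \<tau> (c *\<^sub>C S) = c * \<tau> S" "\<tau> 1 = 1"
    "S \<in> A \<Longrightarrow> T \<in> A \<Longrightarrow> \<tau> (S * T) = \<tau> (T * S)"
    "S \<in> A \<Longrightarrow> \<tau> (adj S * S) = 0 \<Longrightarrow> S = 0"
    by (rule add scale one trace faithful; assumption)+
  show "S \<in> A \<Longrightarrow> \<tau> (r *\<^sub>R S) = of_real r * \<tau> S"
    using scale[of S "of_real r"] by (simp add: scaleC_of_real)
  show "S \<in> A \<Longrightarrow> T \<in> A \<Longrightarrow> \<tau> (S - T) = \<tau> S - \<tau> T"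
    using add[of "S - T" T] by (simp add: vna_closed[OF A])
  show "\<tau> 0 = 0" using scale[of 0 0] by (simp add: vna_closed[OF A] scaleC_zero_left)
qed

lemma state_sum:
  fixes f :: "'i \<Rightarrow> 'a::chilbert_space bop"
  assumes A: "von_neumann_algebra A" and \<tau>: "normal_faithful_tracial_state A \<tau>"
    and f: "\<And>i. i \<in> I \<Longrightarrow> f i \<in> A"
  shows "\<tau> (sum f I) = (\<Sum>i\<in>I. \<tau> (f i))" "sum f I \<in> A"
proof -
  have "\<tau> (sum f I) = (\<Sum>i\<in>I. \<tau> (f i)) \<and> sum f I \<in> A"
    using f by (induction I rule: infinite_finite_induct)
      (simp_all add: vna_closed[OF A] state_linear[OF A \<tau>])
  then show "\<tau> (sum f I) = (\<Sum>i\<in>I. \<tau> (f i))" "sum f I \<in> A" by auto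
qed

text \<open>Moments against powers of \<open>V\<close> decide the conditional expectation: linearity
  extends the equality to polynomials and normality to the generated von Neumann algebra. Naming the
  candidate \<open>E\<close> settles existence, and faithfulness settles the uniqueness demanded by
  the definite description.\<close>

lemma cond_expectation_eqI:
  assumes A: "von_neumann_algebra A" and \<tau>: "normal_faithful_tracial_state A \<tau>"
    and V: "self_adjoint V" "V \<in> A" and U: "U \<in> A" and E: "E \<in> generated_vna {V}"
    and eq: "\<And>n. \<tau> (U * V ^ n) = \<tau> (E * V ^ n)"
  shows "cond_expectation \<tau> U V = E"
proof -
  note lin = state_linear[OF A \<tau>]
  have sub: "generated_vna {V} \<subseteq> A" by (rule generated_vna_subset[OF A V(2)])
  have EA: "E \<in> A" using E sub by blast
  have poly: "\<tau> ((U - E) * p) = 0" if p_in: "p \<in> generated_algebra V" for p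
  proof -
    obtain n c where p: "p = (\<Sum>k\<le>n. c k *\<^sub>C V ^ k)"
      using p_in unfolding generated_algebra_def by blast
    have *: "\<tau> ((U - E) * V ^ k) = 0" for k
      using eq[of k] U EA V(2) by (simp add: left_diff_distrib lin vna_closed[OF A])
    have "\<tau> ((U - E) * p) = \<tau> (\<Sum>k\<le>n. c k *\<^sub>C ((U - E) * V ^ k))"
      unfolding p sum_distrib_left scaleC_bop_mult_right ..
    also have "\<dots> = (\<Sum>k\<le>n. \<tau> (c k *\<^sub>C ((U - E) * V ^ k)))"
      by (rule state_sum[OF A \<tau>]) (intro vna_closed[OF A] U EA V)
    also have "\<dots> = (\<Sum>k\<le>n. c k * \<tau> ((U - E) * V ^ k))"
      by (intro sum.cong refl lin(2) vna_closed[OF A] U EA V)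
    finally show ?thesis by (simp add: *)
  qed
  have diff: "\<tau> ((U - E) * W) = 0" if "W \<in> generated_vna {V}" for W
    by (rule state_vanishes_on_generated_vna[OF A \<tau> V vna_closed(4)[OF A U EA] poly that])
  have E_eq: "\<tau> (U * W) = \<tau> (E * W)" if "W \<in> generated_vna {V}" for W
  proof -
    have "W \<in> A" using that sub by blast
    then show ?thesis using diff[OF that] U EA by (simp add: left_diff_distrib lin vna_closed[OF A])
  qed
  show ?thesis
    unfolding cond_expectation_def
  proof (rule the_equality)
    show "E \<in> generated_vna {V} \<and> (\<forall>W\<in>generated_vna {V}. \<tau> (U * W) = \<tau> (E * W))"
      using E E_eq by blast
    fix F assume F: "F \<in> generated_vna {V} \<and> (\<forall>W\<in>generated_vna {V}. \<tau> (U * W) = \<tau> (F * W))"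
    \<comment> \<open>Testing the difference of two candidates against its own adjoint gives
      \<open>\<tau> (D * adj D) = 0\<close>. Traciality reverses the order of the factors, as the
      form of faithfulness requires.\<close>
    define D where "D = F - E"
    have D: "D \<in> generated_vna {V}" "adj D \<in> generated_vna {V}"
      using F E by (auto simp: D_def generated_vna_closed)
    have DA: "D \<in> A" "adj D \<in> A" and FA: "F \<in> A" using D F sub by auto
    have "\<tau> (F * adj D) = \<tau> (E * adj D)" using F E_eq D(2) by auto
    then have "\<tau> (D * adj D) = 0"
      using FA EA DA by (simp add: D_def left_diff_distrib lin vna_closed[OF A])
    then have "\<tau> (adj D * D) = 0" using lin(7)[OF DA] by simp
    then show "F = E" using lin(8)[OF DA(1)] by (simp add: D_def)
  qed
qed


section \<open>Moments of the free Meixner laws\<close>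

lemma compactly_supported_bound:
  assumes "compactly_supported \<mu>"
  obtains R where "R > 0" "AE y in \<mu>. \<bar>y\<bar> \<le> R"
proof -
  obtain K where K: "compact K" "AE y in \<mu>. y \<in> K"
    using assms unfolding compactly_supported_def by blast
  obtain R where R: "R > 0" "\<And>y. y \<in> K \<Longrightarrow> norm y \<le> R"
    using compact_imp_bounded[OF K(1)] unfolding bounded_pos by blast
  have "AE y in \<mu>. \<bar>y\<bar> \<le> R" using K(2) by eventually_elim (use R(2) in auto)
  with R(1) show thesis by (rule that)
qed

text \<open>Expansion at infinity with \<open>x = 1 / z\<close>: the integrand is a geometric series
  in \<open>x * y\<close>, and the bound \<open>cmod x * R < 1\<close> justifies integrating term by
  term. The additional division by \<open>x\<close> makes the series start with the zeroth
  moment.\<close>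

lemma cauchy_transform_sums:
  assumes "real_distribution \<mu>" and R: "R > 0" "AE y in \<mu>. \<bar>y\<bar> \<le> R"
    and x: "x \<noteq> 0" "cmod x * R < 1"
  shows "(\<lambda>n. complex_of_real (\<integral>y. y ^ n \<partial>\<mu>) * x ^ n) sums (cauchy_transform \<mu> (1 / x) / x)"
proof -
  interpret real_distribution \<mu> by fact
  let ?f = "\<lambda>n y. x * (x ^ n * complex_of_real (y ^ n))"
  have bound: "norm (?f n y) \<le> cmod x * (cmod x * R) ^ n" if "\<bar>y\<bar> \<le> R" for n y
  proof -
    have "norm (?f n y) = cmod x * (cmod x * \<bar>y\<bar>) ^ n"
      by (simp add: norm_mult norm_power power_mult_distrib)
    also have "\<dots> \<le> cmod x * (cmod x * R) ^ n"
      by (intro mult_left_mono power_mono that) auto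
    finally show ?thesis .
  qed
  have summ: "summable (\<lambda>n. cmod x * (cmod x * R) ^ n)"
    using x R by (intro summable_mult summable_geometric) (simp add: abs_mult)
  have int: "integrable \<mu> (\<lambda>y. ?f n y)" for n
  proof (rule integrable_const_bound)
    show "AE y in \<mu>. norm (?f n y) \<le> cmod x * (cmod x * R) ^ n"
      using R(2) by eventually_elim (rule bound)
  qed measurable
  have AE_summ: "AE y in \<mu>. summable (\<lambda>n. norm (?f n y))"
    using R(2)
  proof eventually_elim
    case (elim y)
    show ?case by (rule summable_comparison_test'[OF summ]) (use bound[OF elim] in auto)
  qed
  have int_summ: "summable (\<lambda>n. \<integral>y. norm (?f n y) \<partial>\<mu>)"
  proof (rule summable_comparison_test'[OF summ])
    fix n
    have "(\<integral>y. norm (?f n y) \<partial>\<mu>) \<le> (\<integral>y. cmod x * (cmod x * R) ^ n \<partial>\<mu>)"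
    proof (rule integral_mono_AE)
      show "AE y in \<mu>. norm (?f n y) \<le> cmod x * (cmod x * R) ^ n"
        using R(2) by eventually_elim (rule bound)
    qed (use int in auto)
    then show "norm (\<integral>y. norm (?f n y) \<partial>\<mu>) \<le> cmod x * (cmod x * R) ^ n"
      by (simp add: prob_space[simplified])
  qed
  have geom: "(\<Sum>n. ?f n y) = 1 / (1 / x - complex_of_real y)" if "\<bar>y\<bar> \<le> R" for y
  proof -
    have "cmod x * \<bar>y\<bar> \<le> cmod x * R" by (rule mult_left_mono[OF that]) simp
    then have "norm (x * complex_of_real y) < 1" using x(2) by (simp add: norm_mult)
    then have "(\<lambda>n. x * (x * complex_of_real y) ^ n) sums (x * (1 / (1 - x * complex_of_real y)))"
      by (intro sums_mult geometric_sums)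
    moreover have "x * (1 / (1 - x * complex_of_real y)) = 1 / (1 / x - complex_of_real y)"
      using x(1) by (simp add: field_simps)
    moreover have "(\<lambda>n. x * (x * complex_of_real y) ^ n) = (\<lambda>n. ?f n y)"
      by (simp add: power_mult_distrib)
    ultimately show ?thesis by (simp add: sums_iff)
  qed
  have "(\<lambda>n. \<integral>y. ?f n y \<partial>\<mu>) sums (\<integral>y. (\<Sum>n. ?f n y) \<partial>\<mu>)"
    by (rule sums_integral[OF int AE_summ int_summ])
  also have "(\<integral>y. (\<Sum>n. ?f n y) \<partial>\<mu>) = cauchy_transform \<mu> (1 / x)"
    unfolding cauchy_transform_def
  proof (rule integral_cong_AE)
    show "AE y in \<mu>. (\<Sum>n. ?f n y) = 1 / (1 / x - complex_of_real y)"
      using R(2) by eventually_elim (rule geom)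
  qed measurable
  finally have "(\<lambda>n. x * (x ^ n * complex_of_real (\<integral>y. y ^ n \<partial>\<mu>))) sums cauchy_transform \<mu> (1 / x)"
    by (simp del: of_real_power)
  from sums_divide[OF this, of x] show ?thesis using x(1) by (simp add: mult.commute)
qed

text \<open>Isolating the square root and squaring removes the choice of branch. The radicand equals
  the discriminant of the resulting quadratic polynomial in the Cauchy transform.\<close>

lemma free_meixner_quadratic:
  assumes G: "free_meixner a b \<mu>" and z: "Im z > 0" "of_real b * z\<^sup>2 + of_real a * z + 1 \<noteq> 0"
  shows "(of_real b * z\<^sup>2 + of_real a * z + 1) * (cauchy_transform \<mu> z)\<^sup>2
    - ((1 + 2 * of_real b) * z + of_real a) * cauchy_transform \<mu> z + (1 + of_real b) = 0"
proof -
  define D where "D = of_real b * z\<^sup>2 + of_real a * z + 1"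
  define B where "B = (1 + 2 * of_real b) * z + complex_of_real a"
  define g where "g = cauchy_transform \<mu> z"
  obtain r where r: "(r z)\<^sup>2 = (z - of_real a)\<^sup>2 - 4 * (1 + of_real b)" and g: "g = (B - r z) / (2 * D)"
    using G z unfolding free_meixner_def D_def B_def g_def by blast
  have "D \<noteq> 0" using z(2) by (simp add: D_def)
  with g have "r z = B - 2 * D * g" by simp
  with r have "(B - 2 * D * g)\<^sup>2 = (z - of_real a)\<^sup>2 - 4 * (1 + of_real b)" by simp
  moreover have "B\<^sup>2 - 4 * (1 + of_real b) * D = (z - of_real a)\<^sup>2 - 4 * (1 + of_real b)"
    by (simp add: B_def D_def power2_eq_square algebra_simps)
  moreover have "4 * D * (D * g\<^sup>2 - B * g + (1 + of_real b))
      = (B - 2 * D * g)\<^sup>2 - (B\<^sup>2 - 4 * (1 + of_real b) * D)"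
    by (simp add: power2_eq_square algebra_simps)
  ultimately have "4 * D * (D * g\<^sup>2 - B * g + (1 + of_real b)) = 0"
    by simp
  then have "D * g\<^sup>2 - B * g + (1 + of_real b) = 0" using \<open>D \<noteq> 0\<close> by simp
  then show ?thesis by (simp only: D_def B_def g_def)
qed

text \<open>In the variable \<open>x = 1 / z\<close> the Cauchy transform is \<open>x\<close> times
  the moment series, which turns its quadratic equation into one that is analytic at 0. It holds at
  points of the lower half plane arbitrarily close to 0; a nonzero power series has isolated zeros,
  so the equation holds formally.\<close>

lemma free_meixner_moments:
  assumes G: "free_meixner a b \<mu>"
  defines "M \<equiv> Abs_fps (\<lambda>n. complex_of_real (\<integral>y. y ^ n \<partial>\<mu>))"
  shows "(fps_const (of_real b) + fps_const (of_real a) * fps_X + fps_X ^ 2) * M ^ 2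
    - (fps_const (1 + 2 * of_real b) + fps_const (of_real a) * fps_X) * M
    + fps_const (1 + of_real b) = 0" (is "?P = 0")
proof -
  have dist: "real_distribution \<mu>" and "compactly_supported \<mu>"
    using G unfolding free_meixner_def by auto
  interpret real_distribution \<mu> by fact
  obtain R where R: "R > 0" "AE y in \<mu>. \<bar>y\<bar> \<le> R"
    using \<open>compactly_supported \<mu>\<close> by (rule compactly_supported_bound)
  note sums = cauchy_transform_sums[OF dist R]
  have "0 < ereal (1 / R)" using R(1) by simp
  also have "\<dots> \<le> fps_conv_radius M"
    unfolding fps_conv_radius_def
  proof (rule conv_radius_geI_ex)
    fix r :: real assume r: "0 < r" "ereal r < ereal (1 / R)"
    then have "r * R < 1" using R(1) by (simp add: field_simps)
    then have "summable (\<lambda>n. fps_nth M n * of_real r ^ n)"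
      using sums_summable[OF sums[of "of_real r"]] r(1) by (simp add: M_def)
    then show "\<exists>z. norm z = r \<and> summable (\<lambda>n. fps_nth M n * z ^ n)"
      using r(1) by (intro exI[of _ "of_real r"]) simp
  qed
  finally have rad: "fps_conv_radius M > 0" .
  define F where "F = (\<lambda>x. (of_real b + of_real a * x + x ^ 2) * eval_fps M x ^ 2
    - ((1 + 2 * of_real b) + of_real a * x) * eval_fps M x + (1 + of_real b))"
  have "eval_fps M has_fps_expansion M"
    using rad by (simp add: has_fps_expansion_def)
  then have F: "F has_fps_expansion ?P"
    unfolding F_def power2_eq_square by (intro fps_expansion_intros)
  then obtain \<rho> where \<rho>: "\<rho> > 0" "\<And>x. cmod x < \<rho> \<Longrightarrow> eval_fps ?P x = F x"
    unfolding has_fps_expansion_def eventually_nhds_metric by (auto simp: dist_norm)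
  have radP: "fps_conv_radius ?P > 0" using F by (simp add: has_fps_expansion_def)
  then obtain r0 where r0: "ereal r0 < fps_conv_radius ?P" "r0 > 0"
    by (meson ereal_dense2 ereal_less(2) less_ereal.simps)
  define r where "r = min r0 \<rho>"
  have r: "r > 0" using r0 \<rho> by (simp add: r_def)
  have Psums: "(\<lambda>n. fps_nth ?P n * (x - 0) ^ n) sums F x" if "norm (x - 0) < r" for x
  proof -
    have "ereal (norm x) < fps_conv_radius ?P"
      using that r0(1) by (simp add: r_def) (meson ereal_less_le less_ereal.simps(1) order_less_trans)
    from sums_eval_fps[OF this] \<rho>(2)[of x] that show ?thesis by (simp add: r_def)
  qed
  \<comment> \<open>With zeroth moment 1 the constant terms add up to
    \<open>b - (1 + 2 * b) + (1 + b) = 0\<close>. Hence 0 is a zero of \<open>F\<close>, and the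
    first nonzero coefficient has positive index, as isolation of zeros requires.\<close>
  have P0: "fps_nth ?P 0 = 0" by (simp add: M_def prob_space[simplified] fps_mult_nth power2_eq_square)
  have F0: "F 0 = 0" using sums_unique[OF Psums[of 0]] r P0 by simp
  show ?thesis
  proof (rule ccontr)
    assume "?P \<noteq> 0"
    then obtain m where m: "fps_nth ?P m \<noteq> 0" by (auto simp: fps_eq_iff)
    then have "m > 0" using P0 by (cases m) auto
    obtain s where s: "0 < s" "\<And>x. x \<in> cball 0 s - {0} \<Longrightarrow> F x \<noteq> 0"
      using powser_0_nonzero[OF r Psums F0 m \<open>m > 0\<close>] by metis
    define e where "e = min s (1 / R)"
    have e: "e > 0" using s(1) R(1) by (simp add: e_def)
    \<comment> \<open>Two candidates with different squares: at least one avoids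
      \<open>u\<^sup>2 = b\<close>, where the denominator of the Cauchy transform might
      vanish.\<close>
    have "(e / 2)\<^sup>2 \<noteq> (e / 3)\<^sup>2" using e by (simp add: power2_eq_square)
    then obtain u where u: "0 < u" "u < e" "u\<^sup>2 \<noteq> b"
      using e that[of "e / 2"] that[of "e / 3"] by force
    \<comment> \<open>On the negative imaginary axis, \<open>1 / x\<close> lies on the positive
      imaginary axis, where the transform is given; the real part \<open>b - u\<^sup>2\<close> keeps
      the denominator away from 0.\<close>
    define x where "x = - \<i> * complex_of_real u"
    have x: "x \<noteq> 0" "cmod x = u" "1 / x = \<i> / of_real u"
      using u(1) by (simp_all add: x_def norm_mult field_simps)
    have "u * R < 1" using u(2) R(1) by (simp add: e_def field_simps)
    then have "eval_fps M x = cauchy_transform \<mu> (1 / x) / x"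
      using sums_unique[OF sums[OF x(1)]] x(2) by (simp add: eval_fps_def M_def)
    moreover define g where "g = cauchy_transform \<mu> (1 / x)"
    ultimately have eval: "eval_fps M x = g / x" by simp
    have "of_real b + of_real a * x + x\<^sup>2 = Complex (b - u\<^sup>2) (- a * u)"
      by (simp add: x_def complex_eq_iff power2_eq_square)
    then have "of_real b + of_real a * x + x\<^sup>2 \<noteq> 0" using u(3) by (auto simp: complex_eq_iff)
    moreover have D: "of_real b * (1 / x)\<^sup>2 + of_real a * (1 / x) + 1 = (of_real b + of_real a * x + x\<^sup>2) / x\<^sup>2"
      using x(1) by (simp add: field_simps power2_eq_square)
    ultimately have "of_real b * (1 / x)\<^sup>2 + of_real a * (1 / x) + 1 \<noteq> 0"
      unfolding D using x(1) by simp
    moreover have "Im (1 / x) > 0" unfolding x(3) using u(1) by simp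
    ultimately have "(of_real b * (1 / x)\<^sup>2 + of_real a * (1 / x) + 1) * g\<^sup>2
        - ((1 + 2 * of_real b) * (1 / x) + of_real a) * g + (1 + of_real b) = 0"
      unfolding g_def by (intro free_meixner_quadratic[OF G])
    then have "F x = 0" unfolding D F_def eval using x(1)
      by (simp add: field_simps power2_eq_square)
    then show False using s(2)[of x] x u by (simp add: e_def)
  qed
qed

text \<open>Undoes the normalisation of the increment: the moment series of \<open>T\<close> is that
  of the normalised element with \<open>sqrt s\<close> times the variable substituted, and
  multiplication by \<open>s\<close> clears the denominators. Homogeneity is a hypothesis because
  \<open>\<tau>\<close> is linear only on the algebra.\<close>

lemma moment_fps_quadratic:
  assumes homogeneous: "\<And>c n. \<tau> ((c *\<^sub>R T) ^ n) = of_real (c ^ n) * \<tau> (T ^ n)"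
    and s: "s > 0" and law: "has_free_meixner_law \<tau> ((1 / sqrt s) *\<^sub>R T) (a / sqrt s) (b / s)"
  defines "M \<equiv> Abs_fps (\<lambda>n. \<tau> (T ^ n))"
  shows "(fps_const (of_real b) + fps_const (of_real (a * s)) * fps_X + fps_const (of_real (s\<^sup>2)) * fps_X\<^sup>2) * M\<^sup>2
    - (fps_const (of_real (s + 2 * b)) + fps_const (of_real (a * s)) * fps_X) * M
    + fps_const (of_real (s + b)) = 0"
proof -
  obtain \<mu> where \<mu>: "free_meixner (a / sqrt s) (b / s) \<mu>" and law: "is_law \<tau> ((1 / sqrt s) *\<^sub>R T) \<mu>"
    using law unfolding has_free_meixner_law_def by blast
  let ?N = "Abs_fps (\<lambda>n. complex_of_real (\<integral>y. y ^ n \<partial>\<mu>))"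
  define c where "c = fps_const (complex_of_real (sqrt s))"
  have "\<tau> (T ^ n) = of_real (sqrt s) ^ n * complex_of_real (\<integral>y. y ^ n \<partial>\<mu>)" for n
  proof -
    have "of_real ((1 / sqrt s) ^ n) * \<tau> (T ^ n) = complex_of_real (\<integral>y. y ^ n \<partial>\<mu>)"
      using law homogeneous unfolding is_law_def by metis
    then have "of_real (sqrt s) ^ n * complex_of_real (\<integral>y. y ^ n \<partial>\<mu>)
        = of_real ((sqrt s) ^ n * (1 / sqrt s) ^ n) * \<tau> (T ^ n)" by (simp flip: of_real_power)
    also have "(sqrt s) ^ n * (1 / sqrt s) ^ n = 1" using s by (simp flip: power_mult_distrib)
    finally show ?thesis by simp
  qed
  then have M: "M = ?N oo (c * fps_X)" unfolding c_def M_def fps_compose_linear by simp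
  have c0: "fps_nth (c * fps_X) 0 = 0" by (simp add: c_def)
  from free_meixner_moments[OF \<mu>]
  have "((fps_const (of_real (b / s)) + fps_const (of_real (a / sqrt s)) * fps_X + fps_X ^ 2) * ?N ^ 2
    - (fps_const (1 + 2 * of_real (b / s)) + fps_const (of_real (a / sqrt s)) * fps_X) * ?N
    + fps_const (1 + of_real (b / s))) oo (c * fps_X) = 0" by simp
  then have eq: "(fps_const (of_real (b / s)) + fps_const (of_real (a / sqrt s)) * (c * fps_X) + (c * fps_X)\<^sup>2) * M\<^sup>2
    - (fps_const (1 + 2 * of_real (b / s)) + fps_const (of_real (a / sqrt s)) * (c * fps_X)) * M
    + fps_const (1 + of_real (b / s)) = 0"
    by (simp add: fps_compose_add_distrib fps_compose_sub_distrib fps_compose_mult_distrib[OF c0]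
        fps_compose_power[OF c0, symmetric] fps_X_fps_compose_startby0[OF c0] M)
  have sq: "fps_const (of_real (a / sqrt s)) * c = fps_const (complex_of_real a)" "c * c = fps_const (of_real s)"
    using s by (simp add: c_def) (use s in \<open>simp add: c_def flip: of_real_mult\<close>)
  have coeff: "fps_const (of_real s) * fps_const (of_real (b / s)) = fps_const (complex_of_real b)"
    "fps_const (of_real s) * fps_const (1 + 2 * of_real (b / s)) = fps_const (complex_of_real (s + 2 * b))"
    "fps_const (of_real s) * fps_const (1 + of_real (b / s)) = fps_const (complex_of_real (s + b))"
    "fps_const (of_real s) * fps_const (complex_of_real a) = fps_const (complex_of_real (a * s))"
    "fps_const (of_real s) * fps_const (complex_of_real s) = fps_const (complex_of_real (s\<^sup>2))"
    using s by (simp_all add: field_simps power2_eq_square)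
  have "fps_const (of_real s) * ((fps_const (of_real (b / s)) + (fps_const (of_real (a / sqrt s)) * c) * fps_X + (c * c) * fps_X\<^sup>2) * M\<^sup>2
    - (fps_const (1 + 2 * of_real (b / s)) + (fps_const (of_real (a / sqrt s)) * c) * fps_X) * M
    + fps_const (1 + of_real (b / s))) = 0"
    using eq by (simp only: power2_eq_square mult.assoc mult.left_commute mult_zero_right)
  then have "(fps_const (of_real s) * fps_const (of_real (b / s)) + (fps_const (of_real s) * fps_const (of_real a)) * fps_X
     + (fps_const (of_real s) * fps_const (of_real s)) * fps_X\<^sup>2) * M\<^sup>2
    - (fps_const (of_real s) * fps_const (1 + 2 * of_real (b / s)) + (fps_const (of_real s) * fps_const (of_real a)) * fps_X) * M
    + fps_const (of_real s) * fps_const (1 + of_real (b / s)) = 0"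
    unfolding sq by (simp only: distrib_left right_diff_distrib distrib_right mult.assoc)
  then show ?thesis unfolding coeff .
qed


section \<open>Formal power series over the operators\<close>

lemma fps_one_mult: "1 * F = (F :: 'a::{ring, monoid_mult} fps)" "F * 1 = F"
proof -
  have "(\<Sum>i=0..n. (if i = 0 then 1 else 0) * fps_nth F (n - i)) = fps_nth F n" for n
    by (subst sum.remove[of _ 0]) (auto intro!: sum.neutral)
  then show "1 * F = F" by (simp add: fps_eq_iff fps_mult_nth)
  have "(\<Sum>i=0..n. fps_nth F i * (if n - i = 0 then 1 else 0)) = fps_nth F n" for n
    by (subst sum.remove[of _ n]) (auto intro!: sum.neutral)
  then show "F * 1 = F" by (simp add: fps_eq_iff fps_mult_nth)
qed

text \<open>The type of operators is not in the class \<open>ring_1\<close>, so the factorization of the resolvent of a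
  sum is phrased with an explicit unit \<open>e\<close>.\<close>

lemma resolvent_factorization:
  fixes e P P' Q Q' w :: "'r::ring"
  assumes e: "\<And>x. e * x = x" "\<And>x. x * e = x"
    and P: "P * P' = e" "P' * P = e" and Q: "Q * Q' = e" "Q' * Q = e"
    and w: "(P' + Q' - e) * w = e"
  obtains y where "y = Q' * w * P'" "w = Q * y * P" "y = e + (P - e) * (Q - e) * y"
proof
  define y where "y = Q' * w * P'"
  show "y = Q' * w * P'" by (rule y_def)
  have "Q * y * P = (Q * Q') * w * (P' * P)" by (simp add: y_def mult.assoc)
  then show w_eq: "w = Q * y * P" by (simp add: P Q e)
  \<comment> \<open>Both sides equal \<open>P + Q - P * Q\<close>. This identity replaces the
    inverse of a sum by the inverse of \<open>e\<close> minus a product of two factors that will be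
    centred.\<close>
  have "e - (P - e) * (Q - e) = P * (P' + Q' - e) * Q"
  proof -
    have "P * (P' + Q' - e) * Q = (P * P') * Q + P * (Q' * Q) - P * Q"
      by (simp add: algebra_simps e)
    then show ?thesis by (simp add: P Q e algebra_simps)
  qed
  then have "(e - (P - e) * (Q - e)) * y = P * ((P' + Q' - e) * ((Q * Q') * w)) * P'"
    by (simp add: y_def mult.assoc)
  also have "\<dots> = e" by (simp add: P Q e w)
  finally have "y - (P - e) * (Q - e) * y = e"
    by (simp only: left_diff_distrib[of e "(P - e) * (Q - e)" y] e)
  then show "y = e + (P - e) * (Q - e) * y" by (simp only: diff_eq_eq)
qed

text \<open>Embeds the scalar series as central elements of the ring of operator series, so that
  scalar and operator coefficients can be handled by ring multiplication alone.\<close>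

definition fps_scalar :: "complex fps \<Rightarrow> 'a::complex_inner bop fps" where
  "fps_scalar c = Abs_fps (\<lambda>n. fps_nth c n *\<^sub>C 1)"

lemma fps_scalar_mult_nth:
  "fps_nth (fps_scalar c * F) n = (\<Sum>i=0..n. fps_nth c i *\<^sub>C fps_nth F (n - i))"
  by (simp add: fps_scalar_def fps_mult_nth scaleC_bop_mult_left)

lemma fps_scalar_commute: "fps_scalar c * F = F * fps_scalar c"
proof (rule fps_ext)
  fix n
  have "fps_nth (F * fps_scalar c) n = (\<Sum>i=0..n. fps_nth c (n - i) *\<^sub>C fps_nth F i)"
    by (simp add: fps_scalar_def fps_mult_nth scaleC_bop_mult_right)
  also have "\<dots> = fps_nth (fps_scalar c * F) n"
    unfolding fps_scalar_mult_nth by (subst sum.atLeastAtMost_rev) simp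
  finally show "fps_nth (fps_scalar c * F) n = fps_nth (F * fps_scalar c) n" by simp
qed

lemma fps_scalar_simps:
  "fps_scalar 1 = 1"
  "fps_scalar (c + d) = fps_scalar c + fps_scalar d"
  "fps_scalar (c - d) = fps_scalar c - fps_scalar d"
  "fps_scalar (c * d) = fps_scalar c * fps_scalar d"
proof -
  show "fps_scalar 1 = 1" by (simp add: fps_scalar_def fps_eq_iff scaleC_one scaleC_zero_left)
  show "fps_scalar (c + d) = fps_scalar c + fps_scalar d"
    by (simp add: fps_scalar_def fps_eq_iff scaleC_add_left)
  show "fps_scalar (c - d) = fps_scalar c - fps_scalar d"
    by (simp add: fps_scalar_def fps_eq_iff eq_diff_eq flip: scaleC_add_left)
  show "fps_scalar (c * d) = fps_scalar c * fps_scalar d"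
    unfolding fps_eq_iff fps_scalar_mult_nth
    by (simp add: fps_scalar_def fps_mult_nth scaleC_sum_left scaleC_scaleC)
qed

text \<open>The formal inverse of \<open>1 - q T\<close>, that is, the resolvent
  \<open>\<omega> (\<omega> - T)\<^sup>-\<^sup>1\<close> for \<open>q = 1 / \<omega>\<close>.
  Truncation at \<open>n = m\<close> loses nothing when \<open>q\<close> has no constant term,
  because then \<open>q ^ n\<close> starts in degree at least \<open>n\<close>.\<close>

definition geometric_fps :: "complex fps \<Rightarrow> 'a::complex_inner bop \<Rightarrow> 'a bop fps" where
  "geometric_fps q T = Abs_fps (\<lambda>m. \<Sum>n=0..m. fps_nth (q ^ n) m *\<^sub>C T ^ n)"

lemma geometric_fps_unfold:
  assumes q: "fps_nth q 0 = 0"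
  shows "geometric_fps q T = 1 + fps_scalar q * (fps_const T * geometric_fps q T)"
proof (rule fps_ext)
  fix m
  have zero: "fps_nth (q ^ n) i = 0" if "i < n" for i n
    using startsby_zero_power_prefix[OF q] that by blast
  have "fps_nth (fps_scalar q * (fps_const T * geometric_fps q T)) m
      = (\<Sum>i=0..m. \<Sum>n=0..m - i. (fps_nth q i * fps_nth (q ^ n) (m - i)) *\<^sub>C T ^ Suc n)"
    unfolding fps_scalar_mult_nth
    by (simp add: geometric_fps_def sum_distrib_left scaleC_bop_mult_right scaleC_sum_right scaleC_scaleC)
  \<comment> \<open>The added summands have \<open>n > m - i\<close>, where the coefficient of
    \<open>q ^ n\<close> is 0. A rectangular range allows the sums to be exchanged.\<close>
  also have "\<dots> = (\<Sum>i=0..m. \<Sum>n=0..m. (fps_nth q i * fps_nth (q ^ n) (m - i)) *\<^sub>C T ^ Suc n)"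
    by (intro sum.cong refl sum.mono_neutral_left) (auto simp: zero scaleC_zero_left)
  also have "\<dots> = (\<Sum>n=0..m. fps_nth (q ^ Suc n) m *\<^sub>C T ^ Suc n)"
    by (subst sum.swap) (simp add: fps_mult_nth scaleC_sum_left)
  also have "\<dots> = (\<Sum>n=1..Suc m. fps_nth (q ^ n) m *\<^sub>C T ^ n)"
    by (simp only: sum.shift_bounds_cl_Suc_ivl One_nat_def)
  also have "\<dots> = (\<Sum>n=1..m. fps_nth (q ^ n) m *\<^sub>C T ^ n)"
    using zero[of m "Suc m"] by (simp add: scaleC_zero_left)
  also have "fps_nth 1 m + \<dots> = fps_nth (geometric_fps q T) m"
    unfolding geometric_fps_def fps_nth_Abs_fps
    by (subst (2) sum.atLeast_Suc_atMost) (auto simp: scaleC_one scaleC_zero_left)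
  finally show "fps_nth (geometric_fps q T) m
    = fps_nth (1 + fps_scalar q * (fps_const T * geometric_fps q T)) m" by simp
qed

lemma geometric_fps_commute: "fps_const T * geometric_fps q T = geometric_fps q T * fps_const T"
  by (simp add: fps_eq_iff geometric_fps_def sum_distrib_left sum_distrib_right
      scaleC_bop_mult_left scaleC_bop_mult_right power_commutes)

lemma geometric_fps_inverse:
  assumes q: "fps_nth q 0 = 0"
  shows "(1 - fps_scalar q * fps_const T) * geometric_fps q T = 1"
    "geometric_fps q T * (1 - fps_scalar q * fps_const T) = 1"
proof -
  let ?g = "geometric_fps q T"
  have u: "?g - fps_scalar q * (fps_const T * ?g) = 1"
    using geometric_fps_unfold[OF q, of T] by (simp add: diff_eq_eq)
  then show "(1 - fps_scalar q * fps_const T) * ?g = 1"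
    by (simp add: left_diff_distrib fps_one_mult mult.assoc)
  have "?g * (fps_scalar q * fps_const T) = fps_scalar q * (fps_const T * ?g)"
    by (simp add: geometric_fps_commute fps_scalar_commute[of q "?g * _"] mult.assoc)
      (simp only: fps_scalar_commute)
  with u show "?g * (1 - fps_scalar q * fps_const T) = 1"
    by (simp add: right_diff_distrib fps_one_mult)
qed

lemma geometric_fps_0: "fps_nth (geometric_fps q T) 0 = 1"
  by (simp add: geometric_fps_def scaleC_one)

lemma geometric_fps_X: "fps_nth (geometric_fps fps_X T) n = T ^ n"
proof -
  have "fps_nth (geometric_fps fps_X T) n = (\<Sum>k=0..n. if k = n then T ^ k else 0)"
    unfolding geometric_fps_def fps_nth_Abs_fps
    by (intro sum.cong refl) (simp add: fps_X_power_iff scaleC_one scaleC_zero_left)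
  then show ?thesis by simp
qed

section \<open>Coefficients in subalgebras and the state of an operator series\<close>

definition coeffs_in :: "'a::zero set \<Rightarrow> 'a fps \<Rightarrow> bool" where
  "coeffs_in B F \<longleftrightarrow> (\<forall>n. fps_nth F n \<in> B)"

lemma coeffs_in_mono: "coeffs_in B F \<Longrightarrow> B \<subseteq> C \<Longrightarrow> coeffs_in C F"
  by (auto simp: coeffs_in_def)

definition unital_subalgebra :: "'a::complex_inner bop set \<Rightarrow> bool" where
  "unital_subalgebra B \<longleftrightarrow> 0 \<in> B \<and> 1 \<in> B \<and> (\<forall>x\<in>B. \<forall>y\<in>B. x + y \<in> B \<and> x - y \<in> B \<and> x * y \<in> B)
    \<and> (\<forall>x\<in>B. \<forall>c. c *\<^sub>C x \<in> B)"

lemma unital_subalgebra_vna: "von_neumann_algebra A \<Longrightarrow> unital_subalgebra A"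
  by (auto simp: unital_subalgebra_def vna_closed)

lemma unital_subalgebra_generated: "unital_subalgebra (generated_algebra T)"
  by (auto simp: unital_subalgebra_def generated_algebra_closed generated_algebra_0
      generated_algebra_1 generated_algebra_diff)

lemma unital_subalgebra_sum:
  assumes "unital_subalgebra B" "\<And>i. i \<in> I \<Longrightarrow> f i \<in> B"
  shows "sum f I \<in> B"
  using assms(2)
  by (induction I rule: infinite_finite_induct) (use assms(1) in \<open>auto simp: unital_subalgebra_def\<close>)

lemma coeffs_in_closed:
  assumes B: "unital_subalgebra B"
  shows "coeffs_in B 1" "x \<in> B \<Longrightarrow> coeffs_in B (fps_const x)"
    "coeffs_in B F \<Longrightarrow> coeffs_in B G \<Longrightarrow> coeffs_in B (F + G)"
    "coeffs_in B F \<Longrightarrow> coeffs_in B G \<Longrightarrow> coeffs_in B (F - G)"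
    "coeffs_in B F \<Longrightarrow> coeffs_in B G \<Longrightarrow> coeffs_in B (F * G)"
    "coeffs_in B (fps_scalar c)"
  using B by (auto simp: coeffs_in_def unital_subalgebra_def fps_mult_nth fps_scalar_def
      intro!: unital_subalgebra_sum[OF B])

lemma coeffs_in_geometric:
  assumes B: "unital_subalgebra B" and T: "T \<in> B"
  shows "coeffs_in B (geometric_fps q T)"
proof -
  have "T ^ n \<in> B" for n by (induction n) (use B T in \<open>auto simp: unital_subalgebra_def\<close>)
  then show ?thesis
    using B by (auto simp: coeffs_in_def geometric_fps_def unital_subalgebra_def
        intro!: unital_subalgebra_sum[OF B])
qed

definition fps_state :: "('a::complex_inner bop \<Rightarrow> complex) \<Rightarrow> 'a bop fps \<Rightarrow> complex fps" where
  "fps_state \<tau> F = Abs_fps (\<lambda>n. \<tau> (fps_nth F n))"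

locale tracial_algebra =
  fixes A :: "'a::chilbert_space bop set" and \<tau> :: "'a bop \<Rightarrow> complex"
  assumes vna: "von_neumann_algebra A" and state: "normal_faithful_tracial_state A \<tau>"
begin

abbreviation "\<Phi> \<equiv> fps_state \<tau>"

lemmas A_sub = unital_subalgebra_vna[OF vna]
lemmas lin = state_linear[OF vna state]
lemmas A_closed = vna_closed[OF vna]
lemmas A_coeffs = coeffs_in_closed[OF A_sub]

lemma state_fps_simps:
  assumes "coeffs_in A F" "coeffs_in A G"
  shows "\<Phi> (F + G) = \<Phi> F + \<Phi> G" "\<Phi> (F - G) = \<Phi> F - \<Phi> G" "\<Phi> 1 = 1"
    "\<Phi> (fps_scalar c * F) = c * \<Phi> F" "\<Phi> (F * G) = \<Phi> (G * F)"
proof -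
  note F = assms[unfolded coeffs_in_def, rule_format]
  show "\<Phi> (F + G) = \<Phi> F + \<Phi> G" "\<Phi> (F - G) = \<Phi> F - \<Phi> G"
    by (simp_all add: fps_eq_iff fps_state_def lin F)
  show "\<Phi> 1 = 1" by (simp add: fps_eq_iff fps_state_def lin)
  show "\<Phi> (fps_scalar c * F) = c * \<Phi> F"
  proof (rule fps_ext)
    fix n
    have "\<tau> (\<Sum>i=0..n. fps_nth c i *\<^sub>C fps_nth F (n - i)) = (\<Sum>i=0..n. \<tau> (fps_nth c i *\<^sub>C fps_nth F (n - i)))"
      by (rule state_sum[OF vna state]) (intro A_closed F)
    also have "\<dots> = (\<Sum>i=0..n. fps_nth c i * \<tau> (fps_nth F (n - i)))"
      by (intro sum.cong refl lin F)
    finally show "fps_nth (\<Phi> (fps_scalar c * F)) n = fps_nth (c * \<Phi> F) n"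
      by (simp add: fps_state_def fps_scalar_mult_nth fps_mult_nth[of c])
  qed
  show "\<Phi> (F * G) = \<Phi> (G * F)"
  proof (rule fps_ext)
    fix n
    have "\<tau> (\<Sum>i=0..n. fps_nth F i * fps_nth G (n - i)) = (\<Sum>i=0..n. \<tau> (fps_nth F i * fps_nth G (n - i)))"
      by (rule state_sum[OF vna state]) (intro A_closed F)
    also have "\<dots> = (\<Sum>i=0..n. \<tau> (fps_nth G (n - i) * fps_nth F i))"
      by (intro sum.cong refl lin F)
    also have "\<dots> = (\<Sum>i=0..n. \<tau> (fps_nth G i * fps_nth F (n - i)))"
      by (subst sum.atLeastAtMost_rev) simp
    also have "\<dots> = \<tau> (\<Sum>i=0..n. fps_nth G i * fps_nth F (n - i))"
      by (rule state_sum(1)[OF vna state, symmetric]) (intro A_closed F)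
    finally show "fps_nth (\<Phi> (F * G)) n = fps_nth (\<Phi> (G * F)) n"
      by (simp add: fps_state_def fps_mult_nth)
  qed
qed

lemma state_fps_scalar: "\<Phi> (fps_scalar c) = c"
  using state_fps_simps(3)[OF A_coeffs(1) A_coeffs(1)]
    state_fps_simps(4)[OF A_coeffs(1) A_coeffs(1), of c] by (simp add: fps_one_mult)

text \<open>The bridge from resolvents to scalar equations: evaluating at \<omega> instead of
  \<open>w\<close> means substituting \<open>q\<close> into the moment series.\<close>

lemma state_geometric_fps:
  assumes T: "T \<in> A" and q: "fps_nth q 0 = 0"
  shows "\<Phi> (geometric_fps q T) = Abs_fps (\<lambda>n. \<tau> (T ^ n)) oo q"
proof (rule fps_ext)
  fix m
  have "\<tau> (\<Sum>n=0..m. fps_nth (q ^ n) m *\<^sub>C T ^ n) = (\<Sum>n=0..m. \<tau> (fps_nth (q ^ n) m *\<^sub>C T ^ n))"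
    by (rule state_sum[OF vna state]) (intro A_closed T)
  also have "\<dots> = (\<Sum>n=0..m. fps_nth (q ^ n) m * \<tau> (T ^ n))"
    by (intro sum.cong refl lin A_closed T)
  finally show "fps_nth (\<Phi> (geometric_fps q T)) m = fps_nth (Abs_fps (\<lambda>n. \<tau> (T ^ n)) oo q) m"
    by (simp add: fps_state_def geometric_fps_def fps_compose_nth mult.commute)
qed

text \<open>One step of the geometric series. Three such steps relate the resolvent weighted with
  \<open>T ^ 3\<close> to the plain resolvent and the moments of order 0, 1 and 2.\<close>

lemma state_power_geometric:
  assumes T: "T \<in> A" and q: "fps_nth q 0 = 0"
  shows "\<Phi> (fps_const (T ^ k) * geometric_fps q T)
    = fps_const (\<tau> (T ^ k)) + q * \<Phi> (fps_const (T ^ Suc k) * geometric_fps q T)"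
proof -
  let ?g = "geometric_fps q T"
  have g: "coeffs_in A ?g" by (rule coeffs_in_geometric[OF A_sub T])
  have Tk: "coeffs_in A (fps_const (T ^ k))" for k by (intro A_coeffs A_closed T)
  have "fps_const (T ^ k) * ?g = fps_const (T ^ k) * (1 + fps_scalar q * (fps_const T * ?g))"
    by (subst (1) geometric_fps_unfold[OF q]) (rule refl)
  also have "\<dots> = fps_const (T ^ k) + fps_const (T ^ k) * (fps_scalar q * (fps_const T * ?g))"
    by (simp only: distrib_left fps_one_mult)
  also have "fps_const (T ^ k) * (fps_scalar q * (fps_const T * ?g))
      = fps_scalar q * (fps_const (T ^ k) * fps_const T * ?g)"
    by (simp only: mult.assoc[symmetric] fps_scalar_commute[of q "fps_const (T ^ k)"])
  also have "fps_const (T ^ k) * fps_const T = fps_const (T ^ Suc k)"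
    by (simp add: power_commutes)
  finally have "\<Phi> (fps_const (T ^ k) * ?g)
      = \<Phi> (fps_const (T ^ k)) + q * \<Phi> (fps_const (T ^ Suc k) * ?g)"
    by (simp only: state_fps_simps[OF Tk A_coeffs(5)[OF A_coeffs(6) A_coeffs(5)[OF Tk g]]]
        state_fps_simps(4)[OF A_coeffs(5)[OF Tk g] A_coeffs(5)[OF Tk g]])
  moreover have "\<Phi> (fps_const (T ^ k)) = fps_const (\<tau> (T ^ k))"
    by (simp add: fps_eq_iff fps_state_def lin)
  ultimately show ?thesis by simp
qed

end

section \<open>Free pairs\<close>

inductive_set alternating_span :: "('a::chilbert_space bop \<Rightarrow> complex) \<Rightarrow> (nat \<Rightarrow> 'a bop set) \<Rightarrow> 'a bop set"
  for \<tau> \<B> where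
  word: "\<lbrakk>is \<noteq> []; last is = 1; set is \<subseteq> {..<2}; distinct_adj is; length Ts = length is;
    \<forall>k<length is. Ts ! k \<in> \<B> (is ! k) \<and> \<tau> (Ts ! k) = 0\<rbrakk> \<Longrightarrow> prod_list Ts \<in> alternating_span \<tau> \<B>"
| zero: "0 \<in> alternating_span \<tau> \<B>"
| add: "x \<in> alternating_span \<tau> \<B> \<Longrightarrow> y \<in> alternating_span \<tau> \<B> \<Longrightarrow> x + y \<in> alternating_span \<tau> \<B>"

lemma alternating_span_sum: "(\<And>i. i \<in> I \<Longrightarrow> f i \<in> alternating_span \<tau> \<B>) \<Longrightarrow> sum f I \<in> alternating_span \<tau> \<B>"
  by (induction I rule: infinite_finite_induct) (auto intro: alternating_span.intros)

lemma alternating_span_base: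
  assumes "v \<in> \<B> 1" "\<tau> v = 0"
  shows "v \<in> alternating_span \<tau> \<B>"
    "u \<in> \<B> 0 \<Longrightarrow> \<tau> u = 0 \<Longrightarrow> u * v \<in> alternating_span \<tau> \<B>"
  using alternating_span.word[of "[1]" "[v]" \<B> \<tau>] alternating_span.word[of "[0, 1]" "[u, v]" \<B> \<tau>] assms
  by (auto simp: nth_Cons split: nat.split)

lemma alternating_span_extend:
  assumes "x \<in> alternating_span \<tau> \<B>" and u: "u \<in> \<B> 0" "\<tau> u = 0" and v: "v \<in> \<B> 1" "\<tau> v = 0"
  shows "x * (u * v) \<in> alternating_span \<tau> \<B>"
  using assms(1)
proof induction
  case (word "is" Ts)
  have "prod_list (Ts @ [u, v]) \<in> alternating_span \<tau> \<B>"
  proof (rule alternating_span.word)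
    show "is @ [0, 1] \<noteq> []" "last (is @ [0, 1]) = 1" "set (is @ [0, 1]) \<subseteq> {..<2}"
      "length (Ts @ [u, v]) = length (is @ [0, 1])" using word by auto
    show "distinct_adj (is @ [0, 1])" using word by (simp add: distinct_adj_append_iff)
    show "\<forall>k<length (is @ [0, 1]). (Ts @ [u, v]) ! k \<in> \<B> ((is @ [0, 1]) ! k) \<and> \<tau> ((Ts @ [u, v]) ! k) = 0"
    proof (intro allI impI)
      fix k assume "k < length (is @ [0, 1])"
      then consider "k < length is" | "k = length is" | "k = Suc (length is)" by fastforce
      then show "(Ts @ [u, v]) ! k \<in> \<B> ((is @ [0, 1]) ! k) \<and> \<tau> ((Ts @ [u, v]) ! k) = 0"
        using word u v by cases (simp_all add: nth_append)
    qed
  qed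
  then show ?case by (simp add: mult.assoc)
qed (auto simp: distrib_right intro: alternating_span.intros)

lemma alternating_span_state:
  assumes "tracial_algebra A \<tau>" and free: "free_algebras \<tau> {..<2::nat} \<B>" and sub: "\<And>i. \<B> i \<subseteq> A"
    and "x \<in> alternating_span \<tau> \<B>"
  shows "x \<in> A \<and> \<tau> x = 0"
  using assms(4)
proof induction
  case (word "is" Ts)
  interpret tracial_algebra A \<tau> by fact
  have "set Ts \<subseteq> A" using word sub by (force simp: in_set_conv_nth)
  then have "prod_list Ts \<in> A" by (induction Ts) (auto simp: A_closed)
  moreover have "\<tau> (prod_list Ts) = 0"
    using free word unfolding free_algebras_def by blast
  ultimately show ?case by blast
next
  case zero
  interpret tracial_algebra A \<tau> by fact
  show ?case by (simp add: lin A_closed)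
next
  case (add x y)
  interpret tracial_algebra A \<tau> by fact
  show ?case using add by (simp add: lin A_closed)
qed

locale free_pair = tracial_algebra +
  fixes U V :: "'a::chilbert_space bop"
  assumes U: "U \<in> A" and V: "V \<in> A"
    and free: "free_algebras \<tau> {..<2::nat} (\<lambda>i. generated_algebra (if i = 0 then U else V))"
begin

abbreviation "words \<equiv> alternating_span \<tau> (\<lambda>i. generated_algebra (if i = 0 then U else V))"

lemma words_state: "x \<in> words \<Longrightarrow> x \<in> A \<and> \<tau> x = 0"
  by (rule alternating_span_state[OF tracial_algebra_axioms free])
    (use generated_algebra_in_vna[OF vna U] generated_algebra_in_vna[OF vna V] in auto)

lemma coeffs_in_words: "coeffs_in words F \<Longrightarrow> coeffs_in A F \<and> \<Phi> F = 0"
  using words_state by (auto simp: coeffs_in_def fps_state_def fps_eq_iff)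

lemmas genU_A = generated_algebra_in_vna[OF vna U]
lemmas genV_A = generated_algebra_in_vna[OF vna V]

lemma words_series:
  assumes a: "coeffs_in (generated_algebra U) a" "\<Phi> a = 0"
    and b: "coeffs_in (generated_algebra V) b" "\<Phi> b = 0"
  shows "coeffs_in words b" "coeffs_in words (a * b)"
    "coeffs_in words F \<Longrightarrow> coeffs_in words (F * (a * b))"
proof -
  have a': "fps_nth a n \<in> generated_algebra U" "\<tau> (fps_nth a n) = 0" for n
    using a by (auto simp: coeffs_in_def fps_state_def fps_eq_iff)
  have b': "fps_nth b n \<in> generated_algebra V" "\<tau> (fps_nth b n) = 0" for n
    using b by (auto simp: coeffs_in_def fps_state_def fps_eq_iff)
  show "coeffs_in words b"
    using b' by (auto simp: coeffs_in_def intro!: alternating_span_base(1))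
  show "coeffs_in words (a * b)"
    using a' b' by (auto simp: coeffs_in_def fps_mult_nth intro!: alternating_span_sum alternating_span_base(2))
  show "coeffs_in words (F * (a * b))" if "coeffs_in words F"
    using a' b' that by (auto simp: coeffs_in_def fps_mult_nth sum_distrib_left
        intro!: alternating_span_sum alternating_span_extend)
qed

text \<open>Iterating \<open>y = 1 + a b y\<close> only lengthens an alternating word on the left of \<open>y\<close>, and raises
  its order because \<open>a\<close> has no constant term.\<close>

lemma state_words_times:
  assumes a: "coeffs_in (generated_algebra U) a" "\<Phi> a = 0" "fps_nth a 0 = 0"
    and b: "coeffs_in (generated_algebra V) b" "\<Phi> b = 0"
    and y: "coeffs_in A y" "y = 1 + a * b * y" and F: "coeffs_in words F"
  shows "\<Phi> (F * y) = 0"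
proof -
  \<comment> \<open>Factoring the variable out of \<open>a\<close> leaves a series that is still
    centred and in the algebra of \<open>U\<close>; the extracted factor drives the induction on the
    order.\<close>
  define a' where "a' = fps_shift 1 a"
  have a'_in: "coeffs_in (generated_algebra U) a'" and a'_0: "\<Phi> a' = 0"
    using a by (auto simp: a'_def coeffs_in_def fps_state_def fps_eq_iff)
  have a_eq: "a = fps_scalar fps_X * a'"
  proof (rule fps_ext)
    fix n
    have "fps_nth (fps_scalar fps_X * a') n = (\<Sum>i=0..n. if i = 1 then fps_nth a' (n - i) else 0)"
      unfolding fps_scalar_mult_nth
      by (intro sum.cong refl) (simp add: fps_X_def scaleC_one scaleC_zero_left)
    also have "\<dots> = fps_nth a n" by (cases n) (simp_all add: a'_def a(3))
    finally show "fps_nth a n = fps_nth (fps_scalar fps_X * a') n" by simp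
  qed
  \<comment> \<open>The summand 1 of \<open>y\<close> contributes the state of \<open>F\<close>,
    which is 0. The rest is the same kind of expression with a longer word and one more factor of
    the variable.\<close>
  have step: "\<Phi> (F * y) = fps_X * \<Phi> (F * (a' * b) * y)" if F: "coeffs_in words F" for F
  proof -
    have "F * y = F + F * (a * b * y)"
      by (subst (1) y(2)) (simp only: distrib_left fps_one_mult)
    also have "F * (a * b * y) = fps_scalar fps_X * (F * (a' * b) * y)"
      unfolding a_eq by (simp only: mult.assoc[symmetric] fps_scalar_commute[of fps_X F])
    finally have eq: "F * y = F + fps_scalar fps_X * (F * (a' * b) * y)" .
    have A1: "coeffs_in A (F * (a' * b) * y)"
      by (rule A_coeffs(5)[OF conjunct1[OF coeffs_in_words[OF words_series(3)[OF a'_in a'_0 b F]]] y(1)])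
    have A2: "coeffs_in A F" "\<Phi> F = 0" using coeffs_in_words[OF F] by auto
    show ?thesis
      by (simp only: eq state_fps_simps(1)[OF A2(1) A_coeffs(5)[OF A_coeffs(6) A1]]
          state_fps_simps(4)[OF A1 A1] A2(2) add_0)
  qed
  have "fps_nth (\<Phi> (F * y)) n = 0" if "coeffs_in words F" for F n
    using that
  proof (induction n arbitrary: F)
    case 0
    then show ?case by (simp add: step)
  next
    case (Suc n)
    have "fps_nth (\<Phi> (F * (a' * b) * y)) n = 0"
      by (rule Suc.IH) (rule words_series(3)[OF a'_in a'_0 b Suc.prems])
    then show ?case by (simp add: step[OF Suc.prems])
  qed
  then show ?thesis using F by (simp add: fps_eq_iff)
qed

text \<open>Here \<open>P'\<close> and \<open>Q'\<close> stand for \<open>G w (\<omega> - U)\<close>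
  and \<open>G w (\<omega> - V)\<close>, so \<open>P' + Q' - 1\<close> is \<open>G w (w - S)\<close>
  by the choice of \<omega>. Traciality moves \<open>P\<close> to the front and gives
  \<open>P x Q y = x' y + x' b y\<close> with \<open>x' = P x\<close>. Once \<open>x'\<close> is
  split into its state and a centred part, every term but the state of \<open>x'\<close> vanishes by
  freeness.\<close>

lemma state_resolvent_sum_normalized:
  assumes P: "coeffs_in (generated_algebra U) P" "\<Phi> P = 1" "fps_nth P 0 = 1"
    and Q: "coeffs_in (generated_algebra V) Q" "\<Phi> Q = 1"
    and P': "coeffs_in A P'" "P * P' = 1" "P' * P = 1"
    and Q': "coeffs_in A Q'" "Q * Q' = 1" "Q' * Q = 1"
    and w: "coeffs_in A w" "(P' + Q' - 1) * w = 1"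
    and x: "x \<in> generated_algebra U"
  shows "\<Phi> (fps_const x * w) = \<Phi> (P * fps_const x)"
proof -
  note U_coeffs = coeffs_in_closed[OF unital_subalgebra_generated[of U]]
  note V_coeffs = coeffs_in_closed[OF unital_subalgebra_generated[of V]]
  define a where "a = P - 1"
  define b where "b = Q - 1"
  obtain y where y_def: "y = Q' * w * P'" and w_eq: "w = Q * y * P"
    and y: "y = 1 + (P - 1) * (Q - 1) * y"
    by (rule resolvent_factorization[OF fps_one_mult P'(2,3) Q'(2,3) w(2)]) blast
  have a: "coeffs_in (generated_algebra U) a" unfolding a_def by (intro U_coeffs P)
  have b: "coeffs_in (generated_algebra V) b" unfolding b_def by (intro V_coeffs Q)
  note toA = coeffs_in_mono[OF _ genU_A] coeffs_in_mono[OF _ genV_A]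
  have PA: "coeffs_in A P" "coeffs_in A Q" "coeffs_in A a" "coeffs_in A b"
    using P Q a b toA by blast+
  have a0: "\<Phi> a = 0" "\<Phi> b = 0" "fps_nth a 0 = 0"
    unfolding a_def b_def using state_fps_simps(2)[OF PA(1) A_coeffs(1)]
      state_fps_simps(2)[OF PA(2) A_coeffs(1)] state_fps_simps(3)[OF PA(1) PA(1)] P Q by simp_all
  have yA: "coeffs_in A y" unfolding y_def by (intro A_coeffs Q' w P')
  have y': "y = 1 + a * b * y" unfolding a_def b_def by (rule y)
  note kill = state_words_times[OF a a0(1,3) b a0(2) yA y']
  have b_y: "\<Phi> (b * y) = 0" by (rule kill[OF words_series(1)[OF a a0(1) b a0(2)]])
  have y1: "\<Phi> y = 1"
  proof -
    have "\<Phi> y = \<Phi> (1 + a * b * y)" using y' by simp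
    also have "\<dots> = 1 + \<Phi> (a * b * y)"
      by (simp only: state_fps_simps[OF A_coeffs(1) A_coeffs(5)[OF A_coeffs(5)[OF PA(3,4)] yA]])
    also have "\<Phi> (a * b * y) = 0" by (rule kill[OF words_series(2)[OF a a0(1) b a0(2)]])
    finally show ?thesis by simp
  qed
  have centre: "\<exists>x1. x' = fps_scalar (\<Phi> x') + x1 \<and> coeffs_in (generated_algebra U) x1 \<and> \<Phi> x1 = 0"
    if "coeffs_in (generated_algebra U) x'" for x'
  proof (intro exI conjI)
    show "x' = fps_scalar (\<Phi> x') + (x' - fps_scalar (\<Phi> x'))" by simp
    show "coeffs_in (generated_algebra U) (x' - fps_scalar (\<Phi> x'))" by (intro U_coeffs that)
    show "\<Phi> (x' - fps_scalar (\<Phi> x')) = 0"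
      using state_fps_simps(2)[OF toA(1)[OF that] A_coeffs(6)] by (simp add: state_fps_scalar)
  qed
  define x' where "x' = P * fps_const x"
  have x': "coeffs_in (generated_algebra U) x'" unfolding x'_def by (intro U_coeffs P x)
  obtain x0 where x0: "x' = fps_scalar (\<Phi> x') + x0" "coeffs_in (generated_algebra U) x0" "\<Phi> x0 = 0"
    using centre[OF x'] by blast
  have x0A: "coeffs_in A x0" by (rule toA(1)[OF x0(2)])
  \<comment> \<open>Expanding \<open>y\<close> to the right of \<open>x0\<close> creates two
    neighbouring factors from the algebra of \<open>U\<close>, which is not an alternating word.
    Their product is therefore split again into a scalar and a centred part.\<close>
  have "coeffs_in (generated_algebra U) (x0 * a)" by (intro U_coeffs x0 a)
  from centre[OF this] obtain x1 where
    x1: "x0 * a = fps_scalar (\<Phi> (x0 * a)) + x1" "coeffs_in (generated_algebra U) x1" "\<Phi> x1 = 0"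
    by blast
  have x1A: "coeffs_in A x1" by (rule toA(1)[OF x1(2)])
  have byA: "coeffs_in A (b * y)" by (intro A_coeffs PA yA)
  have x_by: "\<Phi> ((fps_scalar c + x2) * (b * y)) = 0"
    if x2: "coeffs_in (generated_algebra U) x2" "\<Phi> x2 = 0" for c x2
  proof -
    have x2A: "coeffs_in A (x2 * (b * y))" by (rule A_coeffs(5)[OF toA(1)[OF x2(1)] byA])
    have "\<Phi> (x2 * b * y) = 0" by (rule kill[OF words_series(2)[OF x2 b a0(2)]])
    then have "\<Phi> (x2 * (b * y)) = 0" by (simp only: mult.assoc)
    then show ?thesis
      by (simp only: distrib_right state_fps_simps(1)[OF A_coeffs(5)[OF A_coeffs(6) byA] x2A]
          state_fps_simps(4)[OF byA byA] b_y mult_zero_right add_0)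
  qed
  have x0y: "\<Phi> (x0 * y) = 0"
  proof -
    have "x0 * y = x0 + x0 * a * (b * y)"
      by (subst (1) y') (simp only: distrib_left fps_one_mult mult.assoc)
    also have "x0 * a * (b * y) = (fps_scalar (\<Phi> (x0 * a)) + x1) * (b * y)" using x1(1) by simp
    finally have "\<Phi> (x0 * y) = \<Phi> x0 + \<Phi> ((fps_scalar (\<Phi> (x0 * a)) + x1) * (b * y))"
      by (simp only: state_fps_simps(1)[OF x0A A_coeffs(5)[OF A_coeffs(3)[OF A_coeffs(6) x1A] byA]])
    then show ?thesis by (simp only: x_by[OF x1(2,3)] x0(3) add_0)
  qed
  have xA: "coeffs_in A (fps_const x)" using x genU_A by (intro A_coeffs) auto
  have QyA: "coeffs_in A (Q * y)" by (intro A_coeffs PA yA)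
  have "\<Phi> (fps_const x * w) = \<Phi> (fps_const x * (Q * y) * P)" by (simp only: w_eq mult.assoc)
  also have "\<dots> = \<Phi> (P * (fps_const x * (Q * y)))"
    by (rule state_fps_simps(5)[OF A_coeffs(5)[OF xA QyA] PA(1)])
  also have "P * (fps_const x * (Q * y)) = x' * y + x' * (b * y)"
    by (simp add: x'_def b_def algebra_simps fps_one_mult)
  also have "\<Phi> (x' * y + x' * (b * y)) = \<Phi> (x' * y) + \<Phi> (x' * (b * y))"
    by (rule state_fps_simps(1)[OF A_coeffs(5)[OF toA(1)[OF x'] yA] A_coeffs(5)[OF toA(1)[OF x'] byA]])
  also have "\<Phi> (x' * (b * y)) = 0" using x_by[OF x0(2,3)] x0(1) by metis
  also have "\<Phi> (x' * y) = \<Phi> (fps_scalar (\<Phi> x') * y + x0 * y)"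
    by (subst (1) x0(1)) (simp only: distrib_right)
  also have "\<dots> = \<Phi> x'"
    by (simp only: state_fps_simps(1)[OF A_coeffs(5)[OF A_coeffs(6) yA] A_coeffs(5)[OF x0A yA]]
        state_fps_simps(4)[OF yA yA] y1 x0y mult_1_right add_0_right)
  finally show ?thesis by (simp add: x'_def)
qed

text \<open>In resolvents, \<open>g = w G w\<close> and \<open>N = \<omega> G w\<close>. The
  conclusion is \<open>\<tau> (x (w - S)\<^sup>-\<^sup>1) = \<tau> (x (\<omega> -
  U)\<^sup>-\<^sup>1)\<close> after multiplication by \<open>w \<omega> G w\<close>.\<close>

lemma state_resolvent_sum:
  fixes q N :: "complex fps"
  defines "g \<equiv> Abs_fps (\<lambda>n. \<tau> ((U + V) ^ n))"
  assumes q: "fps_nth q 0 = 0" "N * q = fps_X * g" and N: "2 * N = 1 + g"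
    and NU: "\<Phi> (geometric_fps q U) = N" and NV: "\<Phi> (geometric_fps q V) = N"
    and x: "x \<in> generated_algebra U"
  shows "N * \<Phi> (fps_const x * geometric_fps fps_X (U + V)) = g * \<Phi> (fps_const x * geometric_fps q U)"
proof -
  let ?u = "geometric_fps q U" and ?v = "geometric_fps q V" and ?w = "geometric_fps fps_X (U + V)"
  have g0: "fps_nth g 0 = 1" by (simp add: g_def lin)
  have N0: "fps_nth N 0 = 1" using arg_cong[OF N, of "\<lambda>F. fps_nth F 0"] g0 by (simp add: numeral_fps_const)
  have inv: "inverse N * N = 1" "N * inverse N = 1" "inverse g * g = 1" "g * inverse g = 1"
    using inverse_mult_eq_1[of N] inverse_mult_eq_1[of g] inverse_mult_eq_1'[of N]
      inverse_mult_eq_1'[of g] N0 g0 by auto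
  have X0: "fps_nth (fps_X :: complex fps) 0 = 0" by simp
  define P where "P = fps_scalar (inverse N) * ?u"
  define Q where "Q = fps_scalar (inverse N) * ?v"
  define P' where "P' = fps_scalar N * (1 - fps_scalar q * fps_const U)"
  define Q' where "Q' = fps_scalar N * (1 - fps_scalar q * fps_const V)"
  define w where "w = fps_scalar (inverse g) * ?w"
  note U_coeffs = coeffs_in_closed[OF unital_subalgebra_generated[of U]]
  note V_coeffs = coeffs_in_closed[OF unital_subalgebra_generated[of V]]
  have u: "coeffs_in (generated_algebra U) ?u" "coeffs_in A ?u"
    by (intro coeffs_in_geometric unital_subalgebra_generated generated_algebra_self A_sub U)+
  have v: "coeffs_in (generated_algebra V) ?v" "coeffs_in A ?v"
    by (intro coeffs_in_geometric unital_subalgebra_generated generated_algebra_self A_sub V)+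
  have wA: "coeffs_in A ?w" by (intro coeffs_in_geometric A_sub A_closed U V)
  have cancel: "fps_scalar c * F * (fps_scalar d * G) = F * G" if "c * d = 1" for c d and F G :: "'a bop fps"
  proof -
    have "fps_scalar c * F * (fps_scalar d * G) = fps_scalar c * (F * fps_scalar d) * G"
      by (simp only: mult.assoc)
    also have "F * fps_scalar d = fps_scalar d * F" by (rule fps_scalar_commute[symmetric])
    also have "fps_scalar c * (fps_scalar d * F) * G = fps_scalar (c * d) * (F * G)"
      by (simp only: mult.assoc fps_scalar_simps)
    finally show ?thesis by (simp add: that fps_scalar_simps fps_one_mult)
  qed
  \<comment> \<open>The constant part is \<open>2 * N - 1 = g\<close>, and the coefficient of
    \<open>U + V\<close> is \<open>N * q = fps_X * g\<close>. The two relations defining \<omega>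
    are thus what turns the sum into a multiple of the denominator for \<open>S\<close>.\<close>
  have "P' + Q' - 1 = fps_scalar g * (1 - fps_scalar fps_X * fps_const (U + V))"
  proof -
    have sq: "fps_scalar N * (fps_scalar q * F) = fps_scalar g * (fps_scalar fps_X * F)" for F :: "'a bop fps"
      by (simp only: mult.assoc[symmetric] fps_scalar_simps(4)[symmetric] q(2) mult.commute[of fps_X g])
    have "P' + Q' - 1 = (fps_scalar N + fps_scalar N - fps_scalar 1)
        - fps_scalar N * (fps_scalar q * (fps_const U + fps_const V))"
    proof -
      have regroup: "(c - F) + (c - G) - e = (c + c - e) - (F + G)" for c e F G :: "'a bop fps"
        by (simp add: algebra_simps)
      show ?thesis
        unfolding P'_def Q'_def right_diff_distrib distrib_left fps_one_mult fps_scalar_simps(1)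
        by (rule regroup)
    qed
    also have "fps_scalar N + fps_scalar N - fps_scalar 1 = (fps_scalar g :: 'a bop fps)"
      by (simp only: fps_scalar_simps(2,3)[symmetric] mult_2[symmetric] N add_diff_cancel_left')
    finally show ?thesis by (simp only: sq right_diff_distrib fps_one_mult fps_const_add)
  qed
  then have w1: "(P' + Q' - 1) * w = 1"
    unfolding w_def by (simp only: cancel[OF inv(4)] geometric_fps_inverse(1)[OF X0])
  have "\<Phi> (fps_const x * w) = \<Phi> (P * fps_const x)"
  proof (rule state_resolvent_sum_normalized[OF _ _ _ _ _ _ _ _ _ _ _ _ w1 x])
    show "coeffs_in (generated_algebra U) P" unfolding P_def by (intro U_coeffs u)
    show "coeffs_in (generated_algebra V) Q" unfolding Q_def by (intro V_coeffs v)
    show "\<Phi> P = 1" "\<Phi> Q = 1"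
      unfolding P_def Q_def state_fps_simps(4)[OF u(2) u(2)] state_fps_simps(4)[OF v(2) v(2)] NU NV
      by (rule inv)+
    show "fps_nth P 0 = 1"
      by (simp add: P_def geometric_fps_0 fps_scalar_def N0 scaleC_one)
    show "coeffs_in A P'" unfolding P'_def by (intro A_coeffs U)
    show "coeffs_in A Q'" unfolding Q'_def by (intro A_coeffs V)
    show "coeffs_in A w" unfolding w_def by (intro A_coeffs wA)
    show "P * P' = 1" "P' * P = 1" "Q * Q' = 1" "Q' * Q = 1"
      unfolding P_def P'_def Q_def Q'_def cancel[OF inv(1)] cancel[OF inv(2)]
      by (rule geometric_fps_inverse[OF q(1)])+
  qed
  moreover have xA: "coeffs_in A (fps_const x)" using x genU_A by (intro A_coeffs) auto
  have "\<Phi> (fps_const x * w) = inverse g * \<Phi> (fps_const x * ?w)"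
  proof -
    have "fps_const x * w = fps_scalar (inverse g) * (fps_const x * ?w)"
      unfolding w_def by (simp only: mult.assoc[symmetric] fps_scalar_commute[of _ "fps_const x"])
    then show ?thesis by (simp only: state_fps_simps(4)[OF A_coeffs(5)[OF xA wA] xA])
  qed
  moreover have "\<Phi> (P * fps_const x) = inverse N * \<Phi> (fps_const x * ?u)"
    unfolding P_def mult.assoc state_fps_simps(4)[OF A_coeffs(5)[OF u(2) xA] xA]
    by (simp only: state_fps_simps(5)[OF u(2) xA])
  ultimately have "inverse g * \<Phi> (fps_const x * ?w) = inverse N * \<Phi> (fps_const x * ?u)" by simp
  then have "N * g * (inverse g * \<Phi> (fps_const x * ?w)) = N * g * (inverse N * \<Phi> (fps_const x * ?u))"
    by (rule arg_cong)
  also have "N * g * (inverse g * \<Phi> (fps_const x * ?w)) = (g * inverse g) * (N * \<Phi> (fps_const x * ?w))"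
    by (simp only: ac_simps)
  also have "N * g * (inverse N * \<Phi> (fps_const x * ?u)) = (N * inverse N) * (g * \<Phi> (fps_const x * ?u))"
    by (simp only: ac_simps)
  finally show ?thesis by (simp only: inv mult_1_left)
qed

end


section \<open>The third conditional moment\<close>

text \<open>The difference of the equations is
  \<open>(M - N) * (\<alpha> * (M + N) - \<beta>)\<close>, and the second factor has constant term
  \<open>2 \<alpha>(0) - \<beta>(0)\<close>. Normalisation of the zeroth moment thereby selects one
  branch of the square root.\<close>

lemma quadratic_root_unique:
  fixes M N :: "complex fps"
  assumes M: "\<alpha> * M\<^sup>2 - \<beta> * M + \<gamma> = 0" and N: "\<alpha> * N\<^sup>2 - \<beta> * N + \<gamma> = 0"
    and start: "fps_nth M 0 = 1" "fps_nth N 0 = 1" "2 * fps_nth \<alpha> 0 \<noteq> fps_nth \<beta> 0"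
  shows "M = N"
proof -
  have "(M - N) * (\<alpha> * (M + N) - \<beta>) = (\<alpha> * M\<^sup>2 - \<beta> * M + \<gamma>) - (\<alpha> * N\<^sup>2 - \<beta> * N + \<gamma>)"
    by (simp add: power2_eq_square algebra_simps)
  then have "(M - N) * (\<alpha> * (M + N) - \<beta>) = 0" by (simp only: M N diff_zero)
  moreover have "fps_nth (\<alpha> * (M + N) - \<beta>) 0 \<noteq> 0" using start by (simp add: mult.commute)
  then have "\<alpha> * (M + N) - \<beta> \<noteq> 0" by (metis fps_zero_nth)
  ultimately show ?thesis by simp
qed

text \<open>After substituting \<open>M = 1 + fps_X * R\<close>, the terms of order 0 cancel and one
  factor of the variable can be removed. What remains determines \<open>R\<close> recursively,
  because its linear coefficient \<open>s\<close> is nonzero.\<close>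

lemma meixner_moments_1_2:
  fixes M :: "complex fps"
  assumes M: "(fps_const (of_real b) + fps_const (of_real (a * s)) * fps_X + fps_const (of_real (s\<^sup>2)) * fps_X\<^sup>2) * M\<^sup>2
    - (fps_const (of_real (s + 2 * b)) + fps_const (of_real (a * s)) * fps_X) * M
    + fps_const (of_real (s + b)) = 0"
    and M0: "fps_nth M 0 = 1" and s: "s > 0"
  shows "fps_nth M 1 = 0" "fps_nth M 2 = of_real s"
proof -
  let ?B = "fps_const (complex_of_real b)" and ?A = "fps_const (complex_of_real a)"
    and ?s = "fps_const (complex_of_real s)"
  define R where "R = fps_shift 1 M"
  have M_eq: "M = 1 + fps_X * R"
    by (rule fps_ext) (simp add: R_def M0)
  have const_eqs: "fps_const (complex_of_real (a * s)) = ?A * ?s" "fps_const (complex_of_real (s\<^sup>2)) = ?s\<^sup>2"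
    "fps_const (complex_of_real (s + 2 * b)) = ?s + 2 * ?B" "fps_const (complex_of_real (s + b)) = ?s + ?B"
    by (simp_all add: power2_eq_square numeral_fps_const)
  have "fps_X * (?s * R) = fps_X * (fps_X * (?B * R\<^sup>2 + ?A * ?s * R + ?A * ?s * fps_X * R\<^sup>2 + ?s\<^sup>2 * M\<^sup>2))"
    using M unfolding const_eqs unfolding M_eq by algebra
  then have sR: "?s * R = fps_X * (?B * R\<^sup>2 + ?A * ?s * R + ?A * ?s * fps_X * R\<^sup>2 + ?s\<^sup>2 * M\<^sup>2)"
    by simp
  have "fps_nth (?s * R) 0 = 0" unfolding sR by simp
  then have R0: "fps_nth R 0 = 0" using s by simp
  then show "fps_nth M 1 = 0" by (simp add: R_def)
  have "fps_nth (?s * R) 1 = of_real (s\<^sup>2)"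
    unfolding sR using R0 M0 by (simp add: power2_eq_square mult.assoc)
  then have "fps_nth R 1 = of_real s" using s by (simp add: power2_eq_square)
  then show "fps_nth M 2 = of_real s" by (simp add: R_def numeral_2_eq_2)
qed

text \<open>Purely algebraic elimination. \<open>L\<close> and \<open>t3\<close> are the resolvents
  of \<open>S\<close> at \<open>w\<close> and of \<open>U\<close> at \<omega> weighted with
  \<open>U ^ 3\<close>; \<open>r1\<close>, \<open>r2\<close>, \<open>r3\<close> are the resolvents
  of \<open>S\<close> weighted with its powers. All of them are rational in \<open>z\<close> and
  \<open>g\<close>, and the claim becomes a multiple of the quadratic equation
  \<open>E\<close>.\<close>

lemma cubic_moment_identity:
  fixes z g N q L r1 r2 r3 t3 a b t :: "complex fps"
  assumes E: "(b + 2 * a * t * z + 4 * t\<^sup>2 * z\<^sup>2) * g\<^sup>2 - (2 * t + 2 * b + 2 * a * t * z) * g + (2 * t + b) = 0"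
    and N: "2 * N = 1 + g" and q: "N * q = z * g"
    and t3: "N = 1 + q * (q * (t + q * t3))" and L: "N * L = g * t3"
    and r: "g = 1 + z * r1" "r1 = z * r2" "r2 = 2 * t + z * r3"
    and ne: "z \<noteq> 0" "g \<noteq> 0" "N \<noteq> 0"
  shows "2 * (b + 2 * t)\<^sup>2 * L = (b + t)\<^sup>2 * r3 + 2 * a * t * (b + t) * r2
    + ((b + a\<^sup>2) * t\<^sup>2 + 2 * t\<^sup>2 * (b + 2 * t)) * r1 + 2 * a * t ^ 3 * g"
proof -
  \<comment> \<open>Multiply \<open>t3\<close> by \<open>N ^ 3\<close> and replace each
    \<open>N * q\<close> by \<open>z * g\<close>: this eliminates \<open>q\<close> and the resolvent
    of \<open>U\<close> together.\<close>
  have "N * (z ^ 3 * g\<^sup>2 * L) = N * (N ^ 3 - N\<^sup>2 - t * z\<^sup>2 * g\<^sup>2)"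
    using t3 L q by algebra
  then have "z ^ 3 * g\<^sup>2 * L = N ^ 3 - N\<^sup>2 - t * z\<^sup>2 * g\<^sup>2" using ne(3) by simp
  then have L8: "8 * z ^ 3 * g\<^sup>2 * L = (g - 1) * (1 + g)\<^sup>2 - 8 * t * z\<^sup>2 * g\<^sup>2"
    using N by algebra
  have r3: "z ^ 3 * r3 = g - 1 - 2 * t * z\<^sup>2" and r2: "z\<^sup>2 * r2 = g - 1" and r1: "z * r1 = g - 1"
    using r by algebra+
  let ?lhs = "2 * (b + 2 * t)\<^sup>2 * L"
  let ?rhs = "(b + t)\<^sup>2 * r3 + 2 * a * t * (b + t) * r2
    + ((b + a\<^sup>2) * t\<^sup>2 + 2 * t\<^sup>2 * (b + 2 * t)) * r1 + 2 * a * t ^ 3 * g"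
  define W where "W = (b + t)\<^sup>2 * (g - 1 - 2 * t * z\<^sup>2) + 2 * a * t * (b + t) * z * (g - 1)
    + ((b + a\<^sup>2) * t\<^sup>2 + 2 * t\<^sup>2 * (b + 2 * t)) * z\<^sup>2 * (g - 1) + 2 * a * t ^ 3 * z ^ 3 * g"
  have W: "z ^ 3 * ?rhs = W" unfolding W_def using r3 r2 r1 by algebra
  \<comment> \<open>The linear factor on the right is the quotient on dividing the left side, a
    cubic in \<open>g\<close>, by the quadratic polynomial of \<open>E\<close>.\<close>
  have "4 * g\<^sup>2 * W - (b + 2 * t)\<^sup>2 * ((g - 1) * (1 + g)\<^sup>2 - 8 * t * z\<^sup>2 * g\<^sup>2)
     = ((3 * b + 4 * t + 2 * a * t * z) * g + (b + 2 * t))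
      * ((b + 2 * a * t * z + 4 * t\<^sup>2 * z\<^sup>2) * g\<^sup>2 - (2 * t + 2 * b + 2 * a * t * z) * g + (2 * t + b))"
    unfolding W_def by algebra
  also have "\<dots> = 0" unfolding E by simp
  finally have "4 * g\<^sup>2 * W = (b + 2 * t)\<^sup>2 * (8 * z ^ 3 * g\<^sup>2 * L)" unfolding L8 by simp
  then have "(4 * z ^ 3 * g\<^sup>2) * ?lhs = (4 * z ^ 3 * g\<^sup>2) * ?rhs" using W by algebra
  moreover have "4 * z ^ 3 * g\<^sup>2 \<noteq> 0" using ne by simp
  ultimately show ?thesis using mult_left_cancel by blast
qed

context free_pair
begin

text \<open>The generating function identity read off in degree \<open>n\<close>: the resolvent
  weighted with \<open>S ^ k\<close> has \<open>\<tau> (S ^ (n + k))\<close> as its coefficient,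
  whence the shifted moments.\<close>

lemma free_meixner_cubic_moments:
  fixes a b t :: real
  defines "E s M \<equiv> (fps_const (of_real b) + fps_const (of_real (a * s)) * fps_X
        + fps_const (of_real (s\<^sup>2)) * fps_X\<^sup>2) * M\<^sup>2
      - (fps_const (of_real (s + 2 * b)) + fps_const (of_real (a * s)) * fps_X) * M
      + fps_const (complex_of_real (s + b))"
  assumes t: "t > 0" and same: "\<And>n. \<tau> (V ^ n) = \<tau> (U ^ n)"
    and EU: "E t (Abs_fps (\<lambda>n. \<tau> (U ^ n))) = 0"
    and ES: "E (2 * t) (Abs_fps (\<lambda>n. \<tau> ((U + V) ^ n))) = 0"
  shows "of_real (2 * (b + 2 * t)\<^sup>2) * \<tau> (U ^ 3 * (U + V) ^ n)
    = of_real ((b + t)\<^sup>2) * \<tau> ((U + V) ^ (n + 3)) + of_real (2 * a * t * (b + t)) * \<tau> ((U + V) ^ (n + 2))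
      + of_real ((b + a\<^sup>2) * t\<^sup>2 + 2 * t\<^sup>2 * (b + 2 * t)) * \<tau> ((U + V) ^ (n + 1))
      + of_real (2 * a * t ^ 3) * \<tau> ((U + V) ^ n)"
proof -
  define S where "S = U + V"
  define M where "M = Abs_fps (\<lambda>n. \<tau> (U ^ n))"
  define g where "g = Abs_fps (\<lambda>n. \<tau> (S ^ n))"
  \<comment> \<open>With \<open>G\<close> the Cauchy transform of \<open>S\<close>, \<open>N\<close>
    encodes \<open>\<omega> G w = (w G w + 1) / 2\<close>, and \<open>q\<close> below is
    \<open>1 / \<omega>\<close>.\<close>
  define N where "N = fps_const (1 / 2) * (1 + g)"
  define q where "q = fps_X * g * inverse N"
  define r where "r k = \<Phi> (fps_const (S ^ k) * geometric_fps fps_X S)" for k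
  define u where "u k = \<Phi> (fps_const (U ^ k) * geometric_fps q U)" for k
  let ?a = "fps_const (complex_of_real a)" and ?b = "fps_const (complex_of_real b)"
    and ?t = "fps_const (complex_of_real t)"
  have SA: "S \<in> A" unfolding S_def by (intro A_closed U V)
  have M0: "fps_nth M 0 = 1" and g0: "fps_nth g 0 = 1" by (simp_all add: M_def g_def lin)
  have N0: "fps_nth N 0 = 1" by (simp add: N_def g0)
  have N2: "2 * N = 1 + g"
    by (simp add: N_def numeral_fps_const flip: mult.assoc)
  have Nq: "N * q = fps_X * g"
    using inverse_mult_eq_1[of N] N0 by (simp add: q_def mult.commute mult.left_commute)
  have q0: "fps_nth q 0 = 0" by (simp add: q_def mult.assoc)
  have const_eqs: "fps_const (complex_of_real (a * s)) = ?a * fps_const (of_real s)"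
      "fps_const (complex_of_real (s\<^sup>2)) = (fps_const (of_real s))\<^sup>2"
      "fps_const (complex_of_real (s + 2 * b)) = fps_const (of_real s) + 2 * ?b"
      "fps_const (complex_of_real (s + b)) = fps_const (of_real s) + ?b"
      "fps_const (complex_of_real (2 * s)) = 2 * fps_const (of_real s)" for s
    by (simp_all add: power2_eq_square numeral_fps_const)
  note mU = meixner_moments_1_2[OF EU[folded M_def, unfolded E_def] M0 t]
  have mS: "fps_nth g 1 = 0" "fps_nth g 2 = of_real (2 * t)"
    using meixner_moments_1_2[OF ES[folded S_def, folded g_def, unfolded E_def] g0] t by simp_all
  have Eg: "(?b + 2 * ?a * ?t * fps_X + 4 * ?t\<^sup>2 * fps_X\<^sup>2) * g\<^sup>2
      - (2 * ?t + 2 * ?b + 2 * ?a * ?t * fps_X) * g + (2 * ?t + ?b) = 0"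
    using ES[folded S_def, folded g_def] unfolding E_def const_eqs by algebra
  \<comment> \<open>The value of the resolvent of \<open>U\<close> at \<omega>: both series solve
    the quadratic equation of \<open>U\<close> with \<open>q\<close> substituted and have constant
    term 1. For \<open>N\<close>, the equation is that of \<open>S\<close> at time
    \<open>2 * t\<close> in disguise.\<close>
  have "M oo q = N"
  proof (rule quadratic_root_unique)
    have "E t M oo q = 0" using EU by (simp add: M_def)
    then show "(?b + ?a * ?t * q + ?t\<^sup>2 * q\<^sup>2) * (M oo q)\<^sup>2 - (?t + 2 * ?b + ?a * ?t * q) * (M oo q)
        + (?t + ?b) = 0"
      unfolding E_def const_eqs
      by (simp add: fps_compose_add_distrib fps_compose_sub_distrib fps_compose_mult_distrib[OF q0]
        fps_compose_power[OF q0, symmetric] fps_X_fps_compose_startby0[OF q0])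
    \<comment> \<open>The factor 4 absorbs the halves in \<open>N\<close>; with
      \<open>2 * N = 1 + g\<close> and \<open>N * q = fps_X * g\<close> the expression becomes the
      left side of \<open>Eg\<close>.\<close>
    have "4 * ((?b + ?a * ?t * q + ?t\<^sup>2 * q\<^sup>2) * N\<^sup>2 - (?t + 2 * ?b + ?a * ?t * q) * N + (?t + ?b)) = 0"
      using Eg N2 Nq by algebra
    then show "(?b + ?a * ?t * q + ?t\<^sup>2 * q\<^sup>2) * N\<^sup>2 - (?t + 2 * ?b + ?a * ?t * q) * N + (?t + ?b) = 0"
      unfolding mult_eq_0_iff by (rule disjE) (erule notE[OF zero_neq_numeral[symmetric]], assumption)
    show "fps_nth (M oo q) 0 = 1" using M0 by simp
    show "fps_nth N 0 = 1" by (rule N0)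
    \<comment> \<open>The constant terms differ by \<open>t\<close>: the left one is
      \<open>2 * b\<close>, the right one \<open>t + 2 * b\<close>.\<close>
    show "2 * fps_nth (?b + ?a * ?t * q + ?t\<^sup>2 * q\<^sup>2) 0 \<noteq> fps_nth (?t + 2 * ?b + ?a * ?t * q) 0"
      using t by (simp add: q0 power2_eq_square mult.assoc numeral_fps_const)
  qed
  then have NU: "\<Phi> (geometric_fps q U) = N" and NV: "\<Phi> (geometric_fps q V) = N"
    using state_geometric_fps[OF U q0] state_geometric_fps[OF V q0] same by (simp_all add: M_def)
  have u0: "u 0 = N" by (simp add: u_def NU fps_one_mult)
  have r0: "r 0 = g"
    using state_geometric_fps[OF SA, of fps_X] by (simp add: r_def fps_one_mult g_def)
  have ustep: "u k = fps_const (fps_nth M k) + q * u (Suc k)" for k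
    using state_power_geometric[OF U q0, of k] by (simp add: u_def M_def)
  have rstep: "r k = fps_const (fps_nth g k) + fps_X * r (Suc k)" for k
    using state_power_geometric[OF SA, of fps_X k] by (simp add: r_def g_def)
  have "U ^ 3 \<in> generated_algebra U" by (rule generated_algebra_closed)
  from state_resolvent_sum[OF q0 Nq[unfolded g_def S_def] N2[unfolded g_def S_def] NU NV this]
  have L: "N * \<Phi> (fps_const (U ^ 3) * geometric_fps fps_X S) = g * u 3"
    by (simp add: g_def S_def u_def)
  have nums: "Suc 0 = 1" "Suc 1 = 2" "Suc 2 = 3" by simp_all
  \<comment> \<open>The moments of order 0, 1, 2 of \<open>U\<close> are 1, 0 and \<open>t\<close>;
    three steps of the geometric series leave only the resolvent weighted with
    \<open>U ^ 3\<close>.\<close>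
  have chainU: "N = 1 + q * (q * (?t + q * u 3))"
    using ustep[of 0] ustep[of 1] ustep[of 2] M0 mU unfolding u0 nums by simp
  have chainS: "g = 1 + fps_X * r 1" "r 1 = fps_X * r 2" "r 2 = 2 * ?t + fps_X * r 3"
    using rstep[of 0] rstep[of 1] rstep[of 2] g0 mS unfolding r0 nums by (simp_all add: const_eqs)
  have "g \<noteq> 0" "N \<noteq> 0" using g0 N0 by (metis fps_zero_nth zero_neq_one)+
  from cubic_moment_identity[OF Eg N2 Nq chainU L chainS _ this]
  have "2 * (?b + 2 * ?t)\<^sup>2 * \<Phi> (fps_const (U ^ 3) * geometric_fps fps_X S)
    = (?b + ?t)\<^sup>2 * r 3 + 2 * ?a * ?t * (?b + ?t) * r 2
      + ((?b + ?a\<^sup>2) * ?t\<^sup>2 + 2 * ?t\<^sup>2 * (?b + 2 * ?t)) * r 1 + 2 * ?a * ?t ^ 3 * r 0"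
    by (simp add: r0)
  also have "2 * (?b + 2 * ?t)\<^sup>2 = fps_const (of_real (2 * (b + 2 * t)\<^sup>2))"
    by (simp add: power2_eq_square numeral_fps_const)
  also have "(?b + ?t)\<^sup>2 = fps_const (of_real ((b + t)\<^sup>2))" by (simp add: power2_eq_square)
  also have "2 * ?a * ?t * (?b + ?t) = fps_const (of_real (2 * a * t * (b + t)))"
    by (simp add: numeral_fps_const)
  also have "(?b + ?a\<^sup>2) * ?t\<^sup>2 + 2 * ?t\<^sup>2 * (?b + 2 * ?t)
      = fps_const (of_real ((b + a\<^sup>2) * t\<^sup>2 + 2 * t\<^sup>2 * (b + 2 * t)))"
    by (simp add: power2_eq_square numeral_fps_const)
  also have "2 * ?a * ?t ^ 3 = fps_const (of_real (2 * a * t ^ 3))"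
    by (simp add: power3_eq_cube numeral_fps_const)
  finally have "fps_nth (fps_const (of_real (2 * (b + 2 * t)\<^sup>2)) * \<Phi> (fps_const (U ^ 3) * geometric_fps fps_X S)) n
    = fps_nth (fps_const (of_real ((b + t)\<^sup>2)) * r 3 + fps_const (of_real (2 * a * t * (b + t))) * r 2
      + fps_const (of_real ((b + a\<^sup>2) * t\<^sup>2 + 2 * t\<^sup>2 * (b + 2 * t))) * r 1
      + fps_const (of_real (2 * a * t ^ 3)) * r 0) n" by (rule arg_cong)
  moreover have "fps_nth (r k) n = \<tau> (S ^ (n + k))" for k
    by (simp add: r_def fps_state_def geometric_fps_X add.commute flip: power_add)
  moreover have "fps_nth (\<Phi> (fps_const (U ^ 3) * geometric_fps fps_X S)) n = \<tau> (U ^ 3 * S ^ n)"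
    by (simp add: fps_state_def geometric_fps_X)
  ultimately show ?thesis
    by (simp only: fps_add_nth fps_mult_left_const_nth S_def[symmetric] add_0_right)
qed

end

section \<open>Application to the free Levy process\<close>

lemma free_algebras_cong:
  assumes "\<And>i. i \<in> I \<Longrightarrow> \<B> i = \<C> i" and "free_algebras \<tau> I \<B>"
  shows "free_algebras \<tau> I \<C>"
  unfolding free_algebras_def
proof (intro allI impI)
  fix "is" Ts
  assume *: "is \<noteq> [] \<and> set is \<subseteq> I \<and> distinct_adj is \<and> length Ts = length is \<and>
    (\<forall>k<length is. Ts ! k \<in> \<C> (is ! k) \<and> \<tau> (Ts ! k) = 0)"
  have "\<forall>k<length is. Ts ! k \<in> \<B> (is ! k) \<and> \<tau> (Ts ! k) = 0"
  proof (intro allI impI)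
    fix k assume k: "k < length is"
    then have "is ! k \<in> I" using * nth_mem by blast
    then show "Ts ! k \<in> \<B> (is ! k) \<and> \<tau> (Ts ! k) = 0" using * k assms(1) by simp
  qed
  with * assms(2) show "\<tau> (prod_list Ts) = 0" unfolding free_algebras_def by blast
qed

text \<open>Freeness of increments is applied to the partition 0, \<open>t\<close>,
  \<open>2 * t\<close>; since the process starts at 0, the first increment is \<open>X t\<close>
  itself.\<close>

lemma free_levy_pair:
  assumes "free_levy_process A \<tau> X" and t: "t > 0"
  shows "free_algebras \<tau> {..<2::nat} (\<lambda>i. generated_algebra (if i = 0 then X t else X (2 * t) - X t))"
proof -
  have X0: "X 0 = 0"
    and free: "\<And>(s :: nat \<Rightarrow> real) n. 0 \<le> s 0 \<and> (\<forall>i<n. s i < s (Suc i)) \<longrightarrow>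
        free_elements \<tau> {..<n} (\<lambda>i. X (s (Suc i)) - X (s i))"
    using assms(1) unfolding free_levy_process_def by blast+
  have "free_elements \<tau> {..<2::nat} (\<lambda>i. X (real (Suc i) * t) - X (real i * t))"
    using free[of "\<lambda>i. real i * t" 2] t by simp
  then have "free_algebras \<tau> {..<2::nat} (\<lambda>i. generated_algebra (X (real (Suc i) * t) - X (real i * t)))"
    unfolding free_elements_def .
  then show ?thesis
  proof (rule free_algebras_cong[rotated])
    fix i :: nat assume "i \<in> {..<2}"
    then have "i = 0 \<or> i = 1" by auto
    then show "generated_algebra (X (real (Suc i) * t) - X (real i * t))
        = generated_algebra (if i = 0 then X t else X (2 * t) - X t)"
      by (auto simp: X0)
  qed
qed

lemma free_levy_moments:
  assumes "free_levy_process A \<tau> X" "s \<ge> 0" "s' \<ge> 0" "t \<ge> 0"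
  shows "\<tau> ((X (s + t) - X s) ^ n) = \<tau> ((X (s' + t) - X s') ^ n)"
proof -
  obtain \<nu> where "\<forall>t\<ge>0. \<forall>s\<ge>0. is_law \<tau> (X (t + s) - X t) (\<nu> s)"
    using assms(1) unfolding free_levy_process_def by blast
  then show ?thesis using assms(2-4) unfolding is_law_def by simp
qed

lemma scaleR_bop_power: "(c *\<^sub>R T) ^ n = c ^ n *\<^sub>R (T ^ n :: 'a::complex_inner bop)"
  by (induction n) auto

theorem proposition3p6:
  fixes A :: "'h::chilbert_space bop set"
    and \<tau> :: "'h bop \<Rightarrow> complex"
    and X :: "real \<Rightarrow> 'h bop"
    and a b t :: real
  assumes "von_neumann_algebra A"
    and "normal_faithful_tracial_state A \<tau>"
    and "b \<ge> 0"
    and "free_levy_process A \<tau> X"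
    and "\<And>t s. t > 0 \<Longrightarrow> s > 0 \<Longrightarrow>
           has_free_meixner_law \<tau> ((1 / sqrt s) *\<^sub>R (X (t + s) - X t)) (a / sqrt s) (b / s)"
    and "t > 0"
  shows "cond_expectation \<tau> (X t ^ 3) (X (2 * t)) =
      (1 / (8 * (b + 2 * t)\<^sup>2)) *\<^sub>R
        (b\<^sup>2 *\<^sub>R X (2 * t) ^ 3 + (4 * b * a * t) *\<^sub>R X (2 * t) ^ 2
          + (4 * (b + a\<^sup>2) * t\<^sup>2) *\<^sub>R X (2 * t) + (8 * a * t ^ 3) *\<^sub>R 1)
      + (1 / 8) *\<^sub>R X (2 * t) ^ 3
      + (1 / (4 * (b + 2 * t))) *\<^sub>R
        ((4 * t\<^sup>2) *\<^sub>R X (2 * t) + (2 * t * a) *\<^sub>R X (2 * t) ^ 2 + b *\<^sub>R X (2 * t) ^ 3)"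
    (is "_ = ?E")
proof -
  define S where "S = X (2 * t)"
  define d where "d = b + 2 * t"
  have d: "d > 0" using assms(3,6) by (simp add: d_def)
  have XA: "X s \<in> A" "self_adjoint (X s)" if "s \<ge> 0" for s
    using assms(4) that unfolding free_levy_process_def by blast+
  have X0: "X 0 = 0" using assms(4) unfolding free_levy_process_def by blast
  interpret free_pair A \<tau> "X t" "S - X t"
  proof
    show "free_algebras \<tau> {..<2::nat} (\<lambda>i. generated_algebra (if i = 0 then X t else S - X t))"
      unfolding S_def by (rule free_levy_pair[OF assms(4,6)])
  qed (use assms XA in \<open>auto simp: S_def vna_closed[OF assms(1)]\<close>)
  have SA: "S \<in> A" using XA assms(6) by (simp add: S_def)
  have sum: "X t + (S - X t) = S" by simp
  have homogeneous: "\<tau> ((c *\<^sub>R T) ^ n) = of_real (c ^ n) * \<tau> (T ^ n)" if "T \<in> A" for T c n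
    unfolding scaleR_bop_power by (intro lin A_closed that)
  \<comment> \<open>The Meixner hypothesis speaks of increments that begin at a positive time.
    Stationarity carries it to \<open>X t\<close> and \<open>X (2 * t)\<close>, which begin at time
    0, and also makes the two halves of \<open>X (2 * t)\<close> equally distributed.\<close>
  have same: "\<tau> ((S - X t) ^ n) = \<tau> (X t ^ n)" for n
    using free_levy_moments[OF assms(4), of t 0 t n] assms(6) by (simp add: S_def X0)
  have sameS: "\<tau> ((X (t + 2 * t) - X t) ^ n) = \<tau> (S ^ n)" for n
    using free_levy_moments[OF assms(4), of t 0 "2 * t" n] assms(6) by (simp add: S_def X0)
  have "X (t + 2 * t) - X t \<in> A" "X (t + t) - X t \<in> A" using XA assms(6) by (auto intro!: A_closed)
  moreover have t2: "2 * t > 0" using assms(6) by simp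
  ultimately have
    quad: "(fps_const (of_real b) + fps_const (of_real (a * t)) * fps_X + fps_const (of_real (t\<^sup>2)) * fps_X\<^sup>2)
        * (Abs_fps (\<lambda>n. \<tau> ((X (t + t) - X t) ^ n)))\<^sup>2
      - (fps_const (of_real (t + 2 * b)) + fps_const (of_real (a * t)) * fps_X)
        * Abs_fps (\<lambda>n. \<tau> ((X (t + t) - X t) ^ n))
      + fps_const (of_real (t + b)) = 0"
    "(fps_const (of_real b) + fps_const (of_real (a * (2 * t))) * fps_X + fps_const (of_real ((2 * t)\<^sup>2)) * fps_X\<^sup>2)
        * (Abs_fps (\<lambda>n. \<tau> ((X (t + 2 * t) - X t) ^ n)))\<^sup>2
      - (fps_const (of_real (2 * t + 2 * b)) + fps_const (of_real (a * (2 * t))) * fps_X)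
        * Abs_fps (\<lambda>n. \<tau> ((X (t + 2 * t) - X t) ^ n))
      + fps_const (of_real (2 * t + b)) = 0"
    using moment_fps_quadratic[OF homogeneous assms(6) assms(5)[OF assms(6,6)]]
      moment_fps_quadratic[OF homogeneous t2 assms(5)[OF assms(6) t2]] by blast+
  have same': "\<tau> ((X (t + t) - X t) ^ n) = \<tau> (X t ^ n)" for n
    using same[of n] by (simp add: S_def)
  have moments: "of_real (2 * d\<^sup>2) * \<tau> (X t ^ 3 * S ^ n)
    = of_real ((b + t)\<^sup>2) * \<tau> (S ^ (n + 3)) + of_real (2 * a * t * (b + t)) * \<tau> (S ^ (n + 2))
      + of_real ((b + a\<^sup>2) * t\<^sup>2 + 2 * t\<^sup>2 * d) * \<tau> (S ^ (n + 1)) + of_real (2 * a * t ^ 3) * \<tau> (S ^ n)" for n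
    unfolding d_def
  proof (rule free_meixner_cubic_moments[unfolded sum])
    show "t > 0" by fact
    show "\<tau> ((S - X t) ^ n) = \<tau> (X t ^ n)" for n by (rule same)
  qed (rule quad[unfolded same' sameS])+
  \<comment> \<open>The coefficients of the moment identity divided by \<open>2 * d\<^sup>2\<close>.
    They agree with the grouped ones of the claim: for the cubic term, \<open>b\<^sup>2 / (8
    d\<^sup>2) + 1 / 8 + b / (4 d) = (b + d)\<^sup>2 / (8 d\<^sup>2)\<close>, and
    \<open>b + d = 2 (b + t)\<close>.\<close>
  define c1 where "c1 = ((b + a\<^sup>2) * t\<^sup>2 + 2 * t\<^sup>2 * d) / (2 * d\<^sup>2)"
  define c2 where "c2 = 2 * a * t * (b + t) / (2 * d\<^sup>2)"
  define c3 where "c3 = (b + t)\<^sup>2 / (2 * d\<^sup>2)"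
  define c0 where "c0 = 2 * a * t ^ 3 / (2 * d\<^sup>2)"
  have E: "?E = c3 *\<^sub>R S ^ 3 + c2 *\<^sub>R S ^ 2 + c1 *\<^sub>R S + c0 *\<^sub>R 1"
  proof -
    \<comment> \<open>Naming the reciprocal turns the comparison of coefficients into polynomial
      identities modulo \<open>d * e = 1\<close>.\<close>
    define e where "e = 1 / d"
    have e: "1 / (8 * d\<^sup>2) = e\<^sup>2 / 8" "1 / (4 * d) = e / 4" using d by (simp_all add: e_def power2_eq_square)
    have de: "d * e = 1" using d by (simp add: e_def)
    have inv: "x / (2 * d\<^sup>2) = x * e\<^sup>2 / 2" for x using d by (simp add: e_def power2_eq_square)
    have "8 * c3 = 8 * (e\<^sup>2 / 8 * b\<^sup>2 + 1 / 8 + e / 4 * b)"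
      "2 * c2 = 2 * (e\<^sup>2 / 8 * (4 * b * a * t) + e / 4 * (2 * t * a))"
      "2 * c1 = 2 * (e\<^sup>2 / 8 * (4 * (b + a\<^sup>2) * t\<^sup>2) + e / 4 * (4 * t\<^sup>2))"
      unfolding c1_def c2_def c3_def inv using de[unfolded d_def] unfolding d_def
      by (simp_all, algebra+)
    then have "c3 = e\<^sup>2 / 8 * b\<^sup>2 + 1 / 8 + e / 4 * b"
      and "c2 = e\<^sup>2 / 8 * (4 * b * a * t) + e / 4 * (2 * t * a)"
      and "c1 = e\<^sup>2 / 8 * (4 * (b + a\<^sup>2) * t\<^sup>2) + e / 4 * (4 * t\<^sup>2)"
      by (simp_all only: mult_left_cancel[OF zero_neq_numeral[symmetric]])
    moreover have "c0 = e\<^sup>2 / 8 * (8 * a * t ^ 3)"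
      unfolding c0_def inv by simp
    ultimately show ?thesis
      unfolding d_def[symmetric] S_def[symmetric] e
      by (simp only: scaleR_add_right scaleR_add_left scaleR_scaleR ac_simps)
  qed
  let ?F = "c3 *\<^sub>R S ^ 3 + c2 *\<^sub>R S\<^sup>2 + c1 *\<^sub>R S + c0 *\<^sub>R 1"
  have "cond_expectation \<tau> (X t ^ 3) S = ?F"
  proof (rule cond_expectation_eqI[OF assms(1,2)])
    show "self_adjoint S" unfolding S_def by (rule XA) (use assms(6) in simp)
    show "S \<in> A" by (rule SA)
    show "X t ^ 3 \<in> A" by (intro A_closed U)
    show "?F \<in> generated_vna {S}" by (intro generated_vna_closed)
    fix n
    have "?F * S ^ n = c3 *\<^sub>R S ^ (n + 3) + c2 *\<^sub>R S ^ (n + 2) + c1 *\<^sub>R S ^ (n + 1) + c0 *\<^sub>R S ^ n"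
    proof -
      have "S ^ k * S ^ n = S ^ (n + k)" for k by (simp add: add.commute flip: power_add)
      from this[of 3] this[of 2] this[of 1] show ?thesis by (simp add: distrib_right)
    qed
    then have "\<tau> (?F * S ^ n) = of_real c3 * \<tau> (S ^ (n + 3)) + of_real c2 * \<tau> (S ^ (n + 2))
        + of_real c1 * \<tau> (S ^ (n + 1)) + of_real c0 * \<tau> (S ^ n)"
      using SA by (simp only: lin A_closed)
    also have "of_real (2 * d\<^sup>2) * \<dots> = of_real (2 * d\<^sup>2) * \<tau> (X t ^ 3 * S ^ n)"
    proof -
      have scale: "of_real (2 * d\<^sup>2) * (of_real (x / (2 * d\<^sup>2)) * z) = of_real x * z" for x and z :: complex
        using d by simp
      show ?thesis
        unfolding moments distrib_left c0_def c1_def c2_def c3_def scale ..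
    qed
    finally show "\<tau> (X t ^ 3 * S ^ n) = \<tau> (?F * S ^ n)" using d by simp
  qed
  then show ?thesis unfolding E S_def .
qed

end
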